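(* Let $\mathbf{A}$ be a strongly discrete commutative ring. One can test whether a matrix $A\in\mathbf{A}^{m\times n}$ is locally simple and, in case of a positive answer, compute a generalized inverse of the matrix. Let $p=\min(m,n)$ and $q=\max(m,n)$. If the ring is $O(n^s)$-strongly discrete, these computations use $O(p^6q^2+pq^4)$ arithmetic operations and $O(p^4q+pq^{2s+1})$ other elementary operations. Within the same complexity bounds, one computes a generalized inverse of $A$ and projection matrices onto the kernel and onto the image of $A$.
   Context: A matrix $A\in\mathbf{A}^{m\times n}$ is locally simple if its image is a direct summand of $\mathbf{A}^m$. A generalized inverse of $A$ is a matrix $B\in\mathbf{A}^{n\times m}$ with $ABA=A$ and $BAB=B$. A commutative ring $\mathbf{A}$ is strongly discrete if there is an explicit membership test for finitely generated ideals: given $x,x_1,\dots,x_r\in\mathbf{A}$, decide whether $x\in\langle x_1,\dots,x_r\rangle$ and, in the positive case, return coefficients expressing $x$ as a linear combination of the $x_i$. It is $O(n^s)$-strongly discrete if this test for $n$ generators uses $O(n^s)$ elementary operations (in particular the test of equality to $0$ uses a bounded number of them). An elementary operation is either a basic arithmetic operation in $\mathbf{A}$ or one of the elementary operations used in the membership test. *)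

theory Defs
  imports Complex_Main "Jordan_Normal_Form.Matrix_Kernel"
begin

section \<open>Matrices\<close>

definition mat_image :: "'a :: comm_ring_1 mat \<Rightarrow> 'a vec set" where
  "mat_image A = {A *\<^sub>v x | x. x \<in> carrier_vec (dim_col A)}"

definition direct_summand :: "nat \<Rightarrow> 'a :: comm_ring_1 vec set \<Rightarrow> bool" where
  "direct_summand m W \<longleftrightarrow>
     submodule class_ring W (module_vec TYPE('a) m) \<and>
     (\<exists>N. submodule class_ring N (module_vec TYPE('a) m) \<and>
          {v + w | v w. v \<in> W \<and> w \<in> N} = carrier_vec m \<and> W \<inter> N = {0\<^sub>v m})"

definition locally_simple :: "'a :: comm_ring_1 mat \<Rightarrow> bool" where
  "locally_simple A \<longleftrightarrow> direct_summand (dim_row A) (mat_image A)"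

definition generalized_inverse :: "'a :: comm_ring_1 mat \<Rightarrow> 'a mat \<Rightarrow> bool" where
  "generalized_inverse A B \<longleftrightarrow>
     B \<in> carrier_mat (dim_col A) (dim_row A) \<and> A * B * A = A \<and> B * A * B = B"

definition projection_onto :: "nat \<Rightarrow> 'a :: comm_ring_1 mat \<Rightarrow> 'a vec set \<Rightarrow> bool" where
  "projection_onto k P W \<longleftrightarrow> P \<in> carrier_mat k k \<and> P * P = P \<and> mat_image P = W"


section \<open>Strongly discrete rings\<close>

definition lin_comb :: "'a :: comm_ring_1 list \<Rightarrow> 'a list \<Rightarrow> 'a" where
  "lin_comb cs xs = (\<Sum>i<length xs. cs ! i * xs ! i)"

definition fg_ideal :: "'a :: comm_ring_1 list \<Rightarrow> 'a set" where
  "fg_ideal xs = {lin_comb cs xs | cs. length cs = length xs}"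

text \<open>
  A membership test is a function \<open>member\<close>: the value \<open>member x xs\<close> is the answer to the question
  whether \<open>x\<close> lies in the ideal generated by \<open>xs\<close>; a positive answer carries coefficients.
\<close>

definition strongly_discrete :: "('a :: comm_ring_1 \<Rightarrow> 'a list \<Rightarrow> 'a list option) \<Rightarrow> bool" where
  "strongly_discrete member \<longleftrightarrow>
     (\<forall>x xs. case member x xs of
        None \<Rightarrow> x \<notin> fg_ideal xs
      | Some cs \<Rightarrow> length cs = length xs \<and> x = lin_comb cs xs)"

text \<open>
  \<open>ops x xs\<close> is the number of elementary operations spent by the membership test on the
  question \<open>x \<in> \<langle>xs\<rangle>\<close>. The empty list is allowed: \<open>x \<in> \<langle>\<rangle>\<close> is the test \<open>x = 0\<close>, whose cost is
  bounded because of \<open>max 1\<close>.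
\<close>

definition O_strongly_discrete :: "('a :: comm_ring_1 \<Rightarrow> 'a list \<Rightarrow> nat) \<Rightarrow> real \<Rightarrow> bool" where
  "O_strongly_discrete ops s \<longleftrightarrow>
     (\<exists>K. \<forall>x xs. real (ops x xs) \<le> K * real (max 1 (length xs)) powr s)"


section \<open>Algorithms over a strongly discrete ring\<close>

text \<open>
  Programs work on natural number variables, which serve for the control flow, and on arrays of
  ring elements, whose cells are addressed by lists of natural numbers. The ring is a black box:
  a program has only the constants 0 and 1, the operations \<open>+\<close>, \<open>-\<close>, \<open>*\<close> and the membership test.
  Its syntax does not mention the ring, the numbers of rows and columns are inputs, and the
  control flow depends on ring elements only through the answers of membership tests.
\<close>

type_synonym vname = string

datatype nexp =
    NConst nat
  | NVar vname
  | NAdd nexp nexp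
  | NSub nexp nexp
  | NMul nexp nexp
  | NDiv nexp nexp
  | NMod nexp nexp

datatype bexp =
    BEq nexp nexp
  | BLess nexp nexp
  | BNot bexp
  | BAnd bexp bexp

datatype rexp =
    RZero
  | ROne
  | RCell vname "nexp list"
  | RAdd rexp rexp
  | RSub rexp rexp
  | RMul rexp rexp

text \<open>
  \<open>Member b x g k c\<close> asks whether the value of \<open>x\<close> belongs to the ideal generated by
  \<open>g[0], \<dots>, g[k-1]\<close>, sets \<open>b\<close> to 1 or 0 and, in the positive case, stores coefficients in
  \<open>c[0], \<dots>, c[k-1]\<close>.
\<close>

datatype com =
    Skip
  | NAssign vname nexp
  | RAssign vname "nexp list" rexp
  | Member vname rexp vname nexp vname
  | Seq com com
  | If bexp com com
  | While bexp com

type_synonym nstore = "vname \<Rightarrow> nat"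
type_synonym 'a rstore = "vname \<Rightarrow> nat list \<Rightarrow> 'a"

fun nval :: "nexp \<Rightarrow> nstore \<Rightarrow> nat" where
  "nval (NConst k) \<nu> = k"
| "nval (NVar x) \<nu> = \<nu> x"
| "nval (NAdd a b) \<nu> = nval a \<nu> + nval b \<nu>"
| "nval (NSub a b) \<nu> = nval a \<nu> - nval b \<nu>"
| "nval (NMul a b) \<nu> = nval a \<nu> * nval b \<nu>"
| "nval (NDiv a b) \<nu> = nval a \<nu> div nval b \<nu>"
| "nval (NMod a b) \<nu> = nval a \<nu> mod nval b \<nu>"

fun bval :: "bexp \<Rightarrow> nstore \<Rightarrow> bool" where
  "bval (BEq a b) \<nu> \<longleftrightarrow> nval a \<nu> = nval b \<nu>"
| "bval (BLess a b) \<nu> \<longleftrightarrow> nval a \<nu> < nval b \<nu>"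
| "bval (BNot a) \<nu> \<longleftrightarrow> \<not> bval a \<nu>"
| "bval (BAnd a b) \<nu> \<longleftrightarrow> bval a \<nu> \<and> bval b \<nu>"

fun rval :: "rexp \<Rightarrow> nstore \<Rightarrow> 'a :: comm_ring_1 rstore \<Rightarrow> 'a" where
  "rval RZero \<nu> \<rho> = 0"
| "rval ROne \<nu> \<rho> = 1"
| "rval (RCell x is) \<nu> \<rho> = \<rho> x (map (\<lambda>i. nval i \<nu>) is)"
| "rval (RAdd a b) \<nu> \<rho> = rval a \<nu> \<rho> + rval b \<nu> \<rho>"
| "rval (RSub a b) \<nu> \<rho> = rval a \<nu> \<rho> - rval b \<nu> \<rho>"
| "rval (RMul a b) \<nu> \<rho> = rval a \<nu> \<rho> * rval b \<nu> \<rho>"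

fun arith_ops :: "rexp \<Rightarrow> nat" where
  "arith_ops RZero = 0"
| "arith_ops ROne = 0"
| "arith_ops (RCell x is) = 0"
| "arith_ops (RAdd a b) = 1 + arith_ops a + arith_ops b"
| "arith_ops (RSub a b) = 1 + arith_ops a + arith_ops b"
| "arith_ops (RMul a b) = 1 + arith_ops a + arith_ops b"

definition gens :: "'a rstore \<Rightarrow> vname \<Rightarrow> nat \<Rightarrow> 'a list" where
  "gens \<rho> g k = map (\<lambda>i. \<rho> g [i]) [0..<k]"

definition store_cell :: "vname \<Rightarrow> nat list \<Rightarrow> 'a \<Rightarrow> 'a rstore \<Rightarrow> 'a rstore" where
  "store_cell x is v \<rho> = \<rho>(x := (\<rho> x)(is := v))"

definition store_list :: "vname \<Rightarrow> 'a list \<Rightarrow> 'a rstore \<Rightarrow> 'a rstore" where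
  "store_list c cs \<rho> =
     \<rho>(c := \<lambda>is. if \<exists>i<length cs. is = [i] then cs ! hd is else \<rho> c is)"

text \<open>
  \<open>exec member ops P (\<nu>, \<rho>) a e (\<nu>', \<rho>')\<close>: the program \<open>P\<close>, started in \<open>(\<nu>, \<rho>)\<close>, terminates in
  \<open>(\<nu>', \<rho>')\<close> after \<open>a\<close> arithmetic operations and \<open>e\<close> other elementary operations, the latter
  being all those spent inside membership tests.
\<close>

inductive exec ::
  "('a :: comm_ring_1 \<Rightarrow> 'a list \<Rightarrow> 'a list option) \<Rightarrow> ('a \<Rightarrow> 'a list \<Rightarrow> nat) \<Rightarrow>
   com \<Rightarrow> nstore \<times> 'a rstore \<Rightarrow> nat \<Rightarrow> nat \<Rightarrow> nstore \<times> 'a rstore \<Rightarrow> bool"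
  for member ops where
  Skip: "exec member ops Skip \<sigma> 0 0 \<sigma>"
| NAssign: "exec member ops (NAssign x a) (\<nu>, \<rho>) 0 0 (\<nu>(x := nval a \<nu>), \<rho>)"
| RAssign: "exec member ops (RAssign x is r) (\<nu>, \<rho>) (arith_ops r) 0
     (\<nu>, store_cell x (map (\<lambda>i. nval i \<nu>) is) (rval r \<nu> \<rho>) \<rho>)"
| MemberYes: "y = rval r \<nu> \<rho> \<Longrightarrow> xs = gens \<rho> g (nval k \<nu>) \<Longrightarrow> member y xs = Some cs \<Longrightarrow>
     exec member ops (Member b r g k c) (\<nu>, \<rho>) (arith_ops r) (ops y xs)
       (\<nu>(b := 1), store_list c cs \<rho>)"
| MemberNo: "y = rval r \<nu> \<rho> \<Longrightarrow> xs = gens \<rho> g (nval k \<nu>) \<Longrightarrow> member y xs = None \<Longrightarrow>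
     exec member ops (Member b r g k c) (\<nu>, \<rho>) (arith_ops r) (ops y xs) (\<nu>(b := 0), \<rho>)"
| Seq: "exec member ops P \<sigma> a e \<sigma>' \<Longrightarrow> exec member ops Q \<sigma>' a' e' \<sigma>'' \<Longrightarrow>
     exec member ops (Seq P Q) \<sigma> (a + a') (e + e') \<sigma>''"
| IfTrue: "bval t (fst \<sigma>) \<Longrightarrow> exec member ops P \<sigma> a e \<sigma>' \<Longrightarrow> exec member ops (If t P Q) \<sigma> a e \<sigma>'"
| IfFalse: "\<not> bval t (fst \<sigma>) \<Longrightarrow> exec member ops Q \<sigma> a e \<sigma>' \<Longrightarrow> exec member ops (If t P Q) \<sigma> a e \<sigma>'"
| WhileFalse: "\<not> bval t (fst \<sigma>) \<Longrightarrow> exec member ops (While t P) \<sigma> 0 0 \<sigma>"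
| WhileTrue: "bval t (fst \<sigma>) \<Longrightarrow> exec member ops P \<sigma> a e \<sigma>' \<Longrightarrow>
     exec member ops (While t P) \<sigma>' a' e' \<sigma>'' \<Longrightarrow>
     exec member ops (While t P) \<sigma> (a + a') (e + e') \<sigma>''"

inductive_cases exec_SkipE: "exec member ops Skip \<sigma> a e \<sigma>'"
inductive_cases exec_NAssignE: "exec member ops (NAssign x n) \<sigma> a e \<sigma>'"
inductive_cases exec_RAssignE: "exec member ops (RAssign x is r) \<sigma> a e \<sigma>'"
inductive_cases exec_MemberE: "exec member ops (Member b r g k c) \<sigma> a e \<sigma>'"
inductive_cases exec_SeqE: "exec member ops (Seq P Q) \<sigma> a e \<sigma>'"
inductive_cases exec_IfE: "exec member ops (If t P Q) \<sigma> a e \<sigma>'"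
inductive_cases exec_WhileE: "exec member ops (While t P) \<sigma> a e \<sigma>'"

lemma exec_deterministic:
  assumes "exec member ops P \<sigma> a1 e1 \<sigma>1" and "exec member ops P \<sigma> a2 e2 \<sigma>2"
  shows "a1 = a2 \<and> e1 = e2 \<and> \<sigma>1 = \<sigma>2"
  using assms
proof (induction arbitrary: a2 e2 \<sigma>2 rule: exec.induct)
  case (Skip \<sigma>)
  then show ?case by (auto elim: exec_SkipE)
next
  case (NAssign x a \<nu> \<rho>)
  then show ?case by (auto elim: exec_NAssignE)
next
  case (RAssign x "is" r \<nu> \<rho>)
  then show ?case by (auto elim: exec_RAssignE)
next
  case (MemberYes y r \<nu> \<rho> xs g k cs b c)
  from MemberYes.prems MemberYes.hyps show ?case by (auto elim!: exec_MemberE)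
next
  case (MemberNo y r \<nu> \<rho> xs g k b c)
  from MemberNo.prems MemberNo.hyps show ?case by (auto elim!: exec_MemberE)
next
  case (Seq P \<sigma> a e \<sigma>' Q a' e' \<sigma>'')
  from Seq.prems show ?case
    by (rule exec_SeqE) (use Seq.IH in blast)
next
  case (IfTrue t \<sigma> P a e \<sigma>' Q)
  from IfTrue.prems show ?case
    by (rule exec_IfE) (use IfTrue.IH IfTrue.hyps in blast)+
next
  case (IfFalse t \<sigma> Q a e \<sigma>' P)
  from IfFalse.prems show ?case
    by (rule exec_IfE) (use IfFalse.IH IfFalse.hyps in blast)+
next
  case (WhileFalse t \<sigma> P)
  from WhileFalse.prems show ?case
    by (rule exec_WhileE) (use WhileFalse.hyps in blast)+
next
  case (WhileTrue t \<sigma> P a e \<sigma>' a' e' \<sigma>'')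
  from WhileTrue.prems show ?case
    by (rule exec_WhileE) (use WhileTrue.IH WhileTrue.hyps in blast)+
qed

text \<open>
  The input is read from the variables \<open>m\<close>, \<open>n\<close> and the array \<open>A\<close>; all other cells are 0. The
  answer is left in the variable \<open>ok\<close>, and the computed matrices in the arrays \<open>B\<close> (generalized
  inverse), \<open>Ker\<close> and \<open>Im\<close> (projections).
\<close>

definition init_state :: "'a :: comm_ring_1 mat \<Rightarrow> nstore \<times> 'a rstore" where
  "init_state A =
     ((\<lambda>_. 0)(''m'' := dim_row A, ''n'' := dim_col A),
      (\<lambda>x is. if x = ''A'' \<and> length is = 2 \<and> is ! 0 < dim_row A \<and> is ! 1 < dim_col A
              then A $$ (is ! 0, is ! 1) else 0))"

definition stored_mat :: "'a rstore \<Rightarrow> vname \<Rightarrow> nat \<Rightarrow> nat \<Rightarrow> 'a mat" where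
  "stored_mat \<rho> x nr nc = mat nr nc (\<lambda>(i, j). \<rho> x [i, j])"

definition correct_output :: "'a :: comm_ring_1 mat \<Rightarrow> nstore \<times> 'a rstore \<Rightarrow> bool" where
  "correct_output A \<sigma> \<longleftrightarrow> (case \<sigma> of (\<nu>, \<rho>) \<Rightarrow>
     let m = dim_row A; n = dim_col A in
     \<nu> ''ok'' = (if locally_simple A then 1 else 0) \<and>
     (locally_simple A \<longrightarrow>
        generalized_inverse A (stored_mat \<rho> ''B'' n m) \<and>
        projection_onto n (stored_mat \<rho> ''Ker'' n n) (mat_kernel A) \<and>
        projection_onto m (stored_mat \<rho> ''Im'' m m) (mat_image A)))"

end

theory Submission
  imports Defs "Jordan_Normal_Form.Char_Poly" "HOL-Computational_Algebra.Formal_Power_Series"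
begin

text \<open>
  After transposing, let \<open>S\<close> be a \<open>p \<times> q\<close> matrix with \<open>p \<le> q\<close>, and let \<open>G\<close> be its Gram matrix deformed by
  an indeterminate \<open>X\<close>, with entries \<open>\<Sum>\<^sub>j X\<^bsup>2j+2k\<^esup> s\<^sub>i\<^sub>j s\<^sub>k\<^sub>j\<close>. Give \<open>X\<close> weight 1 and the variable \<open>Y\<close> of the
  characteristic polynomial of \<open>G\<close> weight \<open>2(p+q)\<close>. Modulo a maximal ideal, row reduction shows that this
  polynomial has a single term of lowest weight \<open>l\<close>, with an invertible coefficient; it is a multiple of
  \<open>Y\<^sup>k\<close> for \<open>p - k\<close> the rank of \<open>S\<close>, and \<open>l\<close> is at most \<open>2(p+q)p\<close>.

  If \<open>S = SBS\<close>, the coefficients \<open>e\<^sub>k\<close> of \<open>det (Y(1 - SB) + SB)\<close> are orthogonal idempotents with sum 1 that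
  cut the ring into the parts where \<open>S\<close> has corank \<open>k\<close>; on the \<open>k\<close>-th part the adjugate of \<open>Y - G\<close> yields
  matrices that invert \<open>S\<close> up to the coefficients of \<open>Y\<^sup>k\<close>. The idempotents are not given, but they are found by
  membership tests. For each weight \<open>l\<close>, the sum over \<open>k\<close> of the coefficients of weight \<open>l\<close> lies in an ideal
  generated by products of coefficients, because it does so locally. The answers provide, for each \<open>k\<close>,
  a combination \<open>f\<^sub>k\<close> of coefficients that is 1 at the maximal ideals of corank \<open>k\<close>. Then
  \<open>e\<^sub>k f\<^sub>k = f\<^sub>k (1 - \<Sum>\<^sub>j\<^sub><\<^sub>k e\<^sub>j)\<close>, and testing whether this element lies in the ideal of its square returns \<open>e\<^sub>k\<close>.

  So a matrix \<open>X\<close> is computed that satisfies \<open>SXS = S\<close> whenever \<open>S\<close> has a generalized inverse at all. The equation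
  is checked by \<open>pq\<close> zero tests, and \<open>XSX\<close> is the result. The \<open>O(pq)\<close> tests with \<open>O(pq)\<close> generators each account
  for the elementary operations, the power series truncated at degree \<open>O(pq)\<close> for the arithmetic ones.
\<close>

section \<open>Ideals\<close>

text \<open>The corank of \<open>S\<close> varies from one maximal ideal to another, and the ring
  cannot be split before the rank idempotents are known. An undeformed Gram matrix would not help:
  isotropic rows make it lose rank modulo a maximal ideal. In the deformation, the power of
  \<open>X\<close> keeps the squares of the pivots from cancelling. The exponents are doubled so
  that the order of an entry of the reduced matrix is bounded below by a natural number for its row
  plus one for its column; the weight of \<open>Y\<close> exceeds every \<open>2j + 2i\<close>, so a
  row contributes its pivot where it has one and \<open>Y\<close> where it vanishes.

  The bound \<open>p q^(2s+1)\<close> leaves room for \<open>O(pq)\<close> tests with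
  \<open>O(pq)\<close> generators, so one test per weight has to serve all coranks at once. Hence
  the shape of the generators, sums over \<open>k\<close> of a coefficient times a prefix sum over
  coranks, shifted by \<open>k\<close>: on the part of corank \<open>\<kappa>\<close> they form a
  linear system in the coefficients with \<open>k \<ge> \<kappa>\<close> that is triangular, with
  invertible diagonal, modulo the maximal ideal.

  The matrix \<open>B\<close> and its idempotents occur in hypotheses of the verification
  only.\<close>

definition is_ideal :: "'a :: comm_ring_1 set \<Rightarrow> bool" where
  "is_ideal I \<longleftrightarrow> 0 \<in> I \<and> (\<forall>x\<in>I. \<forall>y\<in>I. x + y \<in> I) \<and> (\<forall>x\<in>I. \<forall>c. c * x \<in> I)"

definition is_maximal :: "'a :: comm_ring_1 set \<Rightarrow> bool" where
  "is_maximal M \<longleftrightarrow> is_ideal M \<and> 1 \<notin> M \<and> (\<forall>J. is_ideal J \<longrightarrow> 1 \<notin> J \<longrightarrow> M \<subseteq> J \<longrightarrow> J = M)"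

lemma ideal_0: "is_ideal I \<Longrightarrow> 0 \<in> I"
  and ideal_add: "is_ideal I \<Longrightarrow> x \<in> I \<Longrightarrow> y \<in> I \<Longrightarrow> x + y \<in> I"
  and ideal_mult_left: "is_ideal I \<Longrightarrow> x \<in> I \<Longrightarrow> c * x \<in> I"
  and ideal_mult_right: "is_ideal I \<Longrightarrow> x \<in> I \<Longrightarrow> x * c \<in> I"
  by (auto simp: is_ideal_def mult.commute)

lemma ideal_uminus: "is_ideal I \<Longrightarrow> x \<in> I \<Longrightarrow> - x \<in> I"
  using ideal_mult_left[of I x "- 1"] by simp

lemma ideal_diff: "is_ideal I \<Longrightarrow> x \<in> I \<Longrightarrow> y \<in> I \<Longrightarrow> x - y \<in> I"
  using ideal_add[of I x "- y"] ideal_uminus[of I y] by simp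

lemma ideal_sum: "is_ideal I \<Longrightarrow> (\<And>i. i \<in> S \<Longrightarrow> f i \<in> I) \<Longrightarrow> sum f S \<in> I"
  by (induction S rule: infinite_finite_induct) (auto simp: ideal_0 ideal_add)

lemma ideal_prod:
  assumes "is_ideal I" "finite S" "i \<in> S" "f i \<in> I"
  shows "prod f S \<in> I"
  using assms by (simp add: prod.remove[of S i] ideal_mult_right)

lemma maximal_ideal: "is_maximal M \<Longrightarrow> is_ideal M"
  and maximal_1: "is_maximal M \<Longrightarrow> 1 \<notin> M"
  by (auto simp: is_maximal_def)

lemma maximal_ideal_exists:
  assumes "is_ideal I" "1 \<notin> I"
  shows "\<exists>M. is_maximal M \<and> I \<subseteq> M"
proof -
  let ?A = "{J. is_ideal J \<and> 1 \<notin> J \<and> I \<subseteq> J}"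
  have "\<exists>M\<in>?A. \<forall>X\<in>?A. M \<subseteq> X \<longrightarrow> X = M"
  proof (rule subset_Zorn_nonempty)
    show "?A \<noteq> {}" using assms by auto
    fix C assume ne: "C \<noteq> {}" and ch: "subset.chain ?A C"
    have sub: "C \<subseteq> ?A" and tot: "\<And>X Y. X \<in> C \<Longrightarrow> Y \<in> C \<Longrightarrow> X \<subseteq> Y \<or> Y \<subseteq> X"
      using ch by (auto simp: subset_chain_def)
    have add: "x + y \<in> \<Union>C" if "x \<in> \<Union>C" "y \<in> \<Union>C" for x y
    proof -
      from that obtain X where X: "X \<in> C" "x \<in> X" by blast
      from that obtain Y where Y: "Y \<in> C" "y \<in> Y" by blast
      obtain Z where "Z \<in> C" "x \<in> Z" "y \<in> Z" using tot[of X Y] X Y by blast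
      then show ?thesis using sub ideal_add by blast
    qed
    have "is_ideal (\<Union>C)"
      unfolding is_ideal_def
    proof (intro conjI ballI allI)
      show "0 \<in> \<Union>C" using ne sub ideal_0 by blast
      show "c * x \<in> \<Union>C" if "x \<in> \<Union>C" for c x
        using that sub ideal_mult_left by blast
    qed (use add in blast)
    then show "\<Union>C \<in> ?A" using ne sub by auto
  qed
  then obtain M where M: "M \<in> ?A" "\<forall>X\<in>?A. M \<subseteq> X \<longrightarrow> X = M" by blast
  then have "is_maximal M" unfolding is_maximal_def by blast
  then show ?thesis using M by blast
qed

text \<open>The local-global principle of the development: applied to the set of all
  \<open>b\<close> for which \<open>b * y\<close> has a wanted property, it reduces a claim about
  \<open>y\<close> to one maximal ideal at a time. In the zero ring there is no maximal ideal and
  the second premise is void.\<close>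

lemma ideal_contains_1:
  assumes "is_ideal I" "\<And>M. is_maximal M \<Longrightarrow> I \<subseteq> M \<Longrightarrow> False"
  shows "1 \<in> I"
  using maximal_ideal_exists assms by blast

text \<open>Stands in for the residue field: all computations modulo \<open>M\<close> are phrased as
  memberships in \<open>M\<close>, without a quotient type.\<close>

lemma maximal_inverse:
  assumes M: "is_maximal M" and x: "x \<notin> M"
  shows "\<exists>y. 1 - y * x \<in> M"
proof -
  let ?J = "{m + c * x | m c. m \<in> M}"
  note I = maximal_ideal[OF M]
  have "is_ideal ?J"
    unfolding is_ideal_def
  proof (intro conjI ballI allI)
    show "0 \<in> ?J" using ideal_0[OF I] by (force intro: exI[of _ 0])
  next
    fix u v assume "u \<in> ?J" "v \<in> ?J"
    then obtain m c m' c' where "u = m + c * x" "v = m' + c' * x" "m \<in> M" "m' \<in> M" by auto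
    then show "u + v \<in> ?J"
      by (intro CollectI exI[of _ "m + m'"] exI[of _ "c + c'"]) (auto simp: algebra_simps ideal_add[OF I])
  next
    fix u d assume "u \<in> ?J"
    then obtain m c where "u = m + c * x" "m \<in> M" by auto
    then show "d * u \<in> ?J"
      by (intro CollectI exI[of _ "d * m"] exI[of _ "d * c"]) (auto simp: algebra_simps ideal_mult_left[OF I])
  qed
  moreover have "M \<subseteq> ?J" by (force intro: exI[of _ 0])
  moreover have "x \<in> ?J" using ideal_0[OF I] by (force intro: exI[of _ 1])
  ultimately have "1 \<in> ?J" using M x unfolding is_maximal_def by blast
  then obtain m c where "1 = m + c * x" "m \<in> M" by auto
  then have "1 - c * x \<in> M" by (metis add_diff_cancel_right')
  then show ?thesis by blast
qed

lemma maximal_prime: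
  assumes M: "is_maximal M" and xy: "x * y \<in> M" and x: "x \<notin> M"
  shows "y \<in> M"
proof -
  note I = maximal_ideal[OF M]
  obtain z where "1 - z * x \<in> M" using maximal_inverse[OF M x] by blast
  then have "(1 - z * x) * y + z * (x * y) \<in> M"
    using ideal_mult_left[OF I xy] ideal_mult_right[OF I] ideal_add[OF I] by blast
  then show ?thesis by (simp add: algebra_simps)
qed

lemma maximal_prod:
  assumes M: "is_maximal M" and "\<And>i. i \<in> S \<Longrightarrow> f i \<notin> M"
  shows "prod f S \<notin> M"
  using assms(2)
proof (induction S rule: infinite_finite_induct)
  case (insert i S)
  then show ?case using maximal_prime[OF M, of "f i" "prod f S"] by auto
qed (use maximal_1[OF M] in auto)

section \<open>Ideals generated by a list\<close>

lemma fg_ideal_iff: "y \<in> fg_ideal xs \<longleftrightarrow> (\<exists>x. y = (\<Sum>i<length xs. x i * xs ! i))"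
proof
  assume "\<exists>x. y = (\<Sum>i<length xs. x i * xs ! i)"
  then obtain x where "y = (\<Sum>i<length xs. x i * xs ! i)" by blast
  then have "y = lin_comb (map x [0..<length xs]) xs" by (simp add: lin_comb_def)
  then show "y \<in> fg_ideal xs" unfolding fg_ideal_def by force
qed (auto simp: fg_ideal_def lin_comb_def)

lemma fg_ideal_is_ideal: "is_ideal (fg_ideal xs)"
  unfolding is_ideal_def
proof (intro conjI ballI allI)
  show "0 \<in> fg_ideal xs" unfolding fg_ideal_iff by (rule exI[of _ "\<lambda>_. 0"]) simp
next
  fix x y assume "x \<in> fg_ideal xs" "y \<in> fg_ideal xs"
  then obtain u v where "x = (\<Sum>i<length xs. u i * xs ! i)" "y = (\<Sum>i<length xs. v i * xs ! i)"
    unfolding fg_ideal_iff by blast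
  then show "x + y \<in> fg_ideal xs" unfolding fg_ideal_iff
    by (intro exI[of _ "\<lambda>i. u i + v i"]) (simp add: sum.distrib algebra_simps)
next
  fix x c assume "x \<in> fg_ideal xs"
  then obtain u where "x = (\<Sum>i<length xs. u i * xs ! i)" unfolding fg_ideal_iff by blast
  then show "c * x \<in> fg_ideal xs" unfolding fg_ideal_iff
    by (intro exI[of _ "\<lambda>i. c * u i"]) (simp add: sum_distrib_left algebra_simps)
qed

lemma fg_ideal_gen: "i < length xs \<Longrightarrow> xs ! i \<in> fg_ideal xs"
  unfolding fg_ideal_iff
  by (rule exI[of _ "\<lambda>j. if j = i then 1 else 0"]) (simp add: if_distrib[of "\<lambda>x. x * _"] cong: if_cong)

section \<open>Determinants\<close>

text \<open>The Leibniz expansion with the identity permutation split off. Signs and sums are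
  absorbed by the closure of \<open>N\<close> under negation and addition, so that a level of a
  filtration can be inserted for \<open>N\<close> directly.\<close>

lemma det_minus_diagonal:
  fixes E :: "'b :: comm_ring_1 mat"
  assumes E: "E \<in> carrier_mat n n"
    and N0: "0 \<in> N" and Nadd: "\<And>x y. x \<in> N \<Longrightarrow> y \<in> N \<Longrightarrow> x + y \<in> N"
    and Num: "\<And>x. x \<in> N \<Longrightarrow> - x \<in> N"
    and off: "\<And>\<pi>. \<pi> permutes {0..<n} \<Longrightarrow> \<pi> \<noteq> id \<Longrightarrow> (\<Prod>i=0..<n. E $$ (i, \<pi> i)) \<in> N"
  shows "det E - (\<Prod>i=0..<n. E $$ (i, i)) \<in> N"
proof -
  let ?t = "\<lambda>\<pi>. signof \<pi> * (\<Prod>i=0..<n. E $$ (i, \<pi> i))"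
  have "det E = ?t id + (\<Sum>\<pi>\<in>{\<pi>. \<pi> permutes {0..<n}} - {id}. ?t \<pi>)"
    unfolding det_def'[OF E]
    by (rule sum.remove) (auto simp: finite_permutations permutes_id)
  then have "det E - (\<Prod>i=0..<n. E $$ (i, i)) = (\<Sum>\<pi>\<in>{\<pi>. \<pi> permutes {0..<n}} - {id}. ?t \<pi>)"
    by simp
  moreover have "?t \<pi> \<in> N" if "\<pi> \<in> {\<pi>. \<pi> permutes {0..<n}} - {id}" for \<pi>
    using that off[of \<pi>] Num by (cases \<pi> rule: sign_cases) auto
  then have "(\<Sum>\<pi>\<in>S. ?t \<pi>) \<in> N" if "S \<subseteq> {\<pi>. \<pi> permutes {0..<n}} - {id}" for S
    using that by (induction S rule: infinite_finite_induct) (auto simp: N0 intro!: Nadd)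
  ultimately show ?thesis by simp
qed

text \<open>A permutation other than the identity moves some index upwards, so its product has a
  factor above the diagonal.\<close>

lemma det_triangular_mod:
  assumes E: "E \<in> carrier_mat n n" and N: "is_ideal N"
    and tri: "\<And>i j. i < j \<Longrightarrow> j < n \<Longrightarrow> E $$ (i, j) \<in> N"
  shows "det E - (\<Prod>i=0..<n. E $$ (i, i)) \<in> N"
proof (rule det_minus_diagonal[OF E])
  fix \<pi> assume p: "\<pi> permutes {0..<n}" and ne: "\<pi> \<noteq> id"
  have "\<exists>i<n. i < \<pi> i"
  proof (rule ccontr)
    assume "\<not> ?thesis"
    then have "\<forall>i\<in>{0..<n}. \<pi> i \<le> i" by auto
    then have "\<pi> = id" by (intro permutes_natset_le[OF p]) auto
    then show False using ne by simp
  qed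
  then obtain i where "i < n" "i < \<pi> i" by blast
  moreover have "\<pi> i < n" using permutes_in_image[OF p, of i] \<open>i < n\<close> by auto
  ultimately show "(\<Prod>i=0..<n. E $$ (i, \<pi> i)) \<in> N"
    by (intro ideal_prod[OF N, of _ i]) (auto intro: tri)
qed (auto simp: ideal_0[OF N] ideal_add[OF N] ideal_uminus[OF N])

section \<open>Rank idempotents\<close>

text \<open>The matrix \<open>y (1 - P) + P\<close>: for an idempotent \<open>P\<close> it is
  multiplication by \<open>y\<close> on the kernel of \<open>P\<close> and the identity on the
  image.\<close>

definition pencil :: "'b :: comm_ring_1 \<Rightarrow> 'b mat \<Rightarrow> 'b mat" where
  "pencil y P = mat (dim_row P) (dim_row P) (\<lambda>(i, j). (if i = j then y else 0) + (1 - y) * P $$ (i, j))"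

lemma pencil_carrier: "P \<in> carrier_mat n n \<Longrightarrow> pencil y P \<in> carrier_mat n n"
  by (auto simp: pencil_def)

lemma mult_mat_entry:
  assumes "A \<in> carrier_mat nr n" "B \<in> carrier_mat n nc" "i < nr" "j < nc"
  shows "(A * B) $$ (i, j) = (\<Sum>k<n. A $$ (i, k) * B $$ (k, j))"
  using assms by (simp add: scalar_prod_def atLeast0LessThan)

lemma sum_delta_mult:
  fixes f :: "nat \<Rightarrow> 'b :: comm_ring_1"
  assumes "i < n"
  shows "(\<Sum>k<n. (if i = k then a else 0) * f k) = a * f i"
    and "(\<Sum>k<n. (if k = i then a else 0) * f k) = a * f i"
    and "(\<Sum>k<n. f k * (if i = k then a else 0)) = f i * a"
    and "(\<Sum>k<n. f k * (if k = i then a else 0)) = f i * a"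
  using assms by (simp_all add: if_distrib[of "\<lambda>x. x * _"] if_distrib[of "\<lambda>x. _ * x"] cong: if_cong)

lemma idempotent_sum:
  assumes "P \<in> carrier_mat n n" "P * P = P" "i < n" "j < n"
  shows "(\<Sum>k<n. P $$ (i, k) * P $$ (k, j)) = P $$ (i, j)"
  using mult_mat_entry[OF assms(1,1,3,4)] assms(2) by simp

text \<open>On the image of \<open>P\<close> both factors are the identity, on the kernel they
  multiply by \<open>y\<close> and by \<open>z\<close>.\<close>

lemma pencil_mult:
  assumes P: "P \<in> carrier_mat n n" "P * P = P"
  shows "pencil y P * pencil z P = pencil (y * z) P"
proof (rule eq_matI)
  fix i j assume "i < dim_row (pencil (y * z) P)" "j < dim_col (pencil (y * z) P)"
  then have ij: "i < n" "j < n" using P by (auto simp: pencil_def)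
  have "(pencil y P * pencil z P) $$ (i, j) =
      (\<Sum>k<n. ((if i = k then y else 0) + (1 - y) * P $$ (i, k)) * ((if k = j then z else 0) + (1 - z) * P $$ (k, j)))"
    using P ij by (subst mult_mat_entry[of _ n n _ n]) (auto simp: pencil_def intro!: sum.cong)
  also have "\<dots> = (\<Sum>k<n. (if i = k then y else 0) * (if k = j then z else 0))
      + (\<Sum>k<n. (if i = k then y else 0) * ((1 - z) * P $$ (k, j)))
      + (\<Sum>k<n. (1 - y) * P $$ (i, k) * (if k = j then z else 0))
      + (1 - y) * (1 - z) * (\<Sum>k<n. P $$ (i, k) * P $$ (k, j))"
    by (simp add: sum.distrib[symmetric] sum_distrib_left algebra_simps)
  also have "\<dots> = pencil (y * z) P $$ (i, j)"
    using P ij by (simp add: idempotent_sum sum_delta_mult pencil_def) (simp add: algebra_simps)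
  finally show "(pencil y P * pencil z P) $$ (i, j) = pencil (y * z) P $$ (i, j)" .
qed (use P in \<open>auto simp: pencil_def\<close>)

lemma pencil_1: "P \<in> carrier_mat n n \<Longrightarrow> pencil 1 P = 1\<^sub>m n"
  by (auto simp: pencil_def)

text \<open>The rank polynomial of the complementary idempotent \<open>1 - P\<close>. Over a field
  it is \<open>Y^k\<close> with \<open>k\<close> the corank of \<open>P\<close>.\<close>

definition corank_poly :: "'a :: comm_ring_1 mat \<Rightarrow> 'a poly" where
  "corank_poly P = det (pencil [:0, 1:] (map_mat (\<lambda>a. [:a:]) P))"

lemma degree_det_le:
  fixes A :: "'b :: comm_ring_1 poly mat"
  assumes A: "A \<in> carrier_mat n n" and d: "\<And>i j. i < n \<Longrightarrow> j < n \<Longrightarrow> degree (A $$ (i, j)) \<le> d"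
  shows "degree (det A) \<le> n * d"
  unfolding det_def'[OF A]
proof (rule degree_sum_le)
  fix \<pi> assume p: "\<pi> \<in> {\<pi>. \<pi> permutes {0..<n}}"
  have "degree (\<Prod>i=0..<n. A $$ (i, \<pi> i)) \<le> (\<Sum>i=0..<n. degree (A $$ (i, \<pi> i)))"
    using degree_prod_sum_le[of "{0..<n}" "\<lambda>i. A $$ (i, \<pi> i)"] by (simp add: o_def)
  also have "\<dots> \<le> (\<Sum>i=0..<n. d)"
    using p permutes_in_image[of \<pi> "{0..<n}"] by (intro sum_mono d) auto
  finally show "degree (signof \<pi> * (\<Prod>i=0..<n. A $$ (i, \<pi> i))) \<le> n * d" by simp
qed (simp add: finite_permutations)

lemma degree_corank_poly: "P \<in> carrier_mat n n \<Longrightarrow> degree (corank_poly P) \<le> n"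
proof -
  assume P: "P \<in> carrier_mat n n"
  let ?Q = "pencil [:0, 1:] (map_mat (\<lambda>a. [:a:]) P)"
  have "degree (?Q $$ (i, j)) \<le> 1" if "i < n" "j < n" for i j
  proof -
    have "?Q $$ (i, j) = (if i = j then [:0, 1:] else 0) + smult (P $$ (i, j)) [:1, - 1:]"
      using P that by (simp add: pencil_def one_pCons)
    then show ?thesis by (auto intro!: degree_add_le)
  qed
  then show ?thesis
    using degree_det_le[of ?Q n 1] P by (simp add: corank_poly_def pencil_carrier)
qed

lemma poly_sum_atMost:
  fixes x :: "'b :: comm_ring_1"
  assumes "degree q \<le> n"
  shows "poly q x = (\<Sum>k\<le>n. coeff q k * x ^ k)"
  unfolding poly_altdef using assms by (intro sum.mono_neutral_left) (auto simp: coeff_eq_0)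

text \<open>The pencil at \<open>y\<close> is a specialization of the generic one. An arbitrary
  target ring is allowed because \<open>y\<close> will be an indeterminate over polynomials or over
  power series.\<close>

lemma (in comm_ring_hom) det_pencil:
  assumes P: "P \<in> carrier_mat n n"
  shows "det (pencil y (map_mat hom P)) = (\<Sum>k\<le>n. hom (coeff (corank_poly P) k) * y ^ k)"
proof -
  interpret mp: map_poly_comm_ring_hom hom ..
  let ?Q = "pencil [:0, 1:] (map_mat (\<lambda>a. [:a:]) P)"
  have "pencil y (map_mat hom P) = map_mat (\<lambda>p. poly p y) (map_mat (map_poly hom) ?Q)"
    using P by (intro eq_matI) (auto simp: pencil_def hom_distribs)
  then have "det (pencil y (map_mat hom P)) = poly (map_poly hom (corank_poly P)) y"
    by (simp only: corank_poly_def mp.hom_det comm_ring_hom.hom_det[OF poly_hom.comm_ring_hom_axioms])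
  also have "\<dots> = (\<Sum>k\<le>n. coeff (map_poly hom (corank_poly P)) k * y ^ k)"
    using degree_corank_poly[OF P] degree_map_poly_le[of hom "corank_poly P"]
    by (intro poly_sum_atMost) auto
  finally show ?thesis by simp
qed

lemma const_poly_poly_hom: "comm_ring_hom (\<lambda>a :: 'b :: comm_ring_1. [:[:a:]:])"
  by unfold_locales (auto simp: one_pCons)

lemma const_power: "[:a:] ^ k = [:a ^ k:]" for a :: "'b :: comm_ring_1"
  by (induction k) (auto simp: one_pCons)

text \<open>Writing \<open>r\<close> for the polynomial, \<open>pencil_mult\<close> gives
  \<open>r(Y) r(W) = r(Y W)\<close>. The left side has \<open>e_i e_j\<close> at
  \<open>Y^i W^j\<close>, the right side has diagonal terms only.\<close>

lemma corank_idempotents_orthogonal: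
  assumes P: "P \<in> carrier_mat n n" "P * P = P" and ij: "i \<le> n" "j \<le> n"
  shows "coeff (corank_poly P) i * coeff (corank_poly P) j = (if i = j then coeff (corank_poly P) j else 0)"
proof -
  interpret h: comm_ring_hom "\<lambda>a :: 'a. [:[:a:]:]" by (rule const_poly_poly_hom)
  let ?e = "coeff (corank_poly P)"
  let ?P = "map_mat (\<lambda>a. [:[:a:]:]) P"
  \<comment> \<open>Two independent indeterminates of \<open>'a poly poly\<close>: \<open>?Y\<close>
    is the inner one, \<open>?W\<close> the outer one.\<close>
  let ?Y = "[:monom 1 1:] :: 'a poly poly" and ?W = "monom 1 1 :: 'a poly poly"
  have PP: "?P \<in> carrier_mat n n" "?P * ?P = ?P"
    using P h.mat_hom_mult[OF P(1,1)] by auto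
  have eq: "det (pencil ?Y ?P) * det (pencil ?W ?P) = det (pencil (?Y * ?W) ?P)"
    using det_mult[OF pencil_carrier pencil_carrier, OF PP(1,1), of ?Y ?W]
    unfolding pencil_mult[OF PP] by (rule sym)
  have "[:[:?e k:]:] * ?W ^ k = monom [:?e k:] k" for k
    by (simp add: monom_power smult_monom)
  then have W: "(\<Sum>k\<le>n. [:[:?e k:]:] * ?W ^ k) = (\<Sum>k\<le>n. monom [:?e k:] k)"
    by (intro sum.cong) auto
  have "[:[:?e k:]:] * (?Y * ?W) ^ k = monom (monom (?e k) k) k" for k
    by (simp add: monom_power smult_monom)
  then have YW: "(\<Sum>k\<le>n. [:[:?e k:]:] * (?Y * ?W) ^ k) = (\<Sum>k\<le>n. monom (monom (?e k) k) k)"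
    by (intro sum.cong) auto
  have "[:[:?e k:]:] * ?Y ^ k = [:monom (?e k) k:]" for k
    by (simp add: monom_power const_power smult_monom)
  then have "(\<Sum>k\<le>n. [:[:?e k:]:] * ?Y ^ k) = (\<Sum>k\<le>n. [:monom (?e k) k:])"
    by (intro sum.cong) auto
  also have "\<dots> = [:\<Sum>k\<le>n. monom (?e k) k:]"
    by (induction n) auto
  also have "\<dots> = [:corank_poly P:]"
    by (simp only: poly_as_sum_of_monoms'[OF degree_corank_poly[OF P(1)]])
  finally have Y: "(\<Sum>k\<le>n. [:[:?e k:]:] * ?Y ^ k) = [:corank_poly P:]" .
  have "[:corank_poly P:] * (\<Sum>k\<le>n. monom [:?e k:] k) = (\<Sum>k\<le>n. monom (monom (?e k) k) k)"
    using eq unfolding h.det_pencil[OF P(1)] W YW Y .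
  from arg_cong[OF this, of "\<lambda>p. coeff (coeff p j) i"] show ?thesis
    using ij by (cases "i = j") (auto simp: coeff_sum mult.commute)
qed

text \<open>At \<open>y = 1\<close> the pencil is the identity matrix.\<close>

lemma corank_idempotents_sum:
  assumes P: "P \<in> carrier_mat n n"
  shows "(\<Sum>k\<le>n. coeff (corank_poly P) k) = 1"
proof -
  have h: "comm_ring_hom (\<lambda>a :: 'a. a)" by unfold_locales auto
  have "map_mat (\<lambda>a. a) P = P" using P by (intro eq_matI) auto
  then have "det (pencil 1 P) = (\<Sum>k\<le>n. coeff (corank_poly P) k)"
    using comm_ring_hom.det_pencil[OF h P, of 1] by simp
  then show ?thesis using pencil_1[OF P] by simp
qed

lemma (in comm_ring_hom) corank_idempotent_det_pencil:
  assumes P: "P \<in> carrier_mat n n" "P * P = P" and k: "k \<le> n"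
  shows "hom (coeff (corank_poly P) k) * det (pencil y (map_mat hom P)) = hom (coeff (corank_poly P) k) * y ^ k"
proof -
  let ?e = "coeff (corank_poly P)"
  have "hom (?e k) * det (pencil y (map_mat hom P)) = (\<Sum>j\<le>n. hom (?e k * ?e j) * y ^ j)"
    unfolding det_pencil[OF P(1)] by (simp add: sum_distrib_left hom_mult mult.assoc)
  also have "\<dots> = (\<Sum>j\<le>n. if j = k then hom (?e k) * y ^ j else 0)"
    using k by (intro sum.cong) (auto simp: corank_idempotents_orthogonal[OF P])
  also have "\<dots> = hom (?e k) * y ^ k" using k by simp
  finally show ?thesis .
qed

section \<open>The adjugate of a characteristic matrix\<close>

definition adj_coeff :: "'b :: comm_ring_1 mat \<Rightarrow> nat \<Rightarrow> nat \<Rightarrow> nat \<Rightarrow> 'b" where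
  "adj_coeff M k i j = coeff (adj_mat (char_poly_matrix M) $$ (i, j)) k"

lemma char_poly_matrix_entry:
  assumes "M \<in> carrier_mat n n" "i < n" "j < n"
  shows "char_poly_matrix M $$ (i, j) = (if i = j then [:0, 1:] else 0) - [:M $$ (i, j):]"
  using assms by (auto simp: char_poly_matrix_def)

lemma adj_char_poly_entry:
  assumes M: "M \<in> carrier_mat n n" and ij: "i < n" "j < n"
  shows "pCons 0 (adj_mat (char_poly_matrix M) $$ (i, j))
      - (\<Sum>l<n. smult (M $$ (i, l)) (adj_mat (char_poly_matrix M) $$ (l, j)))
    = (if i = j then char_poly M else 0)"
proof -
  let ?C = "char_poly_matrix M"
  have C: "?C \<in> carrier_mat n n" using M by simp
  have "(?C * adj_mat ?C) $$ (i, j) = (if i = j then char_poly M else 0)"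
    unfolding adj_mat(2)[OF C] using ij by (simp add: char_poly_def)
  moreover have "(?C * adj_mat ?C) $$ (i, j) = (\<Sum>l<n. ((if i = l then [:0, 1:] else 0) - [:M $$ (i, l):]) * adj_mat ?C $$ (l, j))"
    unfolding mult_mat_entry[OF C adj_mat(1)[OF C] ij]
    using ij by (intro sum.cong) (auto simp: char_poly_matrix_entry[OF M])
  also have "\<dots> = pCons 0 (adj_mat ?C $$ (i, j)) - (\<Sum>l<n. smult (M $$ (i, l)) (adj_mat ?C $$ (l, j)))"
    using ij by (simp add: left_diff_distrib sum_subtractf sum_delta_mult)
  ultimately show ?thesis by simp
qed

text \<open>The coefficient of \<open>Y^(k+1)\<close> in \<open>(Y - M) adj(Y - M) = \<chi>\<close>.
  Run downwards from the zero coefficient at the top, it computes the adjugate without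
  division.\<close>

lemma adj_coeff_rec:
  assumes "M \<in> carrier_mat n n" "i < n" "j < n"
  shows "adj_coeff M k i j = (if i = j then coeff (char_poly M) (Suc k) else 0)
    + (\<Sum>l<n. M $$ (i, l) * adj_coeff M (Suc k) l j)"
  using arg_cong[OF adj_char_poly_entry[OF assms], of "\<lambda>p. coeff p (Suc k)"]
  by (simp add: adj_coeff_def coeff_sum algebra_simps split: if_splits)

text \<open>The constant coefficient of the same identity, to which the product of \<open>Y\<close>
  and the adjugate contributes nothing. It closes the recursion.\<close>

lemma adj_coeff_bottom:
  assumes "M \<in> carrier_mat n n" "i < n" "j < n"
  shows "(if i = j then coeff (char_poly M) 0 else 0) + (\<Sum>l<n. M $$ (i, l) * adj_coeff M 0 l j) = 0"
proof -
  have "- (\<Sum>l<n. M $$ (i, l) * adj_coeff M 0 l j) = (if i = j then coeff (char_poly M) 0 else 0)"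
    using arg_cong[OF adj_char_poly_entry[OF assms], of "\<lambda>p. coeff p 0"]
    by (simp add: adj_coeff_def coeff_sum)
  from this[symmetric] show ?thesis by simp
qed

lemma char_poly_coeff_ge:
  assumes M: "M \<in> carrier_mat n n"
  shows "coeff (char_poly M) n = 1" "k > n \<Longrightarrow> coeff (char_poly M) k = 0"
  using degree_monic_char_poly[OF M] by (auto intro: coeff_eq_0)

text \<open>The claim holds beyond a common bound \<open>d\<close> on the degrees in column
  \<open>j\<close>. It descends to \<open>n\<close> along the recursion, because
  \<open>\<chi>\<close> has no coefficient at \<open>k + 1\<close> for
  \<open>k \<ge> n\<close>.\<close>

lemma adj_coeff_eq_0:
  assumes M: "M \<in> carrier_mat n n" and ij: "i < n" "j < n" and k: "k \<ge> n"
  shows "adj_coeff M k i j = 0"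
proof -
  let ?a = "adj_mat (char_poly_matrix M)"
  define d where "d = n + (\<Sum>i<n. degree (?a $$ (i, j)))"
  have "\<forall>i<n. adj_coeff M (d + m) i j = 0" if "m > 0" for m
  proof (intro allI impI)
    fix i assume "i < n"
    then have "degree (?a $$ (i, j)) \<le> (\<Sum>i<n. degree (?a $$ (i, j)))" by (intro member_le_sum) auto
    then show "adj_coeff M (d + m) i j = 0"
      unfolding adj_coeff_def using that by (intro coeff_eq_0) (simp add: d_def)
  qed
  then have top: "\<forall>i<n. adj_coeff M k i j = 0" if "k > d" for k
    using that less_imp_add_positive by blast
  have "\<forall>i<n. adj_coeff M (d + 1 - m) i j = 0" if "d + 1 - m \<ge> n" for m
    using that
  proof (induction m)
    case (Suc m)
    show ?case
    proof (cases "d + 1 - m = 0")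
      case False
      then have e: "Suc (d + 1 - Suc m) = d + 1 - m" by simp
      have IH: "\<forall>i<n. adj_coeff M (d + 1 - m) i j = 0" using Suc by simp
      have "coeff (char_poly M) (d + 1 - m) = 0"
        using Suc.prems False by (intro char_poly_coeff_ge(2)[OF M]) simp
      show ?thesis
      proof (intro allI impI)
        fix l assume l: "l < n"
        show "adj_coeff M (d + 1 - Suc m) l j = 0"
          unfolding adj_coeff_rec[OF M l ij(2), of "d + 1 - Suc m"] e using IH \<open>coeff _ _ = 0\<close> by simp
      qed
    qed (use Suc in simp)
  qed (use top in simp)
  then have "\<forall>i<n. adj_coeff M (d + 1 - (d + 1 - k)) i j = 0" if "k \<le> d"
    using k that by (metis Suc_eq_plus1 diff_diff_cancel le_SucI)
  then show ?thesis using top[of k] ij k by (cases "k \<le> d") auto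
qed

text \<open>The corner cofactor deletes the last row and column and has sign 1. This links the
  characteristic polynomials of consecutive leading submatrices.\<close>

lemma adj_coeff_leading_minor:
  assumes M: "M \<in> carrier_mat (Suc n) (Suc n)"
  shows "adj_coeff M k n n = coeff (char_poly (mat n n (\<lambda>(i, j). M $$ (i, j)))) k"
proof -
  have "mat_delete (char_poly_matrix M) n n = char_poly_matrix (mat n n (\<lambda>(i, j). M $$ (i, j)))"
    using M by (intro eq_matI) (auto simp: mat_delete_def char_poly_matrix_def)
  then show ?thesis
    using M by (simp add: adj_coeff_def adj_mat_def cofactor_def char_poly_def char_poly_matrix_def)
qed

text \<open>The leading coefficient of \<open>f - g\<close> reappears as the top coefficient of
  \<open>h * (f - g)\<close>, in spite of zero divisors.\<close>

lemma monic_mult_cancel: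
  fixes f g h :: "'b :: comm_ring_1 poly"
  assumes "lead_coeff h = 1" "h * f = h * g"
  shows "f = g"
proof -
  have "lead_coeff (f - g) = coeff (h * (f - g)) (degree h + degree (f - g))"
    unfolding coeff_mult_degree_sum assms(1) by (rule mult_1_left[symmetric])
  also have "h * (f - g) = 0" using assms(2) by (simp add: right_diff_distrib)
  finally have "f - g = 0" unfolding coeff_0 leading_coeff_0_iff .
  then show ?thesis by simp
qed

section \<open>The characteristic matrix of a matrix fixed by a projection\<close>

context
  fixes h :: "'a :: comm_ring_1 \<Rightarrow> 'b :: comm_ring_1" and P :: "'a mat" and M :: "'b mat" and n \<kappa> :: nat
  assumes h: "comm_ring_hom h"
    and P: "P \<in> carrier_mat n n" "P * P = P"
    and M: "M \<in> carrier_mat n n" and PM: "map_mat h P * M = M"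
    and \<kappa>: "\<kappa> \<le> n"
begin

interpretation h: comm_ring_hom h by (rule h)

private definition "PC = map_mat (\<lambda>a. [:h a:]) P"
private definition "E = mat n n (\<lambda>(i, j). (if i = j then 1 else 0) + ([:0, 1:] - 1) * [:h (P $$ (i, j)):] - [:M $$ (i, j):])"
private abbreviation (input) "eh \<equiv> h (coeff (corank_poly P) \<kappa>)"

private lemma hom_c: "comm_ring_hom (\<lambda>a. [:h a:])"
  by unfold_locales (auto simp: hom_distribs one_pCons)

private lemma PC: "PC \<in> carrier_mat n n" "PC * PC = PC"
proof -
  interpret c: comm_ring_hom "\<lambda>a. [:h a:]" by (rule hom_c)
  show "PC \<in> carrier_mat n n" using P by (simp add: PC_def)
  show "PC * PC = PC" unfolding PC_def using c.mat_hom_mult[OF P(1,1)] P(2) by simp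
qed

private lemma PC_M: "i < n \<Longrightarrow> j < n \<Longrightarrow> (\<Sum>k<n. [:h (P $$ (i, k)):] * [:M $$ (k, j):]) = [:M $$ (i, j):]"
proof -
  assume ij: "i < n" "j < n"
  have "M $$ (i, j) = (\<Sum>k<n. h (P $$ (i, k)) * M $$ (k, j))"
    using mult_mat_entry[of "map_mat h P" n n M n i j] P M PM ij by simp
  moreover have "(\<Sum>k\<in>K. [:h (P $$ (i, k)):] * [:M $$ (k, j):]) = [:\<Sum>k\<in>K. h (P $$ (i, k)) * M $$ (k, j):]" for K
    by (induction K rule: infinite_finite_induct) auto
  ultimately show ?thesis by simp
qed

private lemma E_carrier: "E \<in> carrier_mat n n" by (simp add: E_def)

text \<open>With \<open>Q = 1 + (Y - 1) P\<close>, the pencil and \<open>Q\<close> multiply to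
  \<open>Y\<close>: on the image of \<open>P\<close> they act as 1 and \<open>Y\<close>, on the
  kernel as \<open>Y\<close> and 1. The pencil fixes \<open>M\<close> because
  \<open>P M = M\<close>. Hence its product with \<open>E = Q - M\<close> is
  \<open>Y - M\<close>.\<close>

private lemma pencil_E: "pencil [:0, 1:] PC * E = char_poly_matrix M"
proof (rule eq_matI)
  fix i j assume "i < dim_row (char_poly_matrix M)" "j < dim_col (char_poly_matrix M)"
  then have ij: "i < n" "j < n" using M by (auto simp: char_poly_matrix_def)
  let ?Y = "[:0, 1:] :: 'b poly"
  let ?p = "\<lambda>i j. [:h (P $$ (i, j)):]"
  have pp: "(\<Sum>k<n. ?p i k * ?p k j) = ?p i j"
    using idempotent_sum[OF PC ij] P ij by (simp add: PC_def)
  have "(pencil ?Y PC * E) $$ (i, j) = (\<Sum>k<n. ((if i = k then ?Y else 0) + (1 - ?Y) * ?p i k)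
      * ((if k = j then 1 else 0) + (?Y - 1) * ?p k j - [:M $$ (k, j):]))"
    using PC(1) P E_carrier ij
    by (subst mult_mat_entry[of _ n n _ n]) (auto simp: pencil_def PC_def E_def intro!: sum.cong)
  also have "\<dots> = (\<Sum>k<n. (if i = k then ?Y else 0) * ((if k = j then 1 else 0) + (?Y - 1) * ?p k j - [:M $$ (k, j):]))
      + (1 - ?Y) * (\<Sum>k<n. ?p i k * (if k = j then 1 else 0)) + (1 - ?Y) * (?Y - 1) * (\<Sum>k<n. ?p i k * ?p k j)
      - (1 - ?Y) * (\<Sum>k<n. ?p i k * [:M $$ (k, j):])"
    unfolding sum_distrib_left sum.distrib[symmetric] sum_subtractf[symmetric]
    by (intro sum.cong refl) (simp only: algebra_simps)
  also have "\<dots> = ?Y * ((if i = j then 1 else 0) + (?Y - 1) * ?p i j - [:M $$ (i, j):])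
      + (1 - ?Y) * ?p i j + (1 - ?Y) * (?Y - 1) * ?p i j - (1 - ?Y) * [:M $$ (i, j):]"
    unfolding pp PC_M[OF ij] using ij by (simp only: sum_delta_mult mult_1_right)
  also have "\<dots> = (if i = j then ?Y else 0) - [:M $$ (i, j):]"
    by (cases "i = j") (simp_all only: if_True if_False algebra_simps, simp_all add: algebra_simps)
  also have "\<dots> = char_poly_matrix M $$ (i, j)" using M ij by (simp add: char_poly_matrix_entry)
  finally show "(pencil ?Y PC * E) $$ (i, j) = char_poly_matrix M $$ (i, j)" .
qed (use PC(1) M in \<open>auto simp: pencil_def E_def char_poly_matrix_def\<close>)

private lemma e_char_poly: "[:eh:] * char_poly M = [:eh:] * [:0, 1:] ^ \<kappa> * det E"
proof -
  interpret c: comm_ring_hom "\<lambda>a. [:h a:]" by (rule hom_c)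
  have "char_poly M = det (pencil [:0, 1:] PC) * det E"
    unfolding char_poly_def pencil_E[symmetric] by (rule det_mult[OF pencil_carrier[OF PC(1)] E_carrier])
  then show ?thesis
    using c.corank_idempotent_det_pencil[OF P \<kappa>, of "[:0, 1:]"]
    unfolding PC_def[symmetric] by (metis mult.assoc)
qed

lemma corank_char_poly_coeff:
  assumes "k < \<kappa>"
  shows "eh * coeff (char_poly M) k = 0"
proof -
  have x: "[:0, 1:] ^ \<kappa> = monom (1 :: 'b) \<kappa>" by (simp add: monom_altdef)
  have "smult eh (char_poly M) = monom 1 \<kappa> * smult eh (det E)"
    using e_char_poly unfolding x by (simp add: ac_simps)
  then have "coeff (smult eh (char_poly M)) k = 0"
    using assms by (simp only: coeff_monom_mult) simp
  then show ?thesis by simp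
qed

text \<open>On the part of corank \<open>\<kappa>\<close> the matrix \<open>adj(Y - M) P\<close> is
  divisible by \<open>Y^\<kappa>\<close>. So in \<open>(Y - M) adj(Y - M) P = \<chi> P\<close> the
  coefficient of \<open>Y^\<kappa>\<close> retains only the product with \<open>- M\<close>: up to
  the factor \<open>\<chi>_\<kappa>\<close> and the sign, the \<open>\<kappa>\<close>-th coefficient
  of the adjugate inverts \<open>M\<close> on the image of \<open>P\<close>.\<close>

lemma corank_adj_coeff:
  assumes ij: "i < n" "j < n"
  shows "eh * (coeff (char_poly M) \<kappa> * h (P $$ (i, j)))
    = - (eh * (\<Sum>l<n. M $$ (i, l) * (\<Sum>k<n. adj_coeff M \<kappa> l k * h (P $$ (k, j)))))"
proof -
  let ?C = "char_poly_matrix M" and ?Y = "[:0, 1:] :: 'b poly"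
  let ?D = "adj_mat ?C" and ?DE = "adj_mat E"
  have C: "?C \<in> carrier_mat n n" using M by simp
  note D = adj_mat(1)[OF C] and DE = adj_mat(1)[OF E_carrier]
  have QP: "pencil ?Y PC * PC = PC"
  proof (rule eq_matI)
    fix i j assume "i < dim_row PC" "j < dim_col PC"
    then have ij: "i < n" "j < n" using PC by auto
    have "(pencil ?Y PC * PC) $$ (i, j) = (\<Sum>k<n. ((if i = k then ?Y else 0) + (1 - ?Y) * PC $$ (i, k)) * PC $$ (k, j))"
      using PC(1) ij by (subst mult_mat_entry[of _ n n _ n]) (auto simp: pencil_def intro!: sum.cong)
    also have "\<dots> = (\<Sum>k<n. (if i = k then ?Y else 0) * PC $$ (k, j)) + (1 - ?Y) * (\<Sum>k<n. PC $$ (i, k) * PC $$ (k, j))"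
      unfolding sum_distrib_left sum.distrib[symmetric] by (intro sum.cong refl) (simp only: algebra_simps)
    also have "\<dots> = PC $$ (i, j)"
      unfolding idempotent_sum[OF PC ij] sum_delta_mult(1)[OF ij(1)] by (simp only: algebra_simps) simp
    finally show "(pencil ?Y PC * PC) $$ (i, j) = PC $$ (i, j)" .
  qed (use PC(1) in \<open>auto simp: pencil_def\<close>)
  \<comment> \<open>\<open>X1\<close> and \<open>X2\<close> are the same matrix. Both solve
    \<open>?C * X = e \<chi> P\<close>; multiplying by the adjugate of \<open>?C\<close> leaves the
    monic factor \<open>\<chi>\<close>, which cancels. The second form displays the divisibility by
    \<open>Y^\<kappa>\<close>.\<close>
  define X1 where "X1 = [:eh:] \<cdot>\<^sub>m (?D * PC)"
  define X2 where "X2 = ([:eh:] * ?Y ^ \<kappa>) \<cdot>\<^sub>m (?DE * PC)"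
  have X: "X1 \<in> carrier_mat n n" "X2 \<in> carrier_mat n n"
    using D DE PC by (auto simp: X1_def X2_def)
  have "?C * X1 = [:eh:] \<cdot>\<^sub>m (?C * ?D * PC)"
    unfolding X1_def using C D PC(1)
    by (simp add: mult_smult_distrib[of _ n n _ n] assoc_mult_mat[of _ n n _ n _ n])
  also have "?C * ?D * PC = char_poly M \<cdot>\<^sub>m PC"
    unfolding adj_mat(2)[OF C] char_poly_def[symmetric] using PC(1)
    by (simp add: mult_smult_assoc_mat[of _ n n _ n])
  finally have 1: "?C * X1 = ([:eh:] * char_poly M) \<cdot>\<^sub>m PC" using PC(1) by (intro eq_matI) (auto simp: ac_simps)
  have "?C * X2 = ([:eh:] * ?Y ^ \<kappa>) \<cdot>\<^sub>m (pencil ?Y PC * (E * ?DE * PC))"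
    unfolding X2_def pencil_E[symmetric] using E_carrier DE PC(1) pencil_carrier[OF PC(1), of ?Y]
    by (simp add: mult_smult_distrib[of _ n n _ n] assoc_mult_mat[of _ n n _ n _ n])
  also have "E * ?DE * PC = det E \<cdot>\<^sub>m PC"
    unfolding adj_mat(2)[OF E_carrier] using PC(1) by (simp add: mult_smult_assoc_mat[of _ n n _ n])
  also have "pencil ?Y PC * (det E \<cdot>\<^sub>m PC) = det E \<cdot>\<^sub>m PC"
    using PC(1) pencil_carrier[OF PC(1), of ?Y] QP by (simp add: mult_smult_distrib[of _ n n _ n])
  finally have 2: "?C * X2 = ([:eh:] * char_poly M) \<cdot>\<^sub>m PC"
    unfolding e_char_poly using PC(1) by (intro eq_matI) (auto simp: ac_simps)
  have canc: "?D * (?C * X) = char_poly M \<cdot>\<^sub>m X" if "X \<in> carrier_mat n n" for X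
    unfolding assoc_mult_mat[OF D C that, symmetric] adj_mat(3)[OF C] char_poly_def[symmetric]
    using that by (simp add: mult_smult_assoc_mat[of _ n n _ n])
  have "char_poly M \<cdot>\<^sub>m X1 = char_poly M \<cdot>\<^sub>m X2"
    unfolding canc[OF X(1), symmetric] canc[OF X(2), symmetric] 1 2 ..
  then have "char_poly M * X1 $$ (l, j) = char_poly M * X2 $$ (l, j)" if "l < n" for l
  proof -
    have "(char_poly M \<cdot>\<^sub>m X1) $$ (l, j) = (char_poly M \<cdot>\<^sub>m X2) $$ (l, j)"
      by (simp only: \<open>char_poly M \<cdot>\<^sub>m X1 = char_poly M \<cdot>\<^sub>m X2\<close>)
    moreover have "(char_poly M \<cdot>\<^sub>m X) $$ (l, j) = char_poly M * X $$ (l, j)" if "X \<in> carrier_mat n n" for X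
      using that \<open>l < n\<close> ij by (intro index_smult_mat(1)) auto
    ultimately show ?thesis using X by metis
  qed
  moreover have "lead_coeff (char_poly M) = 1"
    using degree_monic_char_poly[OF M] by simp
  ultimately have X12: "X1 $$ (l, j) = X2 $$ (l, j)" if "l < n" for l
    using monic_mult_cancel that by blast
  have low: "coeff (X1 $$ (l, j)) k = 0" if "l < n" "k < \<kappa>" for l k
  proof -
    have x: "?Y ^ \<kappa> = monom (1 :: 'b) \<kappa>" by (simp add: monom_altdef)
    have "X2 $$ (l, j) = [:eh:] * monom 1 \<kappa> * (?DE * PC) $$ (l, j)"
      unfolding X2_def x using that ij DE PC by (intro index_smult_mat(1)) auto
    also have "\<dots> = monom 1 \<kappa> * ([:eh:] * (?DE * PC) $$ (l, j))"
      by (simp only: ac_simps)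
    finally show ?thesis unfolding X12[OF that(1)] using that(2) by (simp only: coeff_monom_mult) simp
  qed
  have X1: "coeff (X1 $$ (l, j)) k = eh * (\<Sum>u<n. adj_coeff M k l u * h (P $$ (u, j)))" if "l < n" for l k
  proof -
    have "X1 $$ (l, j) = [:eh:] * (\<Sum>u<n. ?D $$ (l, u) * PC $$ (u, j))"
      using that ij D PC(1) mult_mat_entry[OF D PC(1) that ij(2)] by (simp add: X1_def)
    then show ?thesis using P ij
      by (simp add: coeff_sum adj_coeff_def PC_def mult.commute)
  qed
  have "(?C * X1) $$ (i, j) = (\<Sum>l<n. ((if i = l then ?Y else 0) - [:M $$ (i, l):]) * X1 $$ (l, j))"
    unfolding mult_mat_entry[OF C X(1) ij] using ij by (intro sum.cong) (auto simp: char_poly_matrix_entry[OF M])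
  also have "\<dots> = pCons 0 (X1 $$ (i, j)) - (\<Sum>l<n. smult (M $$ (i, l)) (X1 $$ (l, j)))"
    using ij by (simp add: left_diff_distrib sum_subtractf sum_delta_mult)
  finally have "pCons 0 (X1 $$ (i, j)) - (\<Sum>l<n. smult (M $$ (i, l)) (X1 $$ (l, j))) = [:eh:] * char_poly M * [:h (P $$ (i, j)):]"
    unfolding 1 using P ij by (simp add: PC_def)
  from arg_cong[OF this, of "\<lambda>p. coeff p \<kappa>"]
  have "coeff (pCons 0 (X1 $$ (i, j))) \<kappa> - (\<Sum>l<n. M $$ (i, l) * coeff (X1 $$ (l, j)) \<kappa>)
      = eh * (coeff (char_poly M) \<kappa> * h (P $$ (i, j)))"
    by (simp add: coeff_sum ac_simps)
  \<comment> \<open>The shift by \<open>Y\<close> asks for coefficient \<open>\<kappa> - 1\<close>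
    of \<open>X1\<close>, which vanishes; for \<open>\<kappa> = 0\<close> it is the constant
    coefficient of a multiple of \<open>Y\<close>.\<close>
  moreover have "coeff (pCons 0 (X1 $$ (i, j))) \<kappa> = 0"
    using low[OF ij(1), of "\<kappa> - 1"] by (cases \<kappa>) auto
  ultimately show ?thesis
    by (simp add: X1 sum_distrib_left sum_negf[symmetric] ac_simps)
qed

end

section \<open>The lowest term of the Gram polynomial at a maximal ideal\<close>

definition filtration :: "(nat \<Rightarrow> 'b :: comm_ring_1 set) \<Rightarrow> bool" where
  "filtration N \<longleftrightarrow> (\<forall>d. 0 \<in> N d) \<and> (\<forall>d. \<forall>x\<in>N d. \<forall>y\<in>N d. x + y \<in> N d) \<and> (\<forall>d. \<forall>x\<in>N d. - x \<in> N d)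
     \<and> (\<forall>a b. \<forall>x\<in>N a. \<forall>y\<in>N b. x * y \<in> N (a + b)) \<and> 1 \<in> N 0 \<and> (\<forall>a b. a \<le> b \<longrightarrow> N b \<subseteq> N a)"

context
  fixes N :: "nat \<Rightarrow> 'b :: comm_ring_1 set"
  assumes N: "filtration N"
begin

lemma filtration_closed:
  "0 \<in> N d" "x \<in> N d \<Longrightarrow> y \<in> N d \<Longrightarrow> x + y \<in> N d" "x \<in> N d \<Longrightarrow> - x \<in> N d" "1 \<in> N 0"
  "x \<in> N a \<Longrightarrow> y \<in> N b \<Longrightarrow> x * y \<in> N (a + b)" "x \<in> N b \<Longrightarrow> a \<le> b \<Longrightarrow> x \<in> N a"
proof -
  show "x \<in> N a" if "x \<in> N b" "a \<le> b"
    using N that unfolding filtration_def by (meson subsetD)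
qed (use N in \<open>simp_all add: filtration_def\<close>)

lemma filtration_diff: "x \<in> N d \<Longrightarrow> y \<in> N d \<Longrightarrow> x - y \<in> N d"
  unfolding diff_conv_add_uminus by (intro filtration_closed(2,3))

lemma filtration_prod:
  assumes "\<And>i. i \<in> I \<Longrightarrow> f i \<in> N (w i)"
  shows "prod f I \<in> N (sum w I)"
  using assms by (induction I rule: infinite_finite_induct) (auto simp: filtration_closed)

lemma filtration_prod_strict:
  assumes "finite I" "i \<in> I" "\<And>i. i \<in> I \<Longrightarrow> f i \<in> N (w i)" "f i \<in> N (Suc (w i))"
  shows "prod f I \<in> N (Suc (sum w I))"
  using filtration_closed(5)[OF assms(4) filtration_prod[of "I - {i}" f w]] assms
  by (simp add: prod.remove[of I i] sum.remove[of I i])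

text \<open>The factors are replaced by their leading terms one at a time; each replacement changes
  the product by something of higher order.\<close>

lemma filtration_prod_diff:
  assumes "\<And>i. i \<in> I \<Longrightarrow> t i \<in> N (w i)" "\<And>i. i \<in> I \<Longrightarrow> f i - t i \<in> N (Suc (w i))"
  shows "prod f I - prod t I \<in> N (Suc (sum w I))"
  using assms
proof (induction I rule: infinite_finite_induct)
  case (insert i I)
  have "f i = t i + (f i - t i)" by simp
  then have fi: "f i \<in> N (w i)"
    using insert.prems filtration_closed(2)[of "t i" "w i" "f i - t i"] filtration_closed(6)[of "f i - t i" "Suc (w i)" "w i"]
    by auto
  have "f i * (prod f I - prod t I) + (f i - t i) * prod t I \<in> N (Suc (w i + sum w I))"
    using filtration_closed(5)[OF fi insert.IH] filtration_closed(5)[OF _ filtration_prod[of I t w], of "f i - t i" "Suc (w i)"]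
      insert.prems by (intro filtration_closed(2)) auto
  then show ?case using insert.hyps by (simp add: algebra_simps)
qed (auto simp: filtration_closed)

end

text \<open>The polynomials divisible by \<open>Y^d\<close> modulo \<open>M\<close>.\<close>

definition low_coeffs :: "'a :: comm_ring_1 set \<Rightarrow> nat \<Rightarrow> 'a poly set" where
  "low_coeffs M d = {f. \<forall>k<d. coeff f k \<in> M}"

definition low_weight :: "'a :: comm_ring_1 set \<Rightarrow> nat \<Rightarrow> nat \<Rightarrow> 'a fps poly set" where
  "low_weight M c d = {f. \<forall>k m. c * k + m < d \<longrightarrow> fps_nth (coeff f k) m \<in> M}"

lemma filtration_low_coeffs:
  assumes M: "is_ideal M"
  shows "filtration (low_coeffs M)"
  unfolding filtration_def
proof (intro conjI allI ballI impI)
  fix a b f g assume f: "f \<in> low_coeffs M a" and g: "g \<in> low_coeffs M b"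
  have "coeff f i * coeff g (k - i) \<in> M" if "i \<le> k" "k < a + b" for i k
    using that f g ideal_mult_left[OF M] ideal_mult_right[OF M]
    by (cases "i < a") (auto simp: low_coeffs_def)
  then show "f * g \<in> low_coeffs M (a + b)"
    by (auto simp: low_coeffs_def coeff_mult intro!: ideal_sum[OF M])
qed (auto simp: low_coeffs_def ideal_0[OF M] ideal_add[OF M] ideal_uminus[OF M])

text \<open>The weight \<open>c * k + m\<close> of \<open>Y^k X^m\<close> is additive, so a product
  of terms of weight below \<open>a + b\<close> has a factor of weight below \<open>a\<close> or one
  of weight below \<open>b\<close>.\<close>

lemma filtration_low_weight:
  assumes M: "is_ideal M"
  shows "filtration (low_weight M c)"
  unfolding filtration_def
proof (intro conjI allI ballI impI)
  fix a b f g assume f: "f \<in> low_weight M c a" and g: "g \<in> low_weight M c b"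
  have "fps_nth (coeff f i) u * fps_nth (coeff g (k - i)) (m - u) \<in> M"
    if "i \<le> k" "u \<le> m" "c * k + m < a + b" for i k u m
  proof (cases "c * i + u < a")
    case False
    have "c * k = c * i + c * (k - i)" using that(1) by (simp add: diff_mult_distrib2)
    then have "c * (k - i) + (m - u) < b" using False that by linarith
    then show ?thesis using g ideal_mult_left[OF M] by (auto simp: low_weight_def)
  qed (use f ideal_mult_right[OF M] in \<open>auto simp: low_weight_def\<close>)
  then show "f * g \<in> low_weight M c (a + b)"
    by (auto simp: low_weight_def coeff_mult fps_sum_nth fps_mult_nth intro!: ideal_sum[OF M])
qed (auto simp: low_weight_def ideal_0[OF M] ideal_add[OF M] ideal_uminus[OF M])

section \<open>Row reduction modulo a maximal ideal\<close>

text \<open>There are no row exchanges, so \<open>L\<close> is unit lower triangular. For each row,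
  a combination with earlier rows is chosen whose initial run of entries in \<open>M\<close> is as
  long as possible. Two rows with the same pivot column would allow the later run to be lengthened.
  The value \<open>q\<close> of \<open>\<sigma>\<close> marks a row that vanishes modulo
  \<open>M\<close>.\<close>

lemma row_reduction:
  fixes a :: "nat \<Rightarrow> nat \<Rightarrow> 'a :: comm_ring_1"
  assumes M: "is_maximal M"
  obtains L R :: "nat \<Rightarrow> nat \<Rightarrow> 'a" and \<sigma> :: "nat \<Rightarrow> nat" where
    "\<And>i. L i i = 1" "\<And>i k. i < k \<Longrightarrow> L i k = 0"
    "\<And>i j. R i j = (\<Sum>k\<le>i. L i k * a k j)"
    "\<And>i. \<sigma> i \<le> q" "\<And>i j. j < \<sigma> i \<Longrightarrow> R i j \<in> M" "\<And>i. \<sigma> i < q \<Longrightarrow> R i (\<sigma> i) \<notin> M"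
    "\<And>i k. i \<noteq> k \<Longrightarrow> \<sigma> i = \<sigma> k \<Longrightarrow> \<sigma> i = q"
proof -
  note I = maximal_ideal[OF M]
  define row where "row i l j = (\<Sum>k\<le>i. l k * a k j)" for i :: nat and l :: "nat \<Rightarrow> 'a" and j
  define cand where "cand i l \<longleftrightarrow> l i = 1 \<and> (\<forall>k>i. l k = 0)" for i :: nat and l :: "nat \<Rightarrow> 'a"
  define vanish where "vanish i l s \<longleftrightarrow> s \<le> q \<and> (\<forall>j<s. row i l j \<in> M)" for i l s
  define good where "good i s \<longleftrightarrow> (\<exists>l. cand i l \<and> vanish i l s)" for i s
  define \<sigma> where "\<sigma> i = (GREATEST s. good i s)" for i
  have g0: "good i 0" for i
    unfolding good_def cand_def vanish_def by (rule exI[of _ "\<lambda>k. if k = i then 1 else 0"]) simp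
  have bound: "good i s \<Longrightarrow> s \<le> q" for i s by (auto simp: good_def vanish_def)
  have \<sigma>: "good i (\<sigma> i)" for i
    unfolding \<sigma>_def using g0 bound by (rule GreatestI_nat)
  have max: "good i s \<Longrightarrow> s \<le> \<sigma> i" for i s
    unfolding \<sigma>_def using bound by (intro Greatest_le_nat) auto
  obtain L where L: "\<And>i. cand i (L i)" "\<And>i. vanish i (L i) (\<sigma> i)"
    using \<sigma> unfolding good_def by metis
  define R where "R i j = row i (L i) j" for i j
  have lead: "R i (\<sigma> i) \<notin> M" if "\<sigma> i < q" for i
  proof
    assume "R i (\<sigma> i) \<in> M"
    then have "vanish i (L i) (Suc (\<sigma> i))"
      using L(2)[of i] that by (auto simp: vanish_def R_def less_Suc_eq)
    then show False using L(1) max[of i "Suc (\<sigma> i)"] by (auto simp: good_def)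
  qed
  have distinct: "\<sigma> i = q" if ik: "i < k" "\<sigma> i = \<sigma> k" for i k
  proof (rule ccontr)
    assume "\<sigma> i \<noteq> q"
    moreover have "\<sigma> i \<le> q" using L(2)[of i] by (simp add: vanish_def)
    ultimately have lt: "\<sigma> i < q" by simp
    obtain y where y: "1 - y * R i (\<sigma> i) \<in> M" using maximal_inverse[OF M lead[OF lt]] by blast
    \<comment> \<open>The elimination step: a multiple of row \<open>i\<close> clears the pivot
      entry of row \<open>k\<close>, and earlier entries stay in \<open>M\<close>.\<close>
    define l where "l u = L k u - R k (\<sigma> i) * y * L i u" for u
    have "cand k l" using L(1)[of i] L(1)[of k] ik by (auto simp: cand_def l_def)
    have rl: "row k l j = R k j - R k (\<sigma> i) * y * R i j" for j
    proof -
      have "(\<Sum>u\<le>i. L i u * a u j) = (\<Sum>u\<le>k. L i u * a u j)"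
        using L(1)[of i] ik by (intro sum.mono_neutral_left) (auto simp: cand_def)
      then show ?thesis
        by (simp add: row_def l_def R_def sum_subtractf sum_distrib_left left_diff_distrib mult.assoc)
    qed
    have "row k l j \<in> M" if "j < Suc (\<sigma> i)" for j
    proof (cases "j = \<sigma> i")
      case True
      have "row k l j = R k (\<sigma> i) * (1 - y * R i (\<sigma> i))"
        unfolding rl True by (simp add: algebra_simps)
      then show ?thesis using ideal_mult_left[OF I y] by simp
    next
      case False
      then have "R k j \<in> M" "R i j \<in> M"
        using that L(2)[of i] L(2)[of k] ik by (auto simp: vanish_def R_def)
      then show ?thesis unfolding rl using ideal_diff[OF I] ideal_mult_left[OF I] by blast
    qed
    then have "good k (Suc (\<sigma> i))"
      using \<open>cand k l\<close> lt by (auto simp: good_def vanish_def)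
    then show False using max ik by fastforce
  qed
  show thesis
  proof (rule that[of L R \<sigma>])
    show "\<sigma> i = q" if "i \<noteq> k" "\<sigma> i = \<sigma> k" for i k
      using that distinct[of i k] distinct[of k i] by (cases i k rule: linorder_cases) auto
  qed (use L lead in \<open>auto simp: cand_def vanish_def R_def row_def\<close>)
qed

section \<open>The deformed Gram matrix and its lowest term\<close>

text \<open>The product \<open>A D A\<^sup>T D'\<close> with diagonal matrices \<open>D\<close> and
  \<open>D'\<close> of entries \<open>X^(2j)\<close> and \<open>X^(2k)\<close>. Having
  \<open>A\<close> as left factor, it is fixed by \<open>A * B\<close> whenever
  \<open>A * B * A = A\<close>.\<close>

definition gram :: "'a :: comm_ring_1 mat \<Rightarrow> 'a fps mat" where
  "gram A = mat (dim_row A) (dim_row A)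
     (\<lambda>(i, k). \<Sum>j<dim_col A. fps_const (A $$ (i, j) * A $$ (k, j)) * fps_X ^ (2 * j + 2 * k))"

definition gram_weight :: "'a :: comm_ring_1 mat \<Rightarrow> nat" where
  "gram_weight A = 2 * (dim_row A + dim_col A)"

text \<open>For each \<open>k\<close> there is at most one monomial \<open>Y^k X^m\<close> of weight
  \<open>l\<close>. The default 0 covers the weights below that of \<open>Y^k\<close>.\<close>

definition gram_coeff :: "'a :: comm_ring_1 mat \<Rightarrow> nat \<Rightarrow> nat \<Rightarrow> 'a" where
  "gram_coeff A k l = (if gram_weight A * k \<le> l
     then fps_nth (coeff (char_poly (gram A)) k) (l - gram_weight A * k) else 0)"

lemma gram_carrier: "gram A \<in> carrier_mat (dim_row A) (dim_row A)"
  by (simp add: gram_def)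

lemma det_unit_lower_triangular:
  assumes "A \<in> carrier_mat n n" "\<And>i. i < n \<Longrightarrow> A $$ (i, i) = 1"
    and "\<And>i j. i < j \<Longrightarrow> j < n \<Longrightarrow> A $$ (i, j) = 0"
  shows "det A = 1"
proof -
  have "det A = prod_list (diag_mat A)" using assms by (intro det_lower_triangular) auto
  also have "diag_mat A = replicate n 1" using assms by (intro nth_equalityI) (auto simp: diag_mat_def)
  finally show ?thesis by simp
qed

lemma det_unit_upper_triangular:
  assumes A: "A \<in> carrier_mat n n" and "\<And>i. i < n \<Longrightarrow> A $$ (i, i) = 1"
    and "\<And>i j. j < i \<Longrightarrow> i < n \<Longrightarrow> A $$ (i, j) = 0"
  shows "det A = 1"
  using det_unit_lower_triangular[of "A\<^sup>T" n] assms by (simp add: det_transpose[OF A])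

lemma fps_const_sum: "fps_const (sum f I) = (\<Sum>i\<in>I. fps_const (f i))"
  by (induction I rule: infinite_finite_induct) (auto simp: fps_const_add[symmetric] simp del: fps_const_add)

lemma prod_monom:
  "(\<Prod>i\<in>I. monom (fps_const (a i) * fps_X ^ m i) (k i))
    = monom (fps_const (prod a I) * fps_X ^ sum m I) (sum k I :: nat)"
proof (induction I rule: infinite_finite_induct)
  case (insert i I)
  then show ?case by (simp add: mult_monom power_add fps_const_mult[symmetric] ac_simps del: fps_const_mult)
qed (auto simp: one_pCons monom_0)

context
  fixes M :: "'a :: comm_ring_1 set" and A :: "'a mat" and p q :: nat
  assumes M: "is_maximal M" and A: "A \<in> carrier_mat p q"
begin

text \<open>Row reduction makes the characteristic matrix lower triangular up to terms of higher
  weight. Its diagonal then gives the single lowest term: \<open>Y\<close> for each row in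
  \<open>Z\<close>, and the negated square of the pivot with a power of \<open>X\<close> for each
  other row. The reduction data are part of the conclusion because they also bound the corank of
  \<open>A * B\<close>.\<close>

lemma gram_coeff_lowest:
  obtains Z \<sigma> L R l where
    "Z = {i. i < p \<and> \<sigma> i = q}" "l \<le> gram_weight A * p" "gram_coeff A (card Z) l \<notin> M"
    "\<And>k l'. l' \<le> l \<Longrightarrow> (k, l') \<noteq> (card Z, l) \<Longrightarrow> gram_coeff A k l' \<in> M"
    "\<And>i. L i i = 1" "\<And>i k. i < k \<Longrightarrow> L i k = 0"
    "\<And>i j. R i j = (\<Sum>k\<le>i. L i k * A $$ (k, j))"
    "\<And>i j. j < \<sigma> i \<Longrightarrow> R i j \<in> M"
proof -
  note I = maximal_ideal[OF M]
  obtain L R \<sigma> where Ld: "\<And>i. L i i = 1" and Lu: "\<And>i k. i < k \<Longrightarrow> L i k = 0"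
    and R: "\<And>i j. R i j = (\<Sum>k\<le>i. L i k * A $$ (k, j))"
    and \<sigma>q: "\<And>i. \<sigma> i \<le> q" and Rlow: "\<And>i j. j < \<sigma> i \<Longrightarrow> R i j \<in> M"
    and Rlead: "\<And>i. \<sigma> i < q \<Longrightarrow> R i (\<sigma> i) \<notin> M"
    and dist: "\<And>i k. i \<noteq> k \<Longrightarrow> \<sigma> i = \<sigma> k \<Longrightarrow> \<sigma> i = q"
    using row_reduction[OF M, where q = q and a = "\<lambda>k j. A $$ (k, j)"] by blast
  let ?c = "gram_weight A"
  have c: "?c = 2 * (p + q)" using A by (simp add: gram_weight_def)
  have dims: "dim_row A = p" "dim_col A = q" using A by auto
  note G = gram_carrier[of A, unfolded dims]
  define LL where "LL = mat p p (\<lambda>(i, k). [:fps_const (L i k):])"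
  \<comment> \<open>The transpose of \<open>LL\<close> conjugated by the diagonal matrix of the
    \<open>X^(2k)\<close>: it acts on the factor \<open>A\<^sup>T D'\<close> as \<open>LL\<close>
    acts on \<open>A\<close>. Where \<open>L l k\<close> is nonzero, \<open>k \<le> l\<close>, so
    the difference in the exponent is not truncated.\<close>
  define V where "V = mat p p (\<lambda>(k, l). [:fps_const (L l k) * fps_X ^ (2 * l - 2 * k):])"
  define C where "C = char_poly_matrix (gram A)"
  define E where "E = LL * C * V"
  have car: "LL \<in> carrier_mat p p" "V \<in> carrier_mat p p" "C \<in> carrier_mat p p" "E \<in> carrier_mat p p"
    using G by (auto simp: LL_def V_def C_def E_def)
  have "det LL = 1"
    using Ld Lu car by (intro det_unit_lower_triangular[of _ p]) (auto simp: LL_def one_pCons)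
  moreover have "det V = 1"
    using Ld Lu car by (intro det_unit_upper_triangular[of _ p]) (auto simp: V_def one_pCons)
  ultimately have detE: "det E = char_poly (gram A)"
    using car by (simp add: E_def det_mult[of _ p] char_poly_def C_def)
  \<comment> \<open>\<open>QQ\<close> is the Gram matrix of the reduced rows. \<open>K\<close> is
    what the transformation makes of the identity matrix beside \<open>Y\<close>.\<close>
  define QQ where "QQ i l = (\<Sum>j<q. fps_const (R i j * R l j) * fps_X ^ (2 * j + 2 * l))" for i l
  define K where "K i l = (\<Sum>k<p. fps_const (L i k * L l k) * fps_X ^ (2 * l - 2 * k))" for i l
  have E: "E $$ (i, l) = monom (K i l) 1 - monom (QQ i l) 0" if il: "i < p" "l < p" for i l
  proof -
    have R': "R i j = (\<Sum>k<p. L i k * A $$ (k, j))" if "i < p" for i j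
      unfolding R using that Lu by (intro sum.mono_neutral_left) auto
    have LC: "(LL * C) $$ (i, k) = monom (fps_const (L i k)) 1 - monom (\<Sum>j<q. fps_const (R i j * A $$ (k, j)) * fps_X ^ (2 * j + 2 * k)) 0"
      if k: "k < p" for k
    proof -
      have "(LL * C) $$ (i, k) = (\<Sum>u<p. [:fps_const (L i u):] * ((if u = k then [:0, 1:] else 0) - [:gram A $$ (u, k):]))"
        unfolding mult_mat_entry[OF car(1,3) il(1) k]
        using il k by (intro sum.cong) (auto simp: LL_def C_def char_poly_matrix_entry[OF G])
      also have "\<dots> = [:fps_const (L i k):] * [:0, 1:] - (\<Sum>u<p. [:fps_const (L i u) * gram A $$ (u, k):])"
        using k by (simp add: right_diff_distrib sum_subtractf if_distrib[of "smult _"] mult.commute[of "gram A $$ _"] cong: if_cong)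
      also have "(\<Sum>u<p. [:fps_const (L i u) * gram A $$ (u, k):]) = monom (\<Sum>u<p. fps_const (L i u) * gram A $$ (u, k)) 0"
        by (simp add: monom_0[symmetric] monom_sum)
      also have "(\<Sum>u<p. fps_const (L i u) * gram A $$ (u, k)) =
          (\<Sum>u<p. \<Sum>j<q. fps_const (L i u * A $$ (u, j) * A $$ (k, j)) * fps_X ^ (2 * j + 2 * k))"
        using k dims by (intro sum.cong) (auto simp: gram_def sum_distrib_left mult.assoc[symmetric])
      also have "\<dots> = (\<Sum>j<q. fps_const (R i j * A $$ (k, j)) * fps_X ^ (2 * j + 2 * k))"
        unfolding R'[OF il(1)] sum_distrib_right by (subst sum.swap)
          (simp add: sum_distrib_right fps_const_sum)
      finally show ?thesis by (simp add: monom_altdef)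
    qed
    have "E $$ (i, l) = (\<Sum>k<p. (monom (fps_const (L i k)) 1 - monom (\<Sum>j<q. fps_const (R i j * A $$ (k, j)) * fps_X ^ (2 * j + 2 * k)) 0)
        * monom (fps_const (L l k) * fps_X ^ (2 * l - 2 * k)) 0)"
      unfolding E_def using car il LC by (subst mult_mat_entry[of _ p p _ p]) (auto simp: V_def monom_0 intro!: sum.cong)
    also have "\<dots> = (\<Sum>k<p. monom (fps_const (L i k * L l k) * fps_X ^ (2 * l - 2 * k)) 1)
        - (\<Sum>k<p. monom ((\<Sum>j<q. fps_const (R i j * A $$ (k, j)) * fps_X ^ (2 * j + 2 * k)) * (fps_const (L l k) * fps_X ^ (2 * l - 2 * k))) 0)"
      by (simp add: left_diff_distrib sum_subtractf mult_monom mult.assoc[symmetric])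
    also have "\<dots> = monom (K i l) 1 - monom (\<Sum>k<p. \<Sum>j<q. fps_const (R i j * (L l k * A $$ (k, j))) * fps_X ^ (2 * j + 2 * l)) 0"
    proof -
      have "(\<Sum>j<q. fps_const (R i j * A $$ (k, j)) * fps_X ^ (2 * j + 2 * k)) * (fps_const (L l k) * fps_X ^ (2 * l - 2 * k))
          = (\<Sum>j<q. fps_const (R i j * (L l k * A $$ (k, j))) * fps_X ^ (2 * j + 2 * l))" for k
      proof (cases "k \<le> l")
        case True
        then have e: "2 * j + 2 * l = (2 * j + 2 * k) + (2 * l - 2 * k)" for j by simp
        show ?thesis unfolding sum_distrib_right e power_add
          by (intro sum.cong refl) (simp add: fps_const_mult[symmetric] ac_simps del: fps_const_mult)
      qed (simp add: Lu)
      then show ?thesis by (simp add: K_def monom_sum)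
    qed
    also have "(\<Sum>k<p. \<Sum>j<q. fps_const (R i j * (L l k * A $$ (k, j))) * fps_X ^ (2 * j + 2 * l)) = QQ i l"
      unfolding QQ_def R'[OF il(2)] sum_distrib_left
      by (subst sum.swap) (simp add: sum_distrib_right fps_const_sum)
    finally show ?thesis .
  qed
  \<comment> \<open>Shares of row and column in the weight. A product \<open>R i j * R l j\<close>
    outside \<open>M\<close> has \<open>j\<close> at least \<open>\<sigma> i\<close> and
    \<open>\<sigma> l\<close>, so \<open>2 * j\<close> is at least their sum. For a vanishing row,
    \<open>p\<close> in place of \<open>i\<close> gives the diagonal entry exactly the weight of
    \<open>Y\<close>.\<close>
  define \<alpha> where "\<alpha> i = \<sigma> i" for i
  define \<beta> where "\<beta> i = \<sigma> i + 2 * (if \<sigma> i < q then i else p)" for i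
  note F = filtration_low_weight[OF I, of ?c]
  note Fc = filtration_closed[OF F]
  have const_X: "fps_nth (fps_const x * fps_X ^ m) n = (if n = m then x else 0)" for x :: 'a and m n
    by (simp add: fps_X_power_nth)
  have Q_low: "monom (QQ i l) 0 \<in> low_weight M ?c d"
    if "\<And>j. j < q \<Longrightarrow> 2 * j + 2 * l < d \<Longrightarrow> R i j * R l j \<in> M" for i l d
    using that by (auto simp: low_weight_def QQ_def fps_sum_nth const_X coeff_monom ideal_0[OF I] intro!: ideal_sum[OF I])
  have K_low: "monom (K i l) 1 \<in> low_weight M ?c (?c + d)" if "d \<le> 2 * (l - i)" for i l d
  proof -
    have "fps_nth (K i l) m = 0" if "m < d" for m
    proof -
      have "L i k * L l k = 0" if "m = 2 * l - 2 * k" for k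
        using that \<open>m < d\<close> \<open>d \<le> 2 * (l - i)\<close> Lu[of i k] by (cases "k \<le> i") auto
      then show ?thesis unfolding K_def fps_sum_nth const_X by (intro sum.neutral) auto
    qed
    then show ?thesis by (auto simp: low_weight_def coeff_monom ideal_0[OF I])
  qed
  have \<alpha>\<beta>: "\<alpha> i + \<beta> l \<le> ?c" if "l < p" for i l
    using \<sigma>q[of i] \<sigma>q[of l] that unfolding \<alpha>_def \<beta>_def c by auto
  have RR: "R i j * R l j \<in> M" if "j < \<sigma> i \<or> j < \<sigma> l" for i l j
    using that Rlow ideal_mult_left[OF I] ideal_mult_right[OF I] by blast
  have low: "E $$ (i, l) \<in> low_weight M ?c (\<alpha> i + \<beta> l)" if il: "i < p" "l < p" for i l
  proof -
    have "monom (K i l) 1 \<in> low_weight M ?c (\<alpha> i + \<beta> l)"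
      using Fc(6)[OF K_low[of 0 l i]] \<alpha>\<beta>[OF il(2)] by simp
    moreover have "monom (QQ i l) 0 \<in> low_weight M ?c (\<alpha> i + \<beta> l)"
      by (rule Q_low, rule RR) (use \<sigma>q[of l] \<sigma>q[of i] in \<open>auto simp: \<alpha>_def \<beta>_def split: if_splits\<close>)
    ultimately show ?thesis unfolding E[OF il] by (rule filtration_diff[OF F])
  qed
  \<comment> \<open>Above the diagonal, distinct pivot columns make twice the larger one exceed the
    sum, and \<open>K i l\<close> starts only at \<open>X^(2(l - i))\<close>.\<close>
  have strict: "E $$ (i, l) \<in> low_weight M ?c (Suc (\<alpha> i + \<beta> l))" if il: "i < l" "l < p" for i l
  proof -
    have "monom (K i l) 1 \<in> low_weight M ?c (Suc (\<alpha> i + \<beta> l))"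
      using Fc(6)[OF K_low[of 1 l i]] \<alpha>\<beta>[OF il(2)] il by simp
    moreover have "monom (QQ i l) 0 \<in> low_weight M ?c (Suc (\<alpha> i + \<beta> l))"
    proof (rule Q_low, rule RR)
      fix j assume j: "j < q" "2 * j + 2 * l < Suc (\<alpha> i + \<beta> l)"
      show "j < \<sigma> i \<or> j < \<sigma> l"
      proof (cases "\<sigma> l < q")
        case True
        then have "\<sigma> i \<noteq> \<sigma> l" using dist[of i l] il by auto
        then show ?thesis using True j by (simp add: \<alpha>_def \<beta>_def) linarith
      qed (use j \<sigma>q[of l] in auto)
    qed
    ultimately show ?thesis using E[of i l] il filtration_diff[OF F] by auto
  qed
  define w where "w i = \<alpha> i + \<beta> i" for i
  \<comment> \<open>Coefficient, \<open>X\<close>-exponent and \<open>Y\<close>-exponent of the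
    leading term of a diagonal entry. The minus sign comes from \<open>Y - G\<close>.\<close>
  define s where "s i = (if \<sigma> i < q then - (R i (\<sigma> i) * R i (\<sigma> i)) else 1)" for i
  define m where "m i = (if \<sigma> i < q then w i else 0)" for i
  define z where "z i = (if \<sigma> i < q then 0 else 1 :: nat)" for i
  have wm: "w i = ?c * z i + m i" if "i < p" for i
    using that \<sigma>q[of i] by (auto simp: w_def m_def z_def \<alpha>_def \<beta>_def c)
  let ?t = "\<lambda>i. monom (fps_const (s i) * fps_X ^ m i) (z i)"
  have t: "?t i \<in> low_weight M ?c (w i)" if "i < p" for i
    using wm[OF that] by (auto simp: low_weight_def coeff_monom const_X ideal_0[OF I])
  have diag: "E $$ (i, i) - ?t i \<in> low_weight M ?c (Suc (w i))" if i: "i < p" for i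
  proof (cases "\<sigma> i < q")
    case True
    have lt: "w i < ?c" using True i \<sigma>q[of i] by (simp add: w_def \<alpha>_def \<beta>_def c)
    have wi: "w i = 2 * \<sigma> i + 2 * i" using True by (simp add: w_def \<alpha>_def \<beta>_def)
    have "monom (K i i) 1 \<in> low_weight M ?c (Suc (w i))"
      using Fc(6)[OF K_low[of 0 i i]] lt by simp
    moreover have "- monom (QQ i i) 0 - ?t i \<in> low_weight M ?c (Suc (w i))"
    proof -
      have "fps_nth (QQ i i) n - (if n = w i then R i (\<sigma> i) * R i (\<sigma> i) else 0) \<in> M" if "n \<le> w i" for n
      proof -
        have "fps_nth (QQ i i) n = (\<Sum>j<q. if n = 2 * j + 2 * i then R i j * R i j else 0)"
          by (simp only: QQ_def fps_sum_nth const_X)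
        also have "\<dots> = (if n = w i then R i (\<sigma> i) * R i (\<sigma> i) else 0)
            + (\<Sum>j\<in>{..<q} - {\<sigma> i}. if n = 2 * j + 2 * i then R i j * R i j else 0)"
          using True by (subst sum.remove[of _ "\<sigma> i"]) (auto simp: wi)
        finally have "fps_nth (QQ i i) n - (if n = w i then R i (\<sigma> i) * R i (\<sigma> i) else 0) =
            (\<Sum>j\<in>{..<q} - {\<sigma> i}. if n = 2 * j + 2 * i then R i j * R i j else 0)" by simp
        moreover have "(if n = 2 * j + 2 * i then R i j * R i j else 0) \<in> M" if "j \<in> {..<q} - {\<sigma> i}" for j
          using that \<open>n \<le> w i\<close> RR[of j i i] wi ideal_0[OF I] by auto
        ultimately show ?thesis by (simp only:) (rule ideal_sum[OF I])
      qed
      then show ?thesis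
        using True ideal_uminus[OF I]
        by (force simp: low_weight_def coeff_monom const_X m_def z_def s_def less_Suc_eq_le ideal_0[OF I] split: if_splits)
    qed
    ultimately have "monom (K i i) 1 + (- monom (QQ i i) 0 - ?t i) \<in> low_weight M ?c (Suc (w i))"
      by (rule Fc(2))
    then show ?thesis unfolding E[OF i i] by (simp add: algebra_simps)
  next
    case False
    then have si: "\<sigma> i = q" using \<sigma>q[of i] by simp
    have w: "w i = ?c" using wm[OF i] si by (simp add: z_def m_def)
    have "monom (QQ i i) 0 \<in> low_weight M ?c (Suc (w i))"
      by (rule Q_low, rule RR) (use si in auto)
    moreover have "monom (K i i) 1 - ?t i \<in> low_weight M ?c (Suc (w i))"
    proof -
      have "fps_nth (K i i) 0 = (\<Sum>k<p. if k = i then 1 else 0)"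
        unfolding K_def fps_sum_nth const_X
      proof (rule sum.cong[OF refl])
        fix k
        show "(if 0 = 2 * i - 2 * k then L i k * L i k else 0) = (if k = i then 1 else 0)"
          using Lu[of i k] Ld[of i] by (cases i k rule: linorder_cases) auto
      qed
      then have "fps_nth (K i i) 0 = 1" using i by simp
      then show ?thesis using si w
        by (auto simp: low_weight_def coeff_monom const_X m_def z_def s_def less_Suc_eq ideal_0[OF I])
    qed
    ultimately have "(monom (K i i) 1 - ?t i) - monom (QQ i i) 0 \<in> low_weight M ?c (Suc (w i))"
      by (rule filtration_diff[OF F, rotated])
    then show ?thesis unfolding E[OF i i] by (simp add: algebra_simps)
  qed
  define W where "W = sum w {0..<p}"
  have "det E - (\<Prod>i=0..<p. E $$ (i, i)) \<in> low_weight M ?c (Suc W)"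
  proof (rule det_minus_diagonal[OF car(4)])
    fix \<pi> assume p: "\<pi> permutes {0..<p}" and ne: "\<pi> \<noteq> id"
    have in_p: "\<pi> i < p" if "i < p" for i using permutes_in_image[OF p, of i] that by auto
    have "\<exists>i<p. i < \<pi> i"
    proof (rule ccontr)
      assume "\<not> ?thesis"
      then have "\<forall>i\<in>{0..<p}. \<pi> i \<le> i" by auto
      then have "\<pi> = id" by (intro permutes_natset_le[OF p]) auto
      then show False using ne by simp
    qed
    then obtain i where i: "i < p" "i < \<pi> i" by blast
    \<comment> \<open>A permutation redistributes the column shares without changing their sum, so
      every Leibniz product has weight at least \<open>W\<close>.\<close>
    have "(\<Sum>i=0..<p. \<beta> (\<pi> i)) = (\<Sum>i=0..<p. \<beta> i)"
      using sum.permute[OF p, of \<beta>] by (simp add: o_def)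
    then have W: "W = (\<Sum>i=0..<p. \<alpha> i + \<beta> (\<pi> i))" by (simp add: W_def w_def sum.distrib)
    show "(\<Prod>i=0..<p. E $$ (i, \<pi> i)) \<in> low_weight M ?c (Suc W)"
      unfolding W using i in_p low strict by (intro filtration_prod_strict[OF F, of _ i]) auto
  qed (use Fc in auto)
  moreover have "(\<Prod>i=0..<p. E $$ (i, i)) - (\<Prod>i=0..<p. ?t i) \<in> low_weight M ?c (Suc W)"
    unfolding W_def using t diag by (intro filtration_prod_diff[OF F]) auto
  ultimately have "det E - (\<Prod>i=0..<p. ?t i) \<in> low_weight M ?c (Suc W)"
    using Fc(2) by fastforce
  then have cp: "char_poly (gram A) - monom (fps_const (prod s {0..<p}) * fps_X ^ sum m {0..<p}) (sum z {0..<p}) \<in> low_weight M ?c (Suc W)"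
    unfolding detE prod_monom .
  define Z where "Z = {i. i < p \<and> \<sigma> i = q}"
  have cZ: "sum z {0..<p} = card Z"
  proof -
    have "sum z {0..<p} = (\<Sum>i\<in>{0..<p}. if \<sigma> i = q then 1 else 0)"
      unfolding z_def using \<sigma>q by (intro sum.cong) (auto simp: le_less)
    also have "\<dots> = card ({0..<p} \<inter> {i. \<sigma> i = q})"
      by (subst card_eq_sum, subst sum.inter_restrict) simp_all
    also have "{0..<p} \<inter> {i. \<sigma> i = q} = Z" by (auto simp: Z_def)
    finally show ?thesis .
  qed
  have Wm: "W = ?c * card Z + sum m {0..<p}"
    unfolding W_def cZ[symmetric] sum_distrib_left sum.distrib[symmetric] using wm by (intro sum.cong) auto
  have s: "prod s {0..<p} \<notin> M"
  proof (rule maximal_prod[OF M])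
    fix i
    show "s i \<notin> M"
      using maximal_prime[OF M, of "R i (\<sigma> i)" "R i (\<sigma> i)"] Rlead[of i] maximal_1[OF M]
        ideal_uminus[OF I, of "s i"] by (auto simp: s_def split: if_splits)
  qed
  have coeffs: "fps_nth (coeff (char_poly (gram A)) k) n - (if k = card Z \<and> n = sum m {0..<p} then prod s {0..<p} else 0) \<in> M"
    if "?c * k + n \<le> W" for k n
    using cp that unfolding low_weight_def cZ
    by (auto simp: coeff_monom const_X less_Suc_eq_le split: if_splits)
  show thesis
  proof (rule that[of Z \<sigma> W L R])
    have "W \<le> (\<Sum>i=0..<p. ?c)" unfolding W_def w_def by (intro sum_mono \<alpha>\<beta>) auto
    then show "W \<le> ?c * p" by (simp add: mult.commute)
    show "gram_coeff A (card Z) W \<notin> M"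
    proof
      assume "gram_coeff A (card Z) W \<in> M"
      then have "fps_nth (coeff (char_poly (gram A)) (card Z)) (sum m {0..<p}) \<in> M"
        by (simp add: gram_coeff_def Wm)
      from ideal_diff[OF I this coeffs[of "card Z" "sum m {0..<p}"]] show False
        using s by (simp add: Wm)
    qed
    show "gram_coeff A k l \<in> M" if "l \<le> W" "(k, l) \<noteq> (card Z, W)" for k l
      using coeffs[of k "l - ?c * k"] that ideal_0[OF I] by (auto simp: gram_coeff_def Wm split: if_splits)
  qed (use Ld Lu R Rlow Z_def in auto)
qed

end

section \<open>Computing a generalized inverse from ideal memberships\<close>

lemma fps_const_hom: "comm_ring_hom (fps_const :: 'a :: comm_ring_1 \<Rightarrow> 'a fps)"
  by unfold_locales auto

lemma sum_mult_assoc: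
  fixes a :: "_ \<Rightarrow> 'b :: comm_ring_1"
  shows "(\<Sum>j\<in>J. (\<Sum>l\<in>L. g l * (\<Sum>k\<in>K. d l k * P k j)) * a j)
    = (\<Sum>l\<in>L. g l * (\<Sum>k\<in>K. d l k * (\<Sum>j\<in>J. P k j * a j)))"
proof -
  have "(\<Sum>k\<in>K. d l k * P k j) * a j = (\<Sum>k\<in>K. d l k * (P k j * a j))" for l j
    by (simp add: sum_distrib_right mult.assoc)
  then have "(\<Sum>j\<in>J. (\<Sum>l\<in>L. g l * (\<Sum>k\<in>K. d l k * P k j)) * a j)
      = (\<Sum>j\<in>J. \<Sum>l\<in>L. g l * (\<Sum>k\<in>K. d l k * (P k j * a j)))"
    by (simp add: sum_distrib_right mult.assoc)
  also have "\<dots> = (\<Sum>l\<in>L. g l * (\<Sum>j\<in>J. \<Sum>k\<in>K. d l k * (P k j * a j)))"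
    by (subst sum.swap) (simp add: sum_distrib_left)
  also have "\<dots> = (\<Sum>l\<in>L. g l * (\<Sum>k\<in>K. d l k * (\<Sum>j\<in>J. P k j * a j)))"
  proof (rule sum.cong[OF refl])
    fix l
    have "(\<Sum>j\<in>J. \<Sum>k\<in>K. d l k * (P k j * a j)) = (\<Sum>k\<in>K. d l k * (\<Sum>j\<in>J. P k j * a j))"
      by (subst sum.swap) (simp add: sum_distrib_left)
    then show "g l * (\<Sum>j\<in>J. \<Sum>k\<in>K. d l k * (P k j * a j)) = g l * (\<Sum>k\<in>K. d l k * (\<Sum>j\<in>J. P k j * a j))"
      by simp
  qed
  finally show ?thesis .
qed

lemma sum_rotate:
  "(\<Sum>u\<in>U. \<Sum>k\<in>K. \<Sum>l\<in>L. f u k l) = (\<Sum>l\<in>L. \<Sum>u\<in>U. \<Sum>k\<in>K. f u k l)"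
proof -
  have "(\<Sum>u\<in>U. \<Sum>k\<in>K. \<Sum>l\<in>L. f u k l) = (\<Sum>u\<in>U. \<Sum>l\<in>L. \<Sum>k\<in>K. f u k l)"
    by (intro sum.cong refl sum.swap)
  also have "\<dots> = (\<Sum>l\<in>L. \<Sum>u\<in>U. \<Sum>k\<in>K. f u k l)" by (rule sum.swap)
  finally show ?thesis .
qed

section \<open>Test elements, generators and partial inverses\<close>

text \<open>Prefix sums combine two properties: on the part of corank \<open>\<kappa>\<close> they
  vanish for \<open>k < \<kappa>\<close>, and for every \<open>k \<ge> \<kappa>\<close> they contain
  the coefficient of corank \<open>\<kappa>\<close>, which is invertible at the lowest
  weight.\<close>

definition gram_prefix :: "'a :: comm_ring_1 mat \<Rightarrow> nat \<Rightarrow> nat \<Rightarrow> 'a" where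
  "gram_prefix A k l = (\<Sum>k'\<le>k. gram_coeff A k' l)"

text \<open>The shift of the weight by \<open>k\<close> is what makes the system in
  \<open>test_elem_in_ideal\<close> triangular.\<close>

definition test_gen :: "'a :: comm_ring_1 mat \<Rightarrow> nat \<Rightarrow> nat \<Rightarrow> 'a" where
  "test_gen A l j = (\<Sum>k\<le>dim_row A. gram_coeff A k l * (if k \<le> j then gram_prefix A k (j - k) else 0))"

definition test_elem :: "'a :: comm_ring_1 mat \<Rightarrow> nat \<Rightarrow> 'a" where
  "test_elem A l = (\<Sum>k\<le>dim_row A. gram_coeff A k l)"

text \<open>The bound on the lowest weight from \<open>gram_coeff_lowest\<close>: each diagonal
  entry has a leading term of at most the weight of \<open>Y\<close>.\<close>

definition max_height :: "'a :: comm_ring_1 mat \<Rightarrow> nat" where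
  "max_height A = gram_weight A * dim_row A"

text \<open>One more than the largest index \<open>h + \<kappa> + r\<close> that the triangular
  system uses, where \<open>h \<le> max_height A\<close> and
  \<open>\<kappa> + r \<le> dim_row A\<close>.\<close>

definition gens_count :: "'a :: comm_ring_1 mat \<Rightarrow> nat" where
  "gens_count A = max_height A + dim_row A + 1"

text \<open>With \<open>D\<close> and \<open>D'\<close> as in the factorization of
  \<open>gram\<close>, and \<open>\<Delta>\<close> the coefficient of \<open>Y^k\<close> in the
  adjugate, this is entry \<open>(u, j)\<close> of \<open>- D A\<^sup>T D' \<Delta>\<close>, read at
  the power of \<open>X\<close> that belongs to weight \<open>l\<close>.\<close>

definition partial_inverse :: "'a :: comm_ring_1 mat \<Rightarrow> nat \<Rightarrow> nat \<Rightarrow> nat \<Rightarrow> nat \<Rightarrow> 'a" where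
  "partial_inverse A k l u j = (if gram_weight A * k \<le> l then
     - (\<Sum>i<dim_row A. A $$ (i, u) * (if 2 * u + 2 * i \<le> l - gram_weight A * k
         then fps_nth (adj_coeff (gram A) k i j) (l - gram_weight A * k - (2 * u + 2 * i)) else 0)) else 0)"

text \<open>The factor of \<open>gram_coeff A k l\<close> when the combination of generators
  returned by test \<open>l\<close> is sorted by \<open>k\<close>.\<close>

definition response :: "'a :: comm_ring_1 mat \<Rightarrow> (nat \<Rightarrow> nat \<Rightarrow> 'a) \<Rightarrow> nat \<Rightarrow> nat \<Rightarrow> 'a" where
  "response A x l k = (\<Sum>n<gens_count A. x l (n + k) * gram_prefix A k n)"

context
  fixes A B :: "'a :: comm_ring_1 mat" and p q :: nat
  assumes A: "A \<in> carrier_mat p q" and B: "B \<in> carrier_mat q p" and ABA: "A * B * A = A"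
begin

private abbreviation "e \<equiv> coeff (corank_poly (A * B))"

private lemma dims: "dim_row A = p" "dim_col A = q"
  using A by auto

private lemma AB: "A * B \<in> carrier_mat p p" "A * B * (A * B) = A * B"
proof -
  show "A * B \<in> carrier_mat p p" using A B by simp
  have "A * B * (A * B) = (A * B * A) * B"
    using A B by (intro assoc_mult_mat[of "A * B" p p A q B p, symmetric]) auto
  then show "A * B * (A * B) = A * B" by (simp add: ABA)
qed

private lemma AB_A: "i < p \<Longrightarrow> v < q \<Longrightarrow> (\<Sum>j<p. (A * B) $$ (i, j) * A $$ (j, v)) = A $$ (i, v)"
  using mult_mat_entry[of "A * B" p p A q i v] AB(1) A ABA by simp

private lemma AB_gram: "map_mat fps_const (A * B) * gram A = gram A"
proof (rule eq_matI)
  fix i k assume "i < dim_row (gram A)" "k < dim_col (gram A)"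
  then have ik: "i < p" "k < p" using gram_carrier[of A] dims by auto
  have "(map_mat fps_const (A * B) * gram A) $$ (i, k) =
      (\<Sum>u<p. fps_const ((A * B) $$ (i, u)) * gram A $$ (u, k))"
    using gram_carrier[of A] AB(1) ik dims by (subst mult_mat_entry[of _ p p _ p]) auto
  also have "\<dots> = (\<Sum>u<p. \<Sum>j<q. fps_const ((A * B) $$ (i, u) * A $$ (u, j) * A $$ (k, j)) * fps_X ^ (2 * j + 2 * k))"
    using ik dims by (intro sum.cong) (auto simp: gram_def sum_distrib_left mult.assoc[symmetric])
  also have "\<dots> = (\<Sum>j<q. fps_const ((\<Sum>u<p. (A * B) $$ (i, u) * A $$ (u, j)) * A $$ (k, j)) * fps_X ^ (2 * j + 2 * k))"
    by (subst sum.swap) (simp add: sum_distrib_right fps_const_sum)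
  also have "\<dots> = gram A $$ (i, k)"
    using ik dims by (auto simp: gram_def AB_A[OF ik(1)] intro!: sum.cong)
  finally show "(map_mat fps_const (A * B) * gram A) $$ (i, k) = gram A $$ (i, k)" .
qed (use AB gram_carrier[of A] dims in auto)

private lemmas gram_car = gram_carrier[of A, unfolded dims]

lemma corank_idempotent_mult:
  "i \<le> p \<Longrightarrow> j \<le> p \<Longrightarrow> e i * e j = (if i = j then e j else 0)"
  by (rule corank_idempotents_orthogonal[OF AB])

lemma corank_gram_coeff:
  assumes "k < \<kappa>" "\<kappa> \<le> p"
  shows "e \<kappa> * gram_coeff A k l = 0"
proof -
  have "fps_const (e \<kappa>) * coeff (char_poly (gram A)) k = 0"
    by (rule corank_char_poly_coeff[OF fps_const_hom AB gram_car AB_gram assms(2,1)])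
  then have "fps_nth (fps_const (e \<kappa>) * coeff (char_poly (gram A)) k) n = 0" for n by simp
  then show ?thesis by (simp add: gram_coeff_def)
qed

text \<open>\<open>corank_adj_coeff\<close> for the Gram matrix, multiplied by \<open>A\<close> on
  the right. There \<open>A * B * A = A\<close> absorbs the projection, and what remains is compared
  at one power of \<open>X\<close>.\<close>

lemma corank_partial_inverse:
  assumes \<kappa>: "\<kappa> \<le> p" and iv: "i < p" "v < q"
  shows "e \<kappa> * (gram_coeff A \<kappa> l * A $$ (i, v))
    = e \<kappa> * (\<Sum>u<q. \<Sum>j<p. A $$ (i, u) * partial_inverse A \<kappa> l u j * A $$ (j, v))"
proof (cases "gram_weight A * \<kappa> \<le> l")
  case True
  define n where "n = l - gram_weight A * \<kappa>"
  let ?\<chi> = "coeff (char_poly (gram A)) \<kappa>" and ?D = "adj_coeff (gram A) \<kappa>"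
  let ?P = "\<lambda>i j. fps_const ((A * B) $$ (i, j))"
  have main: "fps_const (e \<kappa>) * (?\<chi> * ?P i j)
      = - (fps_const (e \<kappa>) * (\<Sum>l<p. gram A $$ (i, l) * (\<Sum>k<p. ?D l k * ?P k j)))" if "j < p" for j
    by (rule corank_adj_coeff[OF fps_const_hom AB gram_car AB_gram \<kappa> iv(1) that])
  have PA: "(\<Sum>j<p. ?P k j * fps_const (A $$ (j, v))) = fps_const (A $$ (k, v))" if "k < p" for k
    using AB_A[OF that iv(2)] by (simp add: fps_const_sum[symmetric])
  have "fps_const (e \<kappa>) * (?\<chi> * fps_const (A $$ (i, v)))
      = (\<Sum>j<p. fps_const (e \<kappa>) * (?\<chi> * ?P i j) * fps_const (A $$ (j, v)))"
    unfolding PA[OF iv(1), symmetric] sum_distrib_left by (simp only: mult.assoc)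
  also have "\<dots> = (\<Sum>j<p. - (fps_const (e \<kappa>) * (\<Sum>l<p. gram A $$ (i, l) * (\<Sum>k<p. ?D l k * ?P k j))) * fps_const (A $$ (j, v)))"
    using main by (intro sum.cong) auto
  also have "\<dots> = - (fps_const (e \<kappa>) * (\<Sum>l<p. gram A $$ (i, l) * (\<Sum>k<p. ?D l k * (\<Sum>j<p. ?P k j * fps_const (A $$ (j, v))))))"
  proof -
    have "(\<Sum>j<p. (\<Sum>l<p. gram A $$ (i, l) * (\<Sum>k<p. ?D l k * ?P k j)) * fps_const (A $$ (j, v)))
        = (\<Sum>l<p. gram A $$ (i, l) * (\<Sum>k<p. ?D l k * (\<Sum>j<p. ?P k j * fps_const (A $$ (j, v)))))"
      by (rule sum_mult_assoc)
    then show ?thesis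
      by (simp add: sum_negf sum_distrib_left[symmetric] mult.assoc)
  qed
  also have "(\<Sum>l<p. gram A $$ (i, l) * (\<Sum>k<p. ?D l k * (\<Sum>j<p. ?P k j * fps_const (A $$ (j, v)))))
      = (\<Sum>l<p. gram A $$ (i, l) * (\<Sum>k<p. ?D l k * fps_const (A $$ (k, v))))"
    using PA by (intro sum.cong refl arg_cong2[of _ _ _ _ "(*)"]) auto
  also have "\<dots> = (\<Sum>l<p. (\<Sum>u<q. fps_const (A $$ (i, u) * A $$ (l, u)) * fps_X ^ (2 * u + 2 * l)) * (\<Sum>k<p. ?D l k * fps_const (A $$ (k, v))))"
    using iv dims by (intro sum.cong) (auto simp: gram_def)
  also have "\<dots> = (\<Sum>l<p. \<Sum>u<q. \<Sum>k<p. fps_const (A $$ (i, u) * A $$ (l, u) * A $$ (k, v)) * (fps_X ^ (2 * u + 2 * l) * ?D l k))"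
    unfolding sum_product
    by (intro sum.cong refl) (simp add: fps_const_mult[symmetric] ac_simps del: fps_const_mult)
  finally have "fps_nth (fps_const (e \<kappa>) * (?\<chi> * fps_const (A $$ (i, v)))) n =
     fps_nth (- (fps_const (e \<kappa>) * (\<Sum>l<p. \<Sum>u<q. \<Sum>k<p. fps_const (A $$ (i, u) * A $$ (l, u) * A $$ (k, v)) * (fps_X ^ (2 * u + 2 * l) * ?D l k)))) n"
    by simp
  then have eq: "e \<kappa> * (fps_nth ?\<chi> n * A $$ (i, v)) = e \<kappa> * - (\<Sum>l<p. \<Sum>u<q. \<Sum>k<p.
      A $$ (i, u) * A $$ (l, u) * A $$ (k, v) * (if n < 2 * u + 2 * l then 0 else fps_nth (?D l k) (n - (2 * u + 2 * l))))"
    by (simp add: fps_sum_nth fps_X_power_mult_nth)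
  have "(\<Sum>u<q. \<Sum>j<p. A $$ (i, u) * partial_inverse A \<kappa> l u j * A $$ (j, v)) =
     - (\<Sum>u<q. \<Sum>k<p. \<Sum>l<p. A $$ (i, u) * A $$ (l, u) * A $$ (k, v) * (if n < 2 * u + 2 * l then 0 else fps_nth (?D l k) (n - (2 * u + 2 * l))))"
    using True unfolding partial_inverse_def dims n_def[symmetric] sum_negf[symmetric]
    by (auto simp: sum_distrib_left sum_distrib_right sum_negf[symmetric] not_less ac_simps intro!: sum.cong)
  also have "\<dots> = - (\<Sum>l<p. \<Sum>u<q. \<Sum>k<p.
      A $$ (i, u) * A $$ (l, u) * A $$ (k, v) * (if n < 2 * u + 2 * l then 0 else fps_nth (?D l k) (n - (2 * u + 2 * l))))"
    by (rule arg_cong[of _ _ uminus], rule sum_rotate)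
  finally show ?thesis using eq True by (simp add: gram_coeff_def n_def)
qed (simp add: gram_coeff_def partial_inverse_def)

text \<open>The lowest term and the idempotents see the same corank. For \<open>k < card Z\<close>:
  the rows in \<open>Z\<close> make \<open>det (Y (1 - A B) + A B)\<close> divisible by
  \<open>Y^card Z\<close> modulo \<open>M\<close>. For \<open>k > card Z\<close>: \<open>e k\<close>
  annihilates the lowest coefficient, which is not in \<open>M\<close>.\<close>

lemma corank_at_maximal:
  assumes M: "is_maximal M"
  obtains \<kappa> l where "\<kappa> \<le> p" "l \<le> max_height A" "gram_coeff A \<kappa> l \<notin> M"
    "\<And>k l'. l' \<le> l \<Longrightarrow> (k, l') \<noteq> (\<kappa>, l) \<Longrightarrow> gram_coeff A k l' \<in> M"
    "\<And>k. k \<le> p \<Longrightarrow> k \<noteq> \<kappa> \<Longrightarrow> e k \<in> M"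
proof -
  note I = maximal_ideal[OF M]
  obtain Z \<sigma> L R l where Z: "Z = {i. i < p \<and> \<sigma> i = q}" and l: "l \<le> gram_weight A * p"
    and low: "gram_coeff A (card Z) l \<notin> M"
      "\<And>k l'. l' \<le> l \<Longrightarrow> (k, l') \<noteq> (card Z, l) \<Longrightarrow> gram_coeff A k l' \<in> M"
    and Ld: "\<And>i. L i i = 1" and Lu: "\<And>i k. i < k \<Longrightarrow> L i k = 0"
    and R: "\<And>i j. R i j = (\<Sum>k\<le>i. L i k * A $$ (k, j))" and R0: "\<And>i j. j < \<sigma> i \<Longrightarrow> R i j \<in> M"
    by (rule gram_coeff_lowest[OF M A]) (rule that)
  let ?P = "map_mat (\<lambda>a. [:a:]) (A * B)" and ?Y = "[:0, 1:] :: 'a poly"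
  let ?Q = "pencil ?Y ?P"
  define LL where "LL = mat p p (\<lambda>(i, k). [:L i k:])"
  have P: "?P \<in> carrier_mat p p" using AB by simp
  have car: "LL \<in> carrier_mat p p" "?Q \<in> carrier_mat p p"
    using pencil_carrier[OF P] by (auto simp: LL_def)
  have "det LL = 1"
    using Ld Lu car by (intro det_unit_lower_triangular[of _ p]) (auto simp: LL_def one_pCons)
  then have det: "det (LL * ?Q) = corank_poly (A * B)"
    unfolding det_mult[OF car] by (simp add: corank_poly_def)
  note F = filtration_low_coeffs[OF I]
  \<comment> \<open>At \<open>Y = 0\<close> the pencil is \<open>A * B\<close>, so row
    \<open>i\<close> of the product is the reduced row times \<open>B\<close>, in \<open>M\<close>
    when the row vanishes modulo \<open>M\<close>.\<close>
  have entry: "(LL * ?Q) $$ (i, j) \<in> low_coeffs M (if \<sigma> i = q then 1 else 0)" if ij: "i < p" "j < p" for i j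
  proof (cases "\<sigma> i = q")
    case True
    have R': "(\<Sum>k<p. L i k * A $$ (k, u)) = R i u" for u
      unfolding R using ij Lu by (intro sum.mono_neutral_right) auto
    have "coeff ((LL * ?Q) $$ (i, j)) 0 = (\<Sum>k<p. L i k * (A * B) $$ (k, j))"
      unfolding mult_mat_entry[OF car ij] using ij AB(1)
      by (auto simp: coeff_sum LL_def pencil_def dims intro!: sum.cong)
    also have "\<dots> = (\<Sum>k<p. \<Sum>u<q. L i k * (A $$ (k, u) * B $$ (u, j)))"
      using mult_mat_entry[OF A B _ ij(2)] by (intro sum.cong) (auto simp: sum_distrib_left)
    also have "\<dots> = (\<Sum>u<q. R i u * B $$ (u, j))"
      unfolding R'[symmetric] sum_distrib_right by (subst sum.swap) (simp only: mult.assoc)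
    also have "\<dots> \<in> M"
      using R0[of _ i] True by (intro ideal_sum[OF I] ideal_mult_right[OF I]) auto
    finally show ?thesis using True by (simp add: low_coeffs_def)
  qed (simp add: low_coeffs_def)
  have Zsum: "(\<Sum>i=0..<p. if \<sigma> i = q then 1 else 0 :: nat) = card Z"
  proof -
    have "Z = {0..<p} \<inter> {i. \<sigma> i = q}" by (auto simp: Z)
    then show ?thesis by (simp only: card_eq_sum) (subst sum.inter_restrict; simp)
  qed
  have perm: "(\<Prod>i=0..<p. (LL * ?Q) $$ (i, \<pi> i)) \<in> low_coeffs M (card Z)" if "\<pi> permutes {0..<p}" for \<pi>
    unfolding Zsum[symmetric] using permutes_in_image[OF that] entry
    by (intro filtration_prod[OF F]) auto
  have LQ: "LL * ?Q \<in> carrier_mat p p" using car by simp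
  have d: "det (LL * ?Q) - (\<Prod>i=0..<p. (LL * ?Q) $$ (i, i)) \<in> low_coeffs M (card Z)"
    by (rule det_minus_diagonal[OF LQ]) (simp_all only: perm filtration_closed(1-3)[OF F])
  have i: "(\<Prod>i=0..<p. (LL * ?Q) $$ (i, i)) \<in> low_coeffs M (card Z)"
    using perm[OF permutes_id] by simp
  have "corank_poly (A * B) \<in> low_coeffs M (card Z)"
    using filtration_closed(2)[OF F d i] unfolding det by simp
  then have less: "e k \<in> M" if "k < card Z" for k using that by (simp add: low_coeffs_def)
  have more: "e k \<in> M" if "card Z < k" "k \<le> p" for k
    using maximal_prime[OF M, of "gram_coeff A (card Z) l" "e k"] low(1) corank_gram_coeff[OF that, of l] ideal_0[OF I]
    by (simp add: mult.commute)
  have "card Z \<le> card {..<p}" unfolding Z by (intro card_mono) auto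
  then show thesis
    using l low less more by (intro that[of "card Z" l]) (auto simp: max_height_def dims neq_iff)
qed

lemma corank_gram_prefix:
  assumes "k < \<kappa>" "\<kappa> \<le> p"
  shows "e \<kappa> * gram_prefix A k l = 0"
  unfolding gram_prefix_def sum_distrib_left using assms by (intro sum.neutral ballI corank_gram_coeff) auto

lemma corank_gram_prefix_eq:
  assumes "\<kappa> \<le> p"
  shows "e \<kappa> * gram_prefix A \<kappa> l = e \<kappa> * gram_coeff A \<kappa> l"
proof -
  have "{..\<kappa>} = insert \<kappa> {..<\<kappa>}" by auto
  then show ?thesis
    using assms corank_gram_coeff[of _ \<kappa> l]
    by (simp add: gram_prefix_def distrib_left sum_distrib_left)
qed

text \<open>Shown locally. At a maximal ideal of corank \<open>\<kappa>\<close> and height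
  \<open>h\<close>, multiplication by \<open>e \<kappa>\<close> leaves the coefficients with
  \<open>k \<ge> \<kappa>\<close>. The generators with indices \<open>h + \<kappa>\<close> to
  \<open>h + p\<close> are combinations of them with a matrix \<open>T\<close> whose determinant is
  not in \<open>M\<close>, so \<open>e \<kappa> * det T\<close> brings every coefficient into the
  ideal.\<close>

lemma test_elem_in_ideal:
  "test_elem A l \<in> fg_ideal (map (test_gen A l) [0..<gens_count A])" (is "_ \<in> ?I")
proof -
  note I = fg_ideal_is_ideal[of "map (test_gen A l) [0..<gens_count A]"]
  have gen: "test_gen A l j \<in> ?I" if "j < gens_count A" for j
    using fg_ideal_gen[of j "map (test_gen A l) [0..<gens_count A]"] that by simp
  let ?b = "{b. b * test_elem A l \<in> ?I}"
  have b: "is_ideal ?b"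
    unfolding is_ideal_def using ideal_0[OF I] ideal_add[OF I] ideal_mult_left[OF I]
    by (auto simp: distrib_right mult.assoc)
  have "1 \<in> ?b"
  proof (rule ideal_contains_1[OF b])
    fix M assume M: "is_maximal M" and bM: "?b \<subseteq> M"
    note IM = maximal_ideal[OF M]
    obtain \<kappa> h where \<kappa>: "\<kappa> \<le> p" and h: "h \<le> max_height A" and lead: "gram_coeff A \<kappa> h \<notin> M"
      and low: "\<And>k l'. l' \<le> h \<Longrightarrow> (k, l') \<noteq> (\<kappa>, h) \<Longrightarrow> gram_coeff A k l' \<in> M"
      and ek: "\<And>k. k \<le> p \<Longrightarrow> k \<noteq> \<kappa> \<Longrightarrow> e k \<in> M"
      using corank_at_maximal[OF M] by blast
    have e: "e \<kappa> \<notin> M"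
    proof
      assume "e \<kappa> \<in> M"
      then have "(\<Sum>k\<le>p. e k) \<in> M" using ek by (intro ideal_sum[OF IM]) auto
      then show False using corank_idempotents_sum[OF AB(1)] maximal_1[OF M] by simp
    qed
    let ?n = "p + 1 - \<kappa>"
    let ?a = "\<lambda>s. gram_coeff A (\<kappa> + s) l"
    \<comment> \<open>Row \<open>r\<close> belongs to generator \<open>h + \<kappa> + r\<close>,
      column \<open>s\<close> to coefficient \<open>\<kappa> + s\<close>. The prefix sum is taken at
      weight \<open>h + r - s\<close>, which is below \<open>h\<close> above the diagonal and equal
      to \<open>h\<close> on it.\<close>
    define T where "T = mat ?n ?n (\<lambda>(r, s). if \<kappa> + s \<le> h + \<kappa> + r then gram_prefix A (\<kappa> + s) (h + \<kappa> + r - (\<kappa> + s)) else 0)"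
    have T: "T \<in> carrier_mat ?n ?n" by (simp add: T_def)
    have pre_low: "gram_prefix A k l' \<in> M" if "l' < h" for k l'
      unfolding gram_prefix_def using that low by (intro ideal_sum[OF IM]) auto
    have "T $$ (r, s) \<in> M" if "r < s" "s < ?n" for r s
      using that pre_low ideal_0[OF IM] by (auto simp: T_def)
    from det_triangular_mod[OF T IM this] have dT: "det T - (\<Prod>i=0..<?n. T $$ (i, i)) \<in> M" by simp
    have "(\<Prod>i=0..<?n. T $$ (i, i)) \<notin> M"
    proof (rule maximal_prod[OF M])
      fix i assume "i \<in> {0..<?n}"
      then have "T $$ (i, i) = gram_prefix A (\<kappa> + i) h" by (simp add: T_def)
      also have "\<dots> = gram_coeff A \<kappa> h + (\<Sum>k\<in>{..\<kappa> + i} - {\<kappa>}. gram_coeff A k h)"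
        unfolding gram_prefix_def by (intro sum.remove) auto
      finally have "gram_coeff A \<kappa> h = T $$ (i, i) - (\<Sum>k\<in>{..\<kappa> + i} - {\<kappa>}. gram_coeff A k h)" by simp
      moreover have "(\<Sum>k\<in>{..\<kappa> + i} - {\<kappa>}. gram_coeff A k h) \<in> M"
        using low by (intro ideal_sum[OF IM]) auto
      ultimately show "T $$ (i, i) \<notin> M" using lead ideal_diff[OF IM] by metis
    qed
    then have "det T \<notin> M" using ideal_diff[OF IM _ dT, of "det T"] by auto
    have row: "e \<kappa> * (\<Sum>s<?n. T $$ (r, s) * ?a s) \<in> ?I" if r: "r < ?n" for r
    proof -
      have "e \<kappa> * test_gen A l (h + \<kappa> + r) =
          (\<Sum>k\<le>p. e \<kappa> * (gram_coeff A k l * (if k \<le> h + \<kappa> + r then gram_prefix A k (h + \<kappa> + r - k) else 0)))"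
        by (simp add: test_gen_def dims sum_distrib_left)
      also have "\<dots> = (\<Sum>k\<in>(+) \<kappa> ` {..<?n}. e \<kappa> * (gram_coeff A k l * (if k \<le> h + \<kappa> + r then gram_prefix A k (h + \<kappa> + r - k) else 0)))"
      proof (rule sum.mono_neutral_right)
        show "\<forall>k\<in>{..p} - (+) \<kappa> ` {..<?n}. e \<kappa> * (gram_coeff A k l * (if k \<le> h + \<kappa> + r then gram_prefix A k (h + \<kappa> + r - k) else 0)) = 0"
        proof
          fix k assume k: "k \<in> {..p} - (+) \<kappa> ` {..<?n}"
          have "k < \<kappa>"
          proof (rule ccontr)
            assume "\<not> k < \<kappa>"
            then have "k = \<kappa> + (k - \<kappa>)" "k - \<kappa> < ?n" using k by auto
            then show False using k by blast
          qed
          then have "e \<kappa> * gram_coeff A k l = 0" using \<kappa> by (rule corank_gram_coeff)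
          then show "e \<kappa> * (gram_coeff A k l * (if k \<le> h + \<kappa> + r then gram_prefix A k (h + \<kappa> + r - k) else 0)) = 0"
            by (simp only: mult.assoc[symmetric]) simp
        qed
      qed auto
      also have "\<dots> = e \<kappa> * (\<Sum>s<?n. T $$ (r, s) * ?a s)"
        using r by (subst sum.reindex) (auto simp: T_def sum_distrib_left mult.commute intro!: sum.cong)
      finally have "e \<kappa> * test_gen A l (h + \<kappa> + r) = e \<kappa> * (\<Sum>s<?n. T $$ (r, s) * ?a s)" .
      moreover have "h + \<kappa> + r < gens_count A"
        using h r \<kappa> by (simp add: gens_count_def dims)
      ultimately show ?thesis using ideal_mult_left[OF I gen] by metis
    qed
    \<comment> \<open>Cramer's rule: the relations in \<open>row\<close> are combined with the
      entries of the adjugate of \<open>T\<close>.\<close>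
    have each: "e \<kappa> * det T * ?a s \<in> ?I" if s: "s < ?n" for s
    proof -
      have "(adj_mat T * T) $$ (s, t) = (if s = t then det T else 0)" if "t < ?n" for t
        unfolding adj_mat(3)[OF T] using s that by simp
      then have "(\<Sum>t<?n. (\<Sum>r<?n. adj_mat T $$ (s, r) * T $$ (r, t)) * ?a t) = (\<Sum>t<?n. (if s = t then det T else 0) * ?a t)"
        using mult_mat_entry[OF adj_mat(1)[OF T] T s] by (intro sum.cong) auto
      then have "det T * ?a s = (\<Sum>t<?n. (\<Sum>r<?n. adj_mat T $$ (s, r) * T $$ (r, t)) * ?a t)"
        using s by (simp only: sum_delta_mult)
      also have "\<dots> = (\<Sum>r<?n. adj_mat T $$ (s, r) * (\<Sum>t<?n. T $$ (r, t) * ?a t))"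
        unfolding sum_distrib_left sum_distrib_right by (subst sum.swap) (simp only: mult.assoc)
      finally have "e \<kappa> * det T * ?a s = (\<Sum>r<?n. adj_mat T $$ (s, r) * (e \<kappa> * (\<Sum>t<?n. T $$ (r, t) * ?a t)))"
        by (simp add: mult.assoc sum_distrib_left mult.left_commute[of "e \<kappa>"])
      also have "\<dots> \<in> ?I" by (rule ideal_sum[OF I], rule ideal_mult_left[OF I], rule row) simp
      finally show ?thesis .
    qed
    have "e \<kappa> * det T * gram_coeff A k l \<in> ?I" if "k \<le> p" for k
    proof (cases "k < \<kappa>")
      case True
      then have "e \<kappa> * gram_coeff A k l = 0" using \<kappa> by (rule corank_gram_coeff)
      then have "e \<kappa> * det T * gram_coeff A k l = 0" by (metis mult.commute mult.left_commute mult_zero_right)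
      then show ?thesis using ideal_0[OF I] by simp
    next
      case False
      then show ?thesis using each[of "k - \<kappa>"] that by simp
    qed
    then have "e \<kappa> * det T * test_elem A l \<in> ?I"
      unfolding test_elem_def sum_distrib_left dims by (intro ideal_sum[OF I]) auto
    then have "e \<kappa> * det T \<in> M" using bM by auto
    then show False using maximal_prime[OF M _ e] \<open>det T \<notin> M\<close> by blast
  qed
  then show ?thesis by simp
qed

text \<open>
  Each answer \<open>x l\<close> yields elements \<open>response A x l k\<close> of the ideal of rank \<open>\<ge> p - k\<close>. At a maximal
  ideal where the lowest term has corank \<open>\<kappa>\<close> and height \<open>l\<close>, the element \<open>response A x l \<kappa>\<close> is 1,
  whatever the other answers are.
\<close>

context
  fixes x \<xi> :: "nat \<Rightarrow> nat \<Rightarrow> 'a" and f z :: "nat \<Rightarrow> 'a"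
  assumes x: "\<And>l. l \<le> max_height A \<Longrightarrow> test_elem A l = (\<Sum>j<gens_count A. x l j * test_gen A l j)"
    and x0: "\<And>l j. j \<ge> gens_count A \<Longrightarrow> x l j = 0"
    and f: "\<And>k. k \<le> p \<Longrightarrow> 1 - f k = (\<Prod>l\<le>max_height A. 1 - response A x l k)"
    and \<xi>: "\<And>k. k \<le> p \<Longrightarrow> f k = (\<Sum>n<gens_count A. \<xi> k n * gram_prefix A k n)"
begin

lemma test_elem_response:
  assumes "l \<le> max_height A"
  shows "test_elem A l = (\<Sum>k\<le>p. gram_coeff A k l * response A x l k)"
proof -
  have "(\<Sum>j<gens_count A. x l j * (if k \<le> j then gram_prefix A k (j - k) else 0)) = response A x l k" for k
  proof -
    let ?g = "\<lambda>n. x l (n + k) * gram_prefix A k n"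
    have "(\<Sum>j<gens_count A. x l j * (if k \<le> j then gram_prefix A k (j - k) else 0))
        = (\<Sum>j\<in>{k..<gens_count A}. ?g (j - k))"
      by (rule sum.mono_neutral_cong_right) auto
    also have "\<dots> = (\<Sum>n\<in>{..<gens_count A - k}. ?g n)"
      by (rule sum.reindex_bij_witness[of _ "\<lambda>n. n + k" "\<lambda>j. j - k"]) auto
    \<comment> \<open>The added terms have \<open>n + k\<close> beyond the generators, where the
      answer is 0 by \<open>x0\<close>.\<close>
    also have "\<dots> = (\<Sum>n<gens_count A. ?g n)"
      by (rule sum.mono_neutral_left) (auto simp: x0)
    finally show ?thesis by (simp add: response_def)
  qed
  note resp = this
  have "test_elem A l = (\<Sum>k\<le>p. \<Sum>j<gens_count A. gram_coeff A k l * (x l j * (if k \<le> j then gram_prefix A k (j - k) else 0)))"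
    unfolding x[OF assms] test_gen_def dims sum_distrib_left
    by (subst sum.swap) (simp only: mult.left_commute)
  then show ?thesis by (simp only: sum_distrib_left[symmetric] resp)
qed

text \<open>By \<open>test_elem_response\<close> the sum of
  \<open>gram_coeff A j h * (1 - response A x h j)\<close> is 0. At the lowest weight
  \<open>h\<close>, only the term with \<open>j = k\<close> has a coefficient outside
  \<open>M\<close>, so \<open>response A x h k\<close> is 1 modulo \<open>M\<close>, and with it
  \<open>f k\<close>.\<close>

lemma combined_at_maximal:
  assumes M: "is_maximal M" and k: "k \<le> p" and ek: "e k \<notin> M"
  shows "f k \<notin> M"
proof -
  note I = maximal_ideal[OF M]
  obtain \<kappa> h where \<kappa>: "\<kappa> \<le> p" and h: "h \<le> max_height A" and lead: "gram_coeff A \<kappa> h \<notin> M"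
    and low: "\<And>k l'. l' \<le> h \<Longrightarrow> (k, l') \<noteq> (\<kappa>, h) \<Longrightarrow> gram_coeff A k l' \<in> M"
    and e: "\<And>k. k \<le> p \<Longrightarrow> k \<noteq> \<kappa> \<Longrightarrow> e k \<in> M"
    using corank_at_maximal[OF M] by blast
  have [simp]: "\<kappa> = k" using e k ek by auto
  have "(\<Sum>j\<le>p. gram_coeff A j h * (1 - response A x h j)) = 0"
    using test_elem_response[OF h] by (simp add: test_elem_def dims right_diff_distrib sum_subtractf)
  then have "gram_coeff A k h * (1 - response A x h k) = - (\<Sum>j\<in>{..p} - {k}. gram_coeff A j h * (1 - response A x h j))"
    using k by (subst (asm) sum.remove[of _ k]) (auto simp: eq_neg_iff_add_eq_0)
  also have "\<dots> \<in> M" using low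
    by (intro ideal_uminus[OF I] ideal_sum[OF I] ideal_mult_right[OF I]) auto
  finally have "1 - response A x h k \<in> M" using maximal_prime[OF M _ lead] by simp
  then have "1 - f k \<in> M" unfolding f[OF k] using h by (intro ideal_prod[OF I, of _ h]) auto
  then show ?thesis using maximal_1[OF M] ideal_add[OF I, of "1 - f k" "f k"] by auto
qed

lemma corank_combined:
  assumes "k < \<kappa>" "\<kappa> \<le> p"
  shows "e \<kappa> * f k = 0"
  using corank_gram_prefix[OF assms] assms
  by (simp add: \<xi> sum_distrib_left mult.left_commute[of "e \<kappa>"])

text \<open>The bracket is the sum of the \<open>e j\<close> with \<open>j \<ge> k\<close>, and
  those with \<open>j > k\<close> annihilate \<open>f k\<close>. The left side contains only
  idempotents that are already computed at stage \<open>k\<close>.\<close>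

lemma residual_eq:
  assumes k: "k \<le> p"
  shows "f k * (1 - (\<Sum>j<k. e j)) = e k * f k"
proof -
  have "1 - (\<Sum>j<k. e j) = (\<Sum>j\<in>{k..p}. e j)"
  proof -
    have "(\<Sum>j\<le>p. e j) = (\<Sum>j<k. e j) + (\<Sum>j\<in>{k..p}. e j)"
      using k by (subst sum.union_disjoint[symmetric]) (auto intro!: sum.cong)
    then show ?thesis
      unfolding corank_idempotents_sum[OF AB(1)] by (metis add_diff_cancel_left')
  qed
  also have "f k * \<dots> = (\<Sum>j\<in>{k..p}. if j = k then e k * f k else 0)"
    unfolding sum_distrib_left using corank_combined[of k] by (intro sum.cong) (auto simp: mult.commute)
  also have "\<dots> = e k * f k" using k by simp
  finally show ?thesis .
qed

text \<open>No maximal ideal that avoids \<open>e k\<close> contains \<open>f k\<close>, so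
  \<open>e k\<close> is a multiple of \<open>e k * f k\<close>; multiplying by
  \<open>e k * f k\<close> once more gives the square.\<close>

lemma residual_in_square:
  assumes k: "k \<le> p"
  shows "\<exists>c. e k * f k = c * (e k * f k * (e k * f k))"
proof -
  let ?v = "e k * f k"
  let ?b = "{b. \<exists>c. b * e k = c * ?v}"
  have idem: "e k * e k = e k" using corank_idempotent_mult[OF k k] by simp
  have b: "is_ideal ?b"
    unfolding is_ideal_def
  proof (intro conjI ballI allI)
    show "0 \<in> ?b" by (auto intro: exI[of _ 0])
    show "u + v \<in> ?b" if "u \<in> ?b" "v \<in> ?b" for u v
    proof -
      from that obtain c d where "u * e k = c * ?v" "v * e k = d * ?v" by auto
      then have "(u + v) * e k = (c + d) * ?v" by (simp add: distrib_right)
      then show ?thesis by blast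
    qed
    show "c * u \<in> ?b" if "u \<in> ?b" for c u
    proof -
      from that obtain d where "u * e k = d * ?v" by auto
      then have "(c * u) * e k = (c * d) * ?v" by (simp add: mult.assoc)
      then show ?thesis by blast
    qed
  qed
  have "1 \<in> ?b"
  proof (rule ideal_contains_1[OF b])
    fix M assume M: "is_maximal M" and bM: "?b \<subseteq> M"
    note I = maximal_ideal[OF M]
    have "(1 - e k) * e k = 0 * ?v" using idem by (simp add: left_diff_distrib)
    then have 1: "1 - e k \<in> M" using bM by blast
    have "e k \<notin> M" using ideal_add[OF I 1, of "e k"] maximal_1[OF M] by auto
    moreover have "f k * e k = 1 * ?v" by (simp add: mult.commute)
    then have "f k \<in> M" using bM by blast
    ultimately show False using combined_at_maximal[OF M k] by blast
  qed
  then obtain c where c: "e k = c * ?v" by auto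
  have "?v = (c * ?v) * ?v"
    using idem unfolding c[symmetric] by (simp add: mult.assoc[symmetric])
  then show ?thesis by (metis mult.assoc)
qed

text \<open>Every positive answer \<open>c\<close> is good enough:
  \<open>(1 - e k * f k * c) * e k\<close> is annihilated by both \<open>1 - e k\<close> and
  \<open>f k\<close>, and no maximal ideal contains these two.\<close>

lemma residual_idempotent:
  assumes k: "k \<le> p" and c: "e k * f k = c * (e k * f k * (e k * f k))"
  shows "e k * f k * c = e k"
proof -
  let ?v = "e k * f k"
  have idem: "e k * e k = e k" using corank_idempotent_mult[OF k k] by simp
  have "(1 - ?v * c) * e k = 0"
  proof -
    let ?b = "{b. b * ((1 - ?v * c) * e k) = 0}"
    have b: "is_ideal ?b" by (auto simp: is_ideal_def distrib_right mult.assoc)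
    have "1 \<in> ?b"
    proof (rule ideal_contains_1[OF b])
      fix M assume M: "is_maximal M" and bM: "?b \<subseteq> M"
      note I = maximal_ideal[OF M]
      have "(1 - e k) * ((1 - ?v * c) * e k) = (1 - ?v * c) * (e k - e k * e k)" by (simp add: algebra_simps)
      then have 1: "1 - e k \<in> M" using bM idem by auto
      have "e k \<notin> M" using ideal_add[OF I 1, of "e k"] maximal_1[OF M] by auto
      then have "f k \<notin> M" using combined_at_maximal[OF M k] by blast
      moreover have "f k * ((1 - ?v * c) * e k) = ?v - c * (?v * ?v)" by (simp add: algebra_simps)
      then have "f k \<in> M" using bM c by auto
      ultimately show False by blast
    qed
    then show ?thesis by simp
  qed
  then have "e k = ?v * c * e k" by (simp add: left_diff_distrib)
  also have "\<dots> = (e k * e k) * f k * c" by (simp only: ac_simps)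
  finally show ?thesis by (simp add: idem)
qed

text \<open>On part \<open>k\<close>, the combination of partial inverses with coefficients
  \<open>\<xi> k\<close> satisfies \<open>A X A = f k A\<close>, since there the prefix sum is the
  coefficient of corank \<open>k\<close>. Then \<open>z k\<close> removes \<open>f k\<close>, and
  the parts add up because the idempotents have sum 1.\<close>

lemma assembled_inverse:
  assumes z: "\<And>k. k \<le> p \<Longrightarrow> e k * f k * z k = e k" and iv: "i < p" "v < q"
  shows "(\<Sum>u<q. \<Sum>j<p. A $$ (i, u) * (\<Sum>k\<le>p. e k * z k * (\<Sum>n<gens_count A. \<xi> k n * partial_inverse A k n u j)) * A $$ (j, v))
    = A $$ (i, v)"
proof -
  have "(\<Sum>u<q. \<Sum>j<p. A $$ (i, u) * (\<Sum>k\<le>p. e k * z k * (\<Sum>n<gens_count A. \<xi> k n * partial_inverse A k n u j)) * A $$ (j, v))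
    = (\<Sum>u<q. \<Sum>j<p. \<Sum>k\<le>p. \<Sum>n<gens_count A. z k * \<xi> k n * (e k * (A $$ (i, u) * partial_inverse A k n u j * A $$ (j, v))))"
    by (simp add: sum_distrib_left sum_distrib_right ac_simps)
  also have "\<dots> = (\<Sum>k\<le>p. \<Sum>u<q. \<Sum>j<p. \<Sum>n<gens_count A. z k * \<xi> k n * (e k * (A $$ (i, u) * partial_inverse A k n u j * A $$ (j, v))))"
    by (rule sum_rotate)
  also have "\<dots> = (\<Sum>k\<le>p. \<Sum>n<gens_count A. \<Sum>u<q. \<Sum>j<p. z k * \<xi> k n * (e k * (A $$ (i, u) * partial_inverse A k n u j * A $$ (j, v))))"
    by (intro sum.cong refl sum_rotate)
  also have "\<dots> = (\<Sum>k\<le>p. \<Sum>n<gens_count A. z k * \<xi> k n * (e k * (gram_coeff A k n * A $$ (i, v))))"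
    using corank_partial_inverse[OF _ iv] by (intro sum.cong refl) (simp add: sum_distrib_left[symmetric])
  also have "\<dots> = (\<Sum>k\<le>p. \<Sum>n<gens_count A. z k * \<xi> k n * (e k * gram_prefix A k n * A $$ (i, v)))"
    by (intro sum.cong refl) (simp add: corank_gram_prefix_eq mult.assoc)
  also have "\<dots> = (\<Sum>k\<le>p. e k * f k * z k * A $$ (i, v))"
    by (intro sum.cong refl) (simp add: \<xi> sum_distrib_left sum_distrib_right ac_simps)
  also have "\<dots> = (\<Sum>k\<le>p. e k) * A $$ (i, v)"
    unfolding sum_distrib_right by (intro sum.cong refl) (simp add: z)
  finally show ?thesis using corank_idempotents_sum[OF AB(1)] by simp
qed

end

end

section \<open>Locally simple matrices\<close>

lemma vec_is_module: "Module.module class_ring (module_vec TYPE('a :: comm_ring_1) m)"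
proof -
  interpret vec_module "TYPE('a)" m .
  show ?thesis by unfold_locales
qed

lemma submodule_vec_iff:
  "submodule class_ring W (module_vec TYPE('a :: comm_ring_1) m) \<longleftrightarrow>
    W \<subseteq> carrier_vec m \<and> 0\<^sub>v m \<in> W \<and> (\<forall>v\<in>W. \<forall>w\<in>W. v + w \<in> W) \<and> (\<forall>c. \<forall>v\<in>W. c \<cdot>\<^sub>v v \<in> W)"
  using vec_is_module by (auto simp: submodule_def module_vec_simps)

lemma submodule_vec_sum:
  assumes W: "submodule class_ring W (module_vec TYPE('a :: comm_ring_1) m)"
    and "finite I" "\<And>i. i \<in> I \<Longrightarrow> w i \<in> W"
  shows "vec m (\<lambda>r. \<Sum>i\<in>I. c i * w i $ r) \<in> W"
  using assms(2,3)
proof (induction I)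
  case empty
  have "vec m (\<lambda>r. \<Sum>i\<in>{}. c i * w i $ r) = 0\<^sub>v m" by (intro eq_vecI) auto
  moreover have "0\<^sub>v m \<in> W" using W by (simp add: submodule_vec_iff)
  ultimately show ?case by metis
next
  case (insert i I)
  have "w i \<in> carrier_vec m" using W insert by (auto simp: submodule_vec_iff)
  then have "vec m (\<lambda>r. \<Sum>i\<in>insert i I. c i * w i $ r) = c i \<cdot>\<^sub>v w i + vec m (\<lambda>r. \<Sum>i\<in>I. c i * w i $ r)"
    using insert.hyps by (intro eq_vecI) auto
  also have "\<dots> \<in> W" using W insert unfolding submodule_vec_iff by auto
  finally show ?case .
qed

lemma mult_mat_vec_entry:
  assumes "A \<in> carrier_mat nr nc" "x \<in> carrier_vec nc" "i < nr"
  shows "(A *\<^sub>v x) $ i = (\<Sum>j<nc. A $$ (i, j) * x $ j)"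
  using assms by (simp add: scalar_prod_def atLeast0LessThan)

lemma mult_mat_vec_smult:
  fixes A :: "'a :: comm_ring_1 mat"
  assumes A: "A \<in> carrier_mat nr nc" and x: "x \<in> carrier_vec nc"
  shows "A *\<^sub>v (c \<cdot>\<^sub>v x) = c \<cdot>\<^sub>v (A *\<^sub>v x)"
proof (rule eq_vecI)
  fix i assume "i < dim_vec (c \<cdot>\<^sub>v (A *\<^sub>v x))"
  then have i: "i < nr" using A by simp
  have cx: "c \<cdot>\<^sub>v x \<in> carrier_vec nc" using x by simp
  have "(A *\<^sub>v (c \<cdot>\<^sub>v x)) $ i = c * (\<Sum>j<nc. A $$ (i, j) * x $ j)"
    unfolding mult_mat_vec_entry[OF A cx i] sum_distrib_left using x by (intro sum.cong) (auto simp: ac_simps)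
  also have "\<dots> = (c \<cdot>\<^sub>v (A *\<^sub>v x)) $ i"
    unfolding mult_mat_vec_entry[OF A x i, symmetric] using A i by simp
  finally show "(A *\<^sub>v (c \<cdot>\<^sub>v x)) $ i = (c \<cdot>\<^sub>v (A *\<^sub>v x)) $ i" .
qed (use A in simp)

text \<open>If the unit vectors are split along the image and a complement, preimages of their image
  parts are the columns of \<open>B\<close>; every column of \<open>A - A B A\<close> lies in both
  summands. Conversely, the kernel of \<open>A B\<close> is a complement of the image.\<close>

lemma locally_simple_iff:
  fixes A :: "'a :: comm_ring_1 mat"
  assumes A: "A \<in> carrier_mat m n"
  shows "locally_simple A \<longleftrightarrow> (\<exists>B\<in>carrier_mat n m. A * B * A = A)"
proof
  have dims: "dim_row A = m" "dim_col A = n" using A by auto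
  assume "locally_simple A"
  then obtain N where W: "submodule class_ring (mat_image A) (module_vec TYPE('a) m)"
    and N: "submodule class_ring N (module_vec TYPE('a) m)"
    and sum: "{v + w | v w. v \<in> mat_image A \<and> w \<in> N} = carrier_vec m" and int: "mat_image A \<inter> N = {0\<^sub>v m}"
    unfolding locally_simple_def direct_summand_def dims by blast
  have "\<exists>x w. x \<in> carrier_vec n \<and> w \<in> N \<and> unit_vec m i = A *\<^sub>v x + w" for i
  proof -
    have "unit_vec m i \<in> {v + w | v w. v \<in> mat_image A \<and> w \<in> N}" unfolding sum by simp
    then show ?thesis unfolding mat_image_def dims by auto
  qed
  then obtain x w where x: "\<And>i. x i \<in> carrier_vec n" and w: "\<And>i. w i \<in> N"
    and u: "\<And>i. unit_vec m i = A *\<^sub>v x i + w i" by metis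
  have wc: "w i \<in> carrier_vec m" for i using w N by (auto simp: submodule_vec_iff)
  define B where "B = mat n m (\<lambda>(j, i). x i $ j)"
  have B: "B \<in> carrier_mat n m" by (simp add: B_def)
  have w_entry: "w i $ r = (if i = r then 1 else 0) - (\<Sum>j<n. A $$ (r, j) * x i $ j)" if "i < m" "r < m" for i r
  proof -
    have "unit_vec m i $ r = (A *\<^sub>v x i) $ r + w i $ r"
      unfolding u using that A wc[of i] by simp
    then have "w i $ r = unit_vec m i $ r - (A *\<^sub>v x i) $ r" by simp
    then show ?thesis unfolding mult_mat_vec_entry[OF A x that(2)] using that by (cases "i = r") auto
  qed
  have "A * B * A = A"
  proof (rule eq_matI)
    fix r j assume "r < dim_row A" "j < dim_col A"
    then have rj: "r < m" "j < n" using A by auto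
    have AB: "A * B \<in> carrier_mat m m" using A B by simp
    have BA: "B * A \<in> carrier_mat n n" using A B by simp
    \<comment> \<open>Column \<open>j\<close> of \<open>A - A B A\<close>, written as a combination
      of the components \<open>w i\<close> in the complement.\<close>
    define v where "v = vec m (\<lambda>r. \<Sum>i<m. A $$ (i, j) * w i $ r)"
    have "v \<in> N" unfolding v_def using w by (intro submodule_vec_sum[OF N]) auto
    have ve: "v $ r = A $$ (r, j) - (A * B * A) $$ (r, j)" if "r < m" for r
    proof -
      have "v $ r = (\<Sum>i<m. A $$ (i, j) * ((if i = r then 1 else 0) - (\<Sum>j<n. A $$ (r, j) * x i $ j)))"
        using that w_entry by (simp add: v_def)
      also have "\<dots> = A $$ (r, j) - (\<Sum>i<m. (\<Sum>u<n. A $$ (r, u) * B $$ (u, i)) * A $$ (i, j))"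
        using that by (simp add: right_diff_distrib sum_subtractf sum_delta_mult B_def mult.commute)
      also have "(\<Sum>i<m. (\<Sum>u<n. A $$ (r, u) * B $$ (u, i)) * A $$ (i, j)) = (A * B * A) $$ (r, j)"
        unfolding mult_mat_entry[OF AB A that rj(2)] using mult_mat_entry[OF A B that] by (intro sum.cong) auto
      finally show ?thesis .
    qed
    have "v = A *\<^sub>v (unit_vec n j - col (B * A) j)"
    proof (rule eq_vecI)
      fix r assume "r < dim_vec (A *\<^sub>v (unit_vec n j - col (B * A) j))"
      then have r: "r < m" using A by simp
      have "(A * B * A) $$ (r, j) = (A * (B * A)) $$ (r, j)" using A B by simp
      also have "\<dots> = (\<Sum>u<n. A $$ (r, u) * (B * A) $$ (u, j))" by (rule mult_mat_entry[OF A BA r rj(2)])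
      finally have "v $ r = (\<Sum>u<n. A $$ (r, u) * ((if u = j then 1 else 0) - (B * A) $$ (u, j)))"
        using ve[OF r] rj by (simp add: right_diff_distrib sum_subtractf sum_delta_mult)
      also have "\<dots> = (A *\<^sub>v (unit_vec n j - col (B * A) j)) $ r"
        using r rj BA A B by (subst mult_mat_vec_entry[OF A]) (auto intro!: sum.cong simp: unit_vec_def)
      finally show "v $ r = (A *\<^sub>v (unit_vec n j - col (B * A) j)) $ r" .
    qed (use A in \<open>simp add: v_def\<close>)
    moreover have "unit_vec n j - col (B * A) j \<in> carrier_vec n" using A B rj by auto
    ultimately have "v \<in> mat_image A" unfolding mat_image_def dims by blast
    then have "v = 0\<^sub>v m" using \<open>v \<in> N\<close> int by blast
    then show "(A * B * A) $$ (r, j) = A $$ (r, j)" using ve[OF rj(1)] rj by simp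
  qed (use A B in auto)
  then show "\<exists>B\<in>carrier_mat n m. A * B * A = A" using B by blast
next
  have dims: "dim_row A = m" "dim_col A = n" using A by auto
  assume "\<exists>B\<in>carrier_mat n m. A * B * A = A"
  then obtain B where B: "B \<in> carrier_mat n m" and ABA: "A * B * A = A" by blast
  have ABAx: "A *\<^sub>v (B *\<^sub>v (A *\<^sub>v x)) = A *\<^sub>v x" if x: "x \<in> carrier_vec n" for x
  proof -
    have "A *\<^sub>v (B *\<^sub>v (A *\<^sub>v x)) = (A * B * A) *\<^sub>v x"
      using assoc_mult_mat_vec[of "A * B" m m A n x] assoc_mult_mat_vec[of A m n B m "A *\<^sub>v x"] A B x
      by simp
    then show ?thesis by (simp add: ABA)
  qed
  define N where "N = {v \<in> carrier_vec m. A *\<^sub>v (B *\<^sub>v v) = 0\<^sub>v m}"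
  have W: "submodule class_ring (mat_image A) (module_vec TYPE('a) m)"
    unfolding submodule_vec_iff mat_image_def dims
  proof (intro conjI ballI allI)
    show "{A *\<^sub>v x |x. x \<in> carrier_vec n} \<subseteq> carrier_vec m" using A by auto
    show "0\<^sub>v m \<in> {A *\<^sub>v x |x. x \<in> carrier_vec n}" using A by (auto intro!: exI[of _ "0\<^sub>v n"])
    show "v + w \<in> {A *\<^sub>v x |x. x \<in> carrier_vec n}"
      if "v \<in> {A *\<^sub>v x |x. x \<in> carrier_vec n}" "w \<in> {A *\<^sub>v x |x. x \<in> carrier_vec n}" for v w
    proof -
      from that obtain x y where xy: "v = A *\<^sub>v x" "w = A *\<^sub>v y" "x \<in> carrier_vec n" "y \<in> carrier_vec n" by blast
      then have "v + w = A *\<^sub>v (x + y)" using A by (simp add: mult_add_distrib_mat_vec[of A m n])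
      then show ?thesis using xy by (intro CollectI exI[of _ "x + y"]) auto
    qed
    show "c \<cdot>\<^sub>v v \<in> {A *\<^sub>v x |x. x \<in> carrier_vec n}" if "v \<in> {A *\<^sub>v x |x. x \<in> carrier_vec n}" for c v
    proof -
      from that obtain x where x: "v = A *\<^sub>v x" "x \<in> carrier_vec n" by blast
      then have "c \<cdot>\<^sub>v v = A *\<^sub>v (c \<cdot>\<^sub>v x)" using mult_mat_vec_smult[OF A] by simp
      then show ?thesis using x by (intro CollectI exI[of _ "c \<cdot>\<^sub>v x"]) auto
    qed
  qed
  have zero: "M *\<^sub>v 0\<^sub>v nc = 0\<^sub>v nr" if "M \<in> carrier_mat nr nc" for M :: "'a mat" and nr nc
    using that by (intro eq_vecI) auto
  have N: "submodule class_ring N (module_vec TYPE('a) m)"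
    unfolding submodule_vec_iff N_def using A B zero[OF A] zero[OF B]
    by (auto simp: mult_add_distrib_mat_vec[of _ n m] mult_add_distrib_mat_vec[of _ m n]
        mult_mat_vec_smult[of _ n m] mult_mat_vec_smult[of _ m n])
  have "{v + w |v w. v \<in> mat_image A \<and> w \<in> N} = carrier_vec m"
  proof (intro equalityI subsetI)
    fix v :: "'a vec" assume v: "v \<in> carrier_vec m"
    have Bv: "B *\<^sub>v v \<in> carrier_vec n" "A *\<^sub>v (B *\<^sub>v v) \<in> carrier_vec m" using A B v by auto
    have "v - A *\<^sub>v (B *\<^sub>v v) \<in> N"
      unfolding N_def using A B v Bv ABAx[OF Bv(1)]
      by (simp add: mult_minus_distrib_mat_vec[of _ n m] mult_minus_distrib_mat_vec[of _ m n])
    moreover have "v = A *\<^sub>v (B *\<^sub>v v) + (v - A *\<^sub>v (B *\<^sub>v v))" using v Bv A by (intro eq_vecI) auto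
    moreover have "A *\<^sub>v (B *\<^sub>v v) \<in> mat_image A" unfolding mat_image_def dims using Bv by blast
    ultimately show "v \<in> {v + w |v w. v \<in> mat_image A \<and> w \<in> N}" by blast
  next
    fix y assume "y \<in> {v + w |v w. v \<in> mat_image A \<and> w \<in> N}"
    then obtain v w where "y = v + w" "v \<in> mat_image A" "w \<in> N" by blast
    moreover have "mat_image A \<subseteq> carrier_vec m" "N \<subseteq> carrier_vec m"
      using W N by (simp_all add: submodule_vec_iff)
    ultimately show "y \<in> carrier_vec m" by (metis add_carrier_vec subsetD)
  qed
  moreover have "mat_image A \<inter> N = {0\<^sub>v m}"
  proof
    show "mat_image A \<inter> N \<subseteq> {0\<^sub>v m}" using ABAx by (auto simp: N_def mat_image_def dims)
    show "{0\<^sub>v m} \<subseteq> mat_image A \<inter> N" using W N by (simp add: submodule_vec_iff)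
  qed
  ultimately show "locally_simple A"
    unfolding locally_simple_def direct_summand_def dims using W N by blast
qed

lemma generalized_inverse_projections:
  fixes A :: "'a :: comm_ring_1 mat"
  assumes A: "A \<in> carrier_mat m n" and B: "generalized_inverse A B"
  shows "projection_onto m (A * B) (mat_image A)" "projection_onto n (1\<^sub>m n - B * A) (mat_kernel A)"
proof -
  have dims: "dim_row A = m" "dim_col A = n" using A by auto
  have Bc: "B \<in> carrier_mat n m" and ABA: "A * B * A = A" and BAB: "B * A * B = B"
    using B by (auto simp: generalized_inverse_def dims)
  have AB: "A * B \<in> carrier_mat m m" and BA: "B * A \<in> carrier_mat n n" using A Bc by auto
  have "A * B * (A * B) = A * B * A * B"
    using A Bc by (intro assoc_mult_mat[of "A * B" m m A n B m, symmetric]) auto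
  then have 1: "A * B * (A * B) = A * B" by (simp add: ABA)
  have ABAx: "(A * B) *\<^sub>v (A *\<^sub>v x) = A *\<^sub>v x" if "x \<in> carrier_vec n" for x
    using assoc_mult_mat_vec[OF AB A that] ABA by simp
  have "mat_image (A * B) = mat_image A"
    unfolding mat_image_def
  proof (intro equalityI subsetI)
    fix v assume "v \<in> {A * B *\<^sub>v x |x. x \<in> carrier_vec (dim_col (A * B))}"
    then obtain x where x: "x \<in> carrier_vec m" "v = (A * B) *\<^sub>v x" using Bc by auto
    then have "v = A *\<^sub>v (B *\<^sub>v x)" using assoc_mult_mat_vec[OF A Bc x(1)] by simp
    moreover have "B *\<^sub>v x \<in> carrier_vec n" using Bc x by auto
    ultimately show "v \<in> {A *\<^sub>v x |x. x \<in> carrier_vec (dim_col A)}" unfolding dims by blast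
  next
    fix v assume "v \<in> {A *\<^sub>v x |x. x \<in> carrier_vec (dim_col A)}"
    then obtain x where x: "x \<in> carrier_vec n" "v = A *\<^sub>v x" unfolding dims by auto
    then have "v = (A * B) *\<^sub>v v" "v \<in> carrier_vec m" using ABAx A by auto
    then show "v \<in> {A * B *\<^sub>v x |x. x \<in> carrier_vec (dim_col (A * B))}" using Bc by auto
  qed
  then show "projection_onto m (A * B) (mat_image A)" using AB 1 by (simp add: projection_onto_def)
  let ?K = "1\<^sub>m n - B * A"
  have K: "?K \<in> carrier_mat n n" using BA by (rule minus_carrier_mat)
  have Kx: "?K *\<^sub>v x = x - B *\<^sub>v (A *\<^sub>v x)" if x: "x \<in> carrier_vec n" for x
    using minus_mult_distrib_mat_vec[of "1\<^sub>m n" n n "B * A" x] BA x assoc_mult_mat_vec[OF Bc A x] by simp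
  have "B * A * (B * A) = B * A * B * A"
    using A Bc by (intro assoc_mult_mat[of "B * A" n n B m A n, symmetric]) auto
  then have BABA: "B * A * (B * A) = B * A" by (simp add: BAB)
  have "?K * ?K = ?K * 1\<^sub>m n - ?K * (B * A)" using K BA by (intro mult_minus_distrib_mat) auto
  also have "?K * (B * A) = 1\<^sub>m n * (B * A) - B * A * (B * A)" using BA by (intro minus_mult_distrib_mat) auto
  also have "\<dots> = 0\<^sub>m n n" unfolding BABA left_mult_one_mat[OF BA] using BA by (intro eq_matI) auto
  finally have "?K * ?K = ?K - 0\<^sub>m n n" unfolding right_mult_one_mat[OF K] .
  moreover have "X - 0\<^sub>m n n = X" if "X \<in> carrier_mat n n" for X :: "'a mat"
    using that by (intro eq_matI) auto
  ultimately have 2: "?K * ?K = ?K" using K by simp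
  have AK: "A *\<^sub>v (?K *\<^sub>v x) = 0\<^sub>v m" if x: "x \<in> carrier_vec n" for x
  proof -
    have Ax: "A *\<^sub>v x \<in> carrier_vec m" using A x by auto
    have "A *\<^sub>v (?K *\<^sub>v x) = A *\<^sub>v x - A *\<^sub>v (B *\<^sub>v (A *\<^sub>v x))"
      unfolding Kx[OF x] using A Bc x Ax by (intro mult_minus_distrib_mat_vec) auto
    also have "A *\<^sub>v (B *\<^sub>v (A *\<^sub>v x)) = A *\<^sub>v x"
      using ABAx[OF x] assoc_mult_mat_vec[OF A Bc Ax] by simp
    finally show ?thesis using Ax by simp
  qed
  have "mat_image ?K = mat_kernel A"
    unfolding mat_image_def mat_kernel_def dims
  proof (intro equalityI subsetI)
    fix v assume "v \<in> {?K *\<^sub>v x |x. x \<in> carrier_vec (dim_col ?K)}"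
    then obtain x where "x \<in> carrier_vec n" "v = ?K *\<^sub>v x" using A by auto
    then show "v \<in> {v. v \<in> carrier_vec n \<and> A *\<^sub>v v = 0\<^sub>v m}" using AK K by auto
  next
    fix v assume v: "v \<in> {v. v \<in> carrier_vec n \<and> A *\<^sub>v v = 0\<^sub>v m}"
    then have "?K *\<^sub>v v = v" using Kx[of v] Bc by auto
    then show "v \<in> {?K *\<^sub>v x |x. x \<in> carrier_vec (dim_col ?K)}"
      using v A by (auto intro!: exI[of _ v])
  qed
  then show "projection_onto n ?K (mat_kernel A)" using K 2 by (simp add: projection_onto_def)
qed

section \<open>Reasoning about programs\<close>

text \<open>The counts do not influence the control flow. Termination and correctness for arbitrary
  \<open>ops\<close> follow from a run whose tests cost nothing.\<close>

lemma exec_change_ops: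
  "exec member ops P \<sigma> a e \<sigma>' \<Longrightarrow> \<exists>e'. exec member ops' P \<sigma> a e' \<sigma>'"
  by (induction rule: exec.induct) (blast intro: exec.intros)+

text \<open>A total correctness triple with cost bounds for programs that restore the natural number
  variables. The second bound is real because it comes from \<open>K * n powr s\<close>.\<close>

definition run :: "('a :: comm_ring_1 \<Rightarrow> 'a list \<Rightarrow> 'a list option) \<Rightarrow> ('a \<Rightarrow> 'a list \<Rightarrow> nat) \<Rightarrow>
    nstore \<Rightarrow> com \<Rightarrow> 'a rstore \<Rightarrow> nat \<Rightarrow> real \<Rightarrow> ('a rstore \<Rightarrow> bool) \<Rightarrow> bool" where
  "run member ops \<nu> P \<rho> a e Q \<longleftrightarrow>
     (\<exists>a' e' \<rho>'. exec member ops P (\<nu>, \<rho>) a' e' (\<nu>, \<rho>') \<and> a' \<le> a \<and> real e' \<le> e \<and> Q \<rho>')"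

definition For :: "vname \<Rightarrow> nexp \<Rightarrow> com \<Rightarrow> com" where
  "For k h P = Seq (While (BLess (NVar k) h) (Seq P (NAssign k (NAdd (NVar k) (NConst 1))))) (NAssign k (NConst 0))"

text \<open>
  \<open>Tab X ix ha hb hc h1 h2 r\<close> sets \<open>X[ix]\<close>, for all \<open>i1 < ha\<close>, \<open>i2 < hb\<close>, \<open>i3 < hc\<close>, to the sum of
  \<open>r\<close> over all \<open>v1 < h1\<close>, \<open>v2 < h2\<close>. All loops reset their counters to 0, so that they leave the
  natural number variables unchanged.
\<close>

definition Cell :: "vname \<Rightarrow> nexp list \<Rightarrow> nexp \<Rightarrow> nexp \<Rightarrow> rexp \<Rightarrow> com" where
  "Cell X ix h1 h2 r = Seq (RAssign ''acc'' [] RZero)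
     (Seq (For ''v1'' h1 (For ''v2'' h2 (RAssign ''acc'' [] (RAdd (RCell ''acc'' []) r))))
       (RAssign X ix (RCell ''acc'' [])))"

definition Tab :: "vname \<Rightarrow> nexp list \<Rightarrow> nexp \<Rightarrow> nexp \<Rightarrow> nexp \<Rightarrow> nexp \<Rightarrow> nexp \<Rightarrow> rexp \<Rightarrow> com" where
  "Tab X ix ha hb hc h1 h2 r = For ''i1'' ha (For ''i2'' hb (For ''i3'' hc (Cell X ix h1 h2 r)))"

fun nvars :: "nexp \<Rightarrow> vname set" where
  "nvars (NConst k) = {}"
| "nvars (NVar x) = {x}"
| "nvars (NAdd a b) = nvars a \<union> nvars b"
| "nvars (NSub a b) = nvars a \<union> nvars b"
| "nvars (NMul a b) = nvars a \<union> nvars b"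
| "nvars (NDiv a b) = nvars a \<union> nvars b"
| "nvars (NMod a b) = nvars a \<union> nvars b"

fun arrays :: "rexp \<Rightarrow> vname set" where
  "arrays RZero = {}"
| "arrays ROne = {}"
| "arrays (RCell x is) = {x}"
| "arrays (RAdd a b) = arrays a \<union> arrays b"
| "arrays (RSub a b) = arrays a \<union> arrays b"
| "arrays (RMul a b) = arrays a \<union> arrays b"

lemma nval_cong: "(\<And>x. x \<in> nvars e \<Longrightarrow> \<nu> x = \<nu>' x) \<Longrightarrow> nval e \<nu> = nval e \<nu>'"
  by (induction e) auto

lemma rval_cong: "(\<And>x. x \<in> arrays r \<Longrightarrow> \<rho> x = \<rho>' x) \<Longrightarrow> rval r \<nu> \<rho> = rval r \<nu> \<rho>'"
  by (induction r) auto

context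
  fixes member :: "'a :: comm_ring_1 \<Rightarrow> 'a list \<Rightarrow> 'a list option" and ops :: "'a \<Rightarrow> 'a list \<Rightarrow> nat"
begin

lemma run_weaken:
  assumes "run member ops \<nu> P \<rho> a e Q" "a \<le> a'" "e \<le> e'" "\<And>\<rho>'. Q \<rho>' \<Longrightarrow> Q' \<rho>'"
  shows "run member ops \<nu> P \<rho> a' e' Q'"
  using assms unfolding run_def by (meson order_trans)

lemma run_Seq:
  assumes "run member ops \<nu> P \<rho> a1 e1 Q" "\<And>\<rho>'. Q \<rho>' \<Longrightarrow> run member ops \<nu> P' \<rho>' a2 e2 R"
  shows "run member ops \<nu> (Seq P P') \<rho> (a1 + a2) (e1 + e2) R"
proof -
  obtain a e \<rho>' where 1: "exec member ops P (\<nu>, \<rho>) a e (\<nu>, \<rho>')" "a \<le> a1" "real e \<le> e1" "Q \<rho>'"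
    using assms(1) unfolding run_def by blast
  obtain a' e' \<rho>'' where 2: "exec member ops P' (\<nu>, \<rho>') a' e' (\<nu>, \<rho>'')" "a' \<le> a2" "real e' \<le> e2" "R \<rho>''"
    using assms(2)[OF 1(4)] unfolding run_def by blast
  show ?thesis unfolding run_def
    using exec.Seq[OF 1(1) 2(1)] 1 2 by (intro exI[of _ "a + a'"] exI[of _ "e + e'"] exI[of _ \<rho>'']) auto
qed

lemma run_RAssign:
  "Q (store_cell x (map (\<lambda>i. nval i \<nu>) ix) (rval r \<nu> \<rho>) \<rho>) \<Longrightarrow> run member ops \<nu> (RAssign x ix r) \<rho> (arith_ops r) 0 Q"
  unfolding run_def using exec.RAssign[of member ops x ix r \<nu> \<rho>] by fastforce

text \<open>The invariant is indexed by the number of completed rounds. The body works in the store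
  with \<open>k := i\<close> and has to restore it, so that the increment yields
  \<open>i + 1\<close>.\<close>

lemma run_For:
  assumes k: "\<nu> k = 0" and h: "\<And>i. nval h (\<nu>(k := i)) = n" and I0: "I 0 \<rho>"
    and body: "\<And>i \<rho>. i < n \<Longrightarrow> I i \<rho> \<Longrightarrow> run member ops (\<nu>(k := i)) P \<rho> a e (I (Suc i))"
  shows "run member ops \<nu> (For k h P) \<rho> (n * a) (real n * e) (I n)"
proof -
  let ?W = "While (BLess (NVar k) h) (Seq P (NAssign k (NAdd (NVar k) (NConst 1))))"
  have "\<exists>a' e' \<rho>'. exec member ops ?W (\<nu>(k := i), \<rho>) a' e' (\<nu>(k := n), \<rho>') \<and> a' \<le> (n - i) * a
      \<and> real e' \<le> real (n - i) * e \<and> I n \<rho>'" if "i \<le> n" "I i \<rho>" for i \<rho>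
    using that
  proof (induction "n - i" arbitrary: i \<rho>)
    case 0
    then have "exec member ops ?W (\<nu>(k := i), \<rho>) 0 0 (\<nu>(k := n), \<rho>)"
      using exec.WhileFalse[of "BLess (NVar k) h" "(\<nu>(k := i), \<rho>)" member ops] h by simp
    moreover have "i = n" using 0 by simp
    moreover have "real (0 :: nat) \<le> real (n - i) * e" "I n \<rho>" using \<open>i = n\<close> 0 by simp_all
    ultimately show ?case by blast
  next
    case (Suc d)
    then have i: "i < n" by simp
    obtain a1 e1 \<rho>1 where 1: "exec member ops P (\<nu>(k := i), \<rho>) a1 e1 (\<nu>(k := i), \<rho>1)" "a1 \<le> a" "real e1 \<le> e" "I (Suc i) \<rho>1"
      using body[OF i Suc.prems(2)] unfolding run_def by blast
    obtain a2 e2 \<rho>2 where 2: "exec member ops ?W (\<nu>(k := Suc i), \<rho>1) a2 e2 (\<nu>(k := n), \<rho>2)"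
        "a2 \<le> (n - Suc i) * a" "real e2 \<le> real (n - Suc i) * e" "I n \<rho>2"
      using Suc.hyps(1)[OF _ _ 1(4)] Suc.hyps(2) i by (metis Suc_diff_Suc Suc_inject Suc_leI)
    have "exec member ops (NAssign k (NAdd (NVar k) (NConst 1))) (\<nu>(k := i), \<rho>1) 0 0 (\<nu>(k := Suc i), \<rho>1)"
      using exec.NAssign[of member ops k "NAdd (NVar k) (NConst 1)" "\<nu>(k := i)" \<rho>1] by simp
    from exec.Seq[OF 1(1) this] have "exec member ops (Seq P (NAssign k (NAdd (NVar k) (NConst 1)))) (\<nu>(k := i), \<rho>) a1 e1 (\<nu>(k := Suc i), \<rho>1)"
      by simp
    from exec.WhileTrue[OF _ this 2(1)] have "exec member ops ?W (\<nu>(k := i), \<rho>) (a1 + a2) (e1 + e2) (\<nu>(k := n), \<rho>2)"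
      using i h by simp
    moreover obtain m where m: "n - i = Suc m" "n - Suc i = m" using i by (metis Suc_diff_Suc)
    then have "a1 + a2 \<le> (n - i) * a" "real (e1 + e2) \<le> real (n - i) * e"
      using 1 2 unfolding m by (simp_all add: distrib_right)
    ultimately show ?case using 2 by blast
  qed
  from this[OF _ I0] obtain a' e' \<rho>' where 1: "exec member ops ?W (\<nu>(k := 0), \<rho>) a' e' (\<nu>(k := n), \<rho>')"
    "a' \<le> n * a" "real e' \<le> real n * e" "I n \<rho>'" by auto
  have "exec member ops (NAssign k (NConst 0)) (\<nu>(k := n), \<rho>') 0 0 (\<nu>, \<rho>')"
    using exec.NAssign[of member ops k "NConst 0" "\<nu>(k := n)" \<rho>'] k by (simp add: fun_upd_idem)
  from exec.Seq[OF _ this] 1 k show ?thesis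
    unfolding run_def For_def by (fastforce simp: fun_upd_idem)
qed

section \<open>Loops that fill tables of sums\<close>

definition same_off :: "vname set \<Rightarrow> 'a rstore \<Rightarrow> 'a rstore \<Rightarrow> bool" where
  "same_off V \<rho> \<rho>' \<longleftrightarrow> (\<forall>Y. Y \<notin> V \<longrightarrow> \<rho>' Y = \<rho> Y)"

lemma same_off_trans: "same_off V \<rho> \<rho>' \<Longrightarrow> same_off V \<rho>' \<rho>'' \<Longrightarrow> same_off V \<rho> \<rho>''"
  by (simp add: same_off_def)

text \<open>The value of \<open>r\<close> is demanded in all stores that differ at most in the
  target and the accumulator, since the accumulator changes during the summation.\<close>

lemma run_Cell:
  assumes \<nu>: "\<nu> ''v1'' = 0" "\<nu> ''v2'' = 0" and X: "X \<noteq> ''acc''"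
    and h1: "\<And>u w. nval h1 (\<nu>(''v1'' := u, ''v2'' := w)) = n1"
    and h2: "\<And>u w. nval h2 (\<nu>(''v1'' := u, ''v2'' := w)) = n2"
    and r: "\<And>u w \<rho>'. u < n1 \<Longrightarrow> w < n2 \<Longrightarrow> same_off {X, ''acc''} \<rho> \<rho>' \<Longrightarrow> rval r (\<nu>(''v1'' := u, ''v2'' := w)) \<rho>' = f u w"
    and Q: "\<And>\<rho>'. same_off {X, ''acc''} \<rho> \<rho>' \<Longrightarrow>
      \<rho>' X = (\<rho> X)(map (\<lambda>i. nval i \<nu>) ix := (\<Sum>u<n1. \<Sum>w<n2. f u w)) \<Longrightarrow> Q \<rho>'"
  shows "run member ops \<nu> (Cell X ix h1 h2 r) \<rho> (n1 * n2 * Suc (arith_ops r)) 0 Q"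
proof -
  let ?up = "\<lambda>s. \<rho>(''acc'' := (\<rho> ''acc'')([] := s))"
  have 1: "run member ops \<nu> (RAssign ''acc'' [] RZero) \<rho> 0 0 (\<lambda>\<rho>'. \<rho>' = ?up 0)"
    using run_RAssign[of _ "''acc''" \<nu> "[]" RZero \<rho>] by (simp add: store_cell_def)
  have 2: "run member ops \<nu> (For ''v1'' h1 (For ''v2'' h2 (RAssign ''acc'' [] (RAdd (RCell ''acc'' []) r)))) (?up 0)
      (n1 * (n2 * Suc (arith_ops r))) (real n1 * (real n2 * 0)) (\<lambda>\<rho>'. \<rho>' = ?up (\<Sum>u<n1. \<Sum>w<n2. f u w))"
  proof (rule run_For[where I = "\<lambda>i \<rho>'. \<rho>' = ?up (\<Sum>u<i. \<Sum>w<n2. f u w)"])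
    fix i \<rho>1 assume i: "i < n1" and \<rho>1: "\<rho>1 = ?up (\<Sum>u<i. \<Sum>w<n2. f u w)"
    show "run member ops (\<nu>(''v1'' := i)) (For ''v2'' h2 (RAssign ''acc'' [] (RAdd (RCell ''acc'' []) r))) \<rho>1
        (n2 * Suc (arith_ops r)) (real n2 * 0) (\<lambda>\<rho>'. \<rho>' = ?up (\<Sum>u<Suc i. \<Sum>w<n2. f u w))"
    proof (rule run_weaken, rule run_For[where I = "\<lambda>j \<rho>'. \<rho>' = ?up ((\<Sum>u<i. \<Sum>w<n2. f u w) + (\<Sum>w<j. f i w))"])
      fix j \<rho>2 assume j: "j < n2" and \<rho>2: "\<rho>2 = ?up ((\<Sum>u<i. \<Sum>w<n2. f u w) + (\<Sum>w<j. f i w))"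
      have "rval r (\<nu>(''v1'' := i, ''v2'' := j)) \<rho>2 = f i j"
        using i j by (intro r) (auto simp: \<rho>2 same_off_def)
      then show "run member ops (\<nu>(''v1'' := i, ''v2'' := j)) (RAssign ''acc'' [] (RAdd (RCell ''acc'' []) r)) \<rho>2
        (Suc (arith_ops r)) 0 (\<lambda>\<rho>'. \<rho>' = ?up ((\<Sum>u<i. \<Sum>w<n2. f u w) + (\<Sum>w<Suc j. f i w)))"
        using run_RAssign[of _ "''acc''" "\<nu>(''v1'' := i, ''v2'' := j)" "[]" "RAdd (RCell ''acc'' []) r" \<rho>2]
        by (simp add: store_cell_def \<rho>2 add.assoc)
    qed (use \<nu> h2 \<rho>1 in auto)
  next
    show "nval h1 (\<nu>(''v1'' := i)) = n1" for i
    proof -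
      have "\<nu>(''v1'' := i) = \<nu>(''v1'' := i, ''v2'' := 0)" using \<nu> by (auto simp: fun_eq_iff)
      then show ?thesis using h1[of i 0] by simp
    qed
  qed (use \<nu> in auto)
  have 3: "run member ops \<nu> (RAssign X ix (RCell ''acc'' [])) (?up (\<Sum>u<n1. \<Sum>w<n2. f u w)) 0 0 Q"
    using run_RAssign[of Q X \<nu> ix "RCell ''acc'' []" "?up (\<Sum>u<n1. \<Sum>w<n2. f u w)"]
      Q[of "store_cell X (map (\<lambda>i. nval i \<nu>) ix) (\<Sum>u<n1. \<Sum>w<n2. f u w) (?up (\<Sum>u<n1. \<Sum>w<n2. f u w))"] X
    by (simp add: same_off_def store_cell_def)
  show ?thesis
    unfolding Cell_def
  proof (rule run_weaken)
    show "run member ops \<nu> (Seq (RAssign ''acc'' [] RZero)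
        (Seq (For ''v1'' h1 (For ''v2'' h2 (RAssign ''acc'' [] (RAdd (RCell ''acc'' []) r)))) (RAssign X ix (RCell ''acc'' [])))) \<rho>
      (0 + (n1 * (n2 * Suc (arith_ops r)) + 0)) (0 + (real n1 * (real n2 * 0) + 0)) Q"
      by (rule run_Seq[OF 1], simp only:, rule run_Seq[OF 2], simp only:, rule 3)
  qed (auto simp: algebra_simps)
qed

definition tab_post :: "vname \<Rightarrow> (nat \<times> nat \<times> nat) set \<Rightarrow> (nat \<times> nat \<times> nat \<Rightarrow> nat list) \<Rightarrow> (nat \<times> nat \<times> nat \<Rightarrow> 'a) \<Rightarrow>
    'a rstore \<Rightarrow> 'a rstore \<Rightarrow> bool" where
  "tab_post X D g F \<rho> \<rho>' \<longleftrightarrow> same_off {X, ''acc''} \<rho> \<rho>' \<and> (\<forall>t\<in>D. \<rho>' X (g t) = F t) \<and> (\<forall>is. is \<notin> g ` D \<longrightarrow> \<rho>' X is = \<rho> X is)"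

lemma run_Tab:
  assumes \<nu>: "\<nu> ''i1'' = 0" "\<nu> ''i2'' = 0" "\<nu> ''i3'' = 0" "\<nu> ''v1'' = 0" "\<nu> ''v2'' = 0" and X: "X \<noteq> ''acc''"
    and ha: "\<And>i j k. nval ha (\<nu>(''i1'' := i, ''i2'' := j, ''i3'' := k)) = na"
    and hb: "\<And>i j k. nval hb (\<nu>(''i1'' := i, ''i2'' := j, ''i3'' := k)) = nb"
    and hc: "\<And>i j k. nval hc (\<nu>(''i1'' := i, ''i2'' := j, ''i3'' := k)) = nc"
    and h1: "\<And>i j k u w. nval h1 (\<nu>(''i1'' := i, ''i2'' := j, ''i3'' := k, ''v1'' := u, ''v2'' := w)) = n1 i j k"
    and h2: "\<And>i j k u w. nval h2 (\<nu>(''i1'' := i, ''i2'' := j, ''i3'' := k, ''v1'' := u, ''v2'' := w)) = n2 i j k"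
    and ix: "\<And>i j k. map (\<lambda>e. nval e (\<nu>(''i1'' := i, ''i2'' := j, ''i3'' := k))) ix = g (i, j, k)"
    and inj: "inj_on g ({..<na} \<times> {..<nb} \<times> {..<nc})"
    and hm: "\<And>i j k. i < na \<Longrightarrow> j < nb \<Longrightarrow> k < nc \<Longrightarrow> n1 i j k * n2 i j k \<le> hm"
    and r: "\<And>i j k u w \<rho>'. i < na \<Longrightarrow> j < nb \<Longrightarrow> k < nc \<Longrightarrow> u < n1 i j k \<Longrightarrow> w < n2 i j k \<Longrightarrow> same_off {X, ''acc''} \<rho> \<rho>' \<Longrightarrow>
        rval r (\<nu>(''i1'' := i, ''i2'' := j, ''i3'' := k, ''v1'' := u, ''v2'' := w)) \<rho>' = f i j k u w"
  shows "run member ops \<nu> (Tab X ix ha hb hc h1 h2 r) \<rho> (na * (nb * (nc * (hm * Suc (arith_ops r))))) 0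
    (tab_post X ({..<na} \<times> {..<nb} \<times> {..<nc}) g (\<lambda>(i, j, k). \<Sum>u<n1 i j k. \<Sum>w<n2 i j k. f i j k u w) \<rho>)"
proof -
  let ?F = "\<lambda>(i, j, k). \<Sum>u<n1 i j k. \<Sum>w<n2 i j k. f i j k u w"
  let ?a = "hm * Suc (arith_ops r)"
  \<comment> \<open>The indices that precede \<open>(i, j, k)\<close> in the lexicographic order of
    the loops.\<close>
  let ?D = "\<lambda>i j k. {..<i} \<times> {..<nb} \<times> {..<nc} \<union> {i} \<times> {..<j} \<times> {..<nc} \<union> {i} \<times> {j} \<times> {..<k}"
  let ?I = "\<lambda>D. tab_post X D g ?F \<rho>"
  have "\<nu>(''i1'' := i) = \<nu>(''i1'' := i, ''i2'' := 0, ''i3'' := 0)"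
      "\<nu>(''i1'' := i, ''i2'' := j) = \<nu>(''i1'' := i, ''i2'' := j, ''i3'' := 0)" for i j
    using \<nu> by (auto simp: fun_eq_iff)
  then have ha': "nval ha (\<nu>(''i1'' := i)) = na" and hb': "nval hb (\<nu>(''i1'' := i, ''i2'' := j)) = nb" for i j
    using ha[of i 0 0] hb[of i j 0] by metis+
  have cell: "run member ops (\<nu>(''i1'' := i, ''i2'' := j, ''i3'' := k)) (Cell X ix h1 h2 r) \<rho>1 ?a 0 (?I (?D i j (Suc k)))"
    if ijk: "i < na" "j < nb" "k < nc" and I: "?I (?D i j k) \<rho>1" for i j k \<rho>1
  proof (rule run_weaken)
    have so: "same_off {X, ''acc''} \<rho> \<rho>1" using I by (simp add: tab_post_def)
    show "run member ops (\<nu>(''i1'' := i, ''i2'' := j, ''i3'' := k)) (Cell X ix h1 h2 r) \<rho>1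
      (n1 i j k * n2 i j k * Suc (arith_ops r)) 0 (?I (?D i j (Suc k)))"
    proof (rule run_Cell[where f = "f i j k"])
      show "rval r (\<nu>(''i1'' := i, ''i2'' := j, ''i3'' := k, ''v1'' := u, ''v2'' := w)) \<rho>' = f i j k u w"
        if "u < n1 i j k" "w < n2 i j k" "same_off {X, ''acc''} \<rho>1 \<rho>'" for u w \<rho>'
        using r[OF ijk that(1,2)] same_off_trans[OF so that(3)] by simp
      fix \<rho>' assume so': "same_off {X, ''acc''} \<rho>1 \<rho>'"
        and X': "\<rho>' X = (\<rho>1 X)(map (\<lambda>e. nval e (\<nu>(''i1'' := i, ''i2'' := j, ''i3'' := k))) ix := \<Sum>u<n1 i j k. \<Sum>w<n2 i j k. f i j k u w)"
      have D: "?D i j (Suc k) = insert (i, j, k) (?D i j k)" by auto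
      have sub: "?D i j k \<subseteq> {..<na} \<times> {..<nb} \<times> {..<nc}" using ijk by auto
      have "(i, j, k) \<notin> ?D i j k" by auto
      then have ne: "g t \<noteq> g (i, j, k)" if "t \<in> ?D i j k" for t
        using inj_onD[OF inj, of t "(i, j, k)"] that sub ijk by blast
      show "?I (?D i j (Suc k)) \<rho>'"
        unfolding tab_post_def D
      proof (intro conjI ballI allI impI)
        show "same_off {X, ''acc''} \<rho> \<rho>'" using same_off_trans[OF so so'] .
        show "\<rho>' X (g t) = ?F t" if "t \<in> insert (i, j, k) (?D i j k)" for t
          using that I ne[of t] unfolding X' ix tab_post_def by auto
        show "\<rho>' X is = \<rho> X is" if "is \<notin> g ` insert (i, j, k) (?D i j k)" for "is"
          using that I unfolding X' ix tab_post_def by auto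
      qed
    qed (use \<nu> X h1 h2 in auto)
    show "n1 i j k * n2 i j k * Suc (arith_ops r) \<le> ?a" by (rule mult_le_mono1[OF hm[OF ijk]])
  qed auto
  have "run member ops \<nu> (Tab X ix ha hb hc h1 h2 r) \<rho> (na * (nb * (nc * ?a))) (real na * (real nb * (real nc * 0))) (?I (?D na 0 0))"
    unfolding Tab_def
  proof (rule run_For[where I = "\<lambda>i. ?I (?D i 0 0)"])
    fix i \<rho>1 assume i: "i < na" and I1: "?I (?D i 0 0) \<rho>1"
    show "run member ops (\<nu>(''i1'' := i)) (For ''i2'' hb (For ''i3'' hc (Cell X ix h1 h2 r))) \<rho>1
        (nb * (nc * ?a)) (real nb * (real nc * 0)) (?I (?D (Suc i) 0 0))"
    proof (rule run_weaken, rule run_For[where I = "\<lambda>j. ?I (?D i j 0)"])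
      fix j \<rho>2 assume j: "j < nb" and I2: "?I (?D i j 0) \<rho>2"
      show "run member ops (\<nu>(''i1'' := i, ''i2'' := j)) (For ''i3'' hc (Cell X ix h1 h2 r)) \<rho>2
        (nc * ?a) (real nc * 0) (?I (?D i (Suc j) 0))"
      proof (rule run_weaken, rule run_For[where I = "\<lambda>k. ?I (?D i j k)"])
        show "?I (?D i (Suc j) 0) \<rho>'" if "?I (?D i j nc) \<rho>'" for \<rho>'
        proof -
          have "?D i (Suc j) 0 = ?D i j nc" by auto
          then show ?thesis using that by simp
        qed
        show "run member ops (\<nu>(''i1'' := i, ''i2'' := j, ''i3'' := k)) (Cell X ix h1 h2 r) \<rho>3 ?a 0 (?I (?D i j (Suc k)))"
          if "k < nc" "?I (?D i j k) \<rho>3" for k \<rho>3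
          using that by (rule cell[OF i j])
        show "nval hc (\<nu>(''i1'' := i, ''i2'' := j, ''i3'' := k)) = nc" for k by (rule hc)
        show "(\<nu>(''i1'' := i, ''i2'' := j)) ''i3'' = 0" using \<nu> by simp
      qed (use I2 in simp_all)
    next
      show "?I (?D (Suc i) 0 0) \<rho>'" if "?I (?D i nb 0) \<rho>'" for \<rho>'
      proof -
        have "?D (Suc i) 0 0 = ?D i nb 0" by auto
        then show ?thesis using that by simp
      qed
      show "(\<nu>(''i1'' := i)) ''i2'' = 0" using \<nu> by simp
      show "?I (?D i 0 0) \<rho>1" by (rule I1)
      show "nval hb (\<nu>(''i1'' := i, ''i2'' := j)) = nb" for j by (rule hb')
    qed simp_all
  qed (use \<nu> ha' in \<open>simp_all add: tab_post_def same_off_def\<close>)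
  then show ?thesis by (simp add: lessThan_0)
qed

lemma run_TabQ:
  assumes "\<nu> ''i1'' = 0" "\<nu> ''i2'' = 0" "\<nu> ''i3'' = 0" "\<nu> ''v1'' = 0" "\<nu> ''v2'' = 0" "X \<noteq> ''acc''"
    and "\<And>i j k. nval ha (\<nu>(''i1'' := i, ''i2'' := j, ''i3'' := k)) = na"
    and "\<And>i j k. nval hb (\<nu>(''i1'' := i, ''i2'' := j, ''i3'' := k)) = nb"
    and "\<And>i j k. nval hc (\<nu>(''i1'' := i, ''i2'' := j, ''i3'' := k)) = nc"
    and "\<And>i j k u w. nval h1 (\<nu>(''i1'' := i, ''i2'' := j, ''i3'' := k, ''v1'' := u, ''v2'' := w)) = mu i j k"
    and "\<And>i j k u w. nval h2 (\<nu>(''i1'' := i, ''i2'' := j, ''i3'' := k, ''v1'' := u, ''v2'' := w)) = mw i j k"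
    and "\<And>i j k. map (\<lambda>e. nval e (\<nu>(''i1'' := i, ''i2'' := j, ''i3'' := k))) ix = g i j k"
    and "\<And>i j k i' j' k'. i < na \<Longrightarrow> j < nb \<Longrightarrow> k < nc \<Longrightarrow> i' < na \<Longrightarrow> j' < nb \<Longrightarrow> k' < nc \<Longrightarrow> g i j k = g i' j' k' \<Longrightarrow>
      i = i' \<and> j = j' \<and> k = k'"
    and "\<And>i j k. i < na \<Longrightarrow> j < nb \<Longrightarrow> k < nc \<Longrightarrow> mu i j k * mw i j k \<le> hm"
    and "\<And>i j k u w \<rho>'. i < na \<Longrightarrow> j < nb \<Longrightarrow> k < nc \<Longrightarrow> u < mu i j k \<Longrightarrow> w < mw i j k \<Longrightarrow> same_off {X, ''acc''} \<rho> \<rho>' \<Longrightarrow>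
        rval r (\<nu>(''i1'' := i, ''i2'' := j, ''i3'' := k, ''v1'' := u, ''v2'' := w)) \<rho>' = f i j k u w"
    and a: "na * (nb * (nc * (hm * Suc (arith_ops r)))) \<le> a"
    and Q: "\<And>\<rho>'. same_off {X, ''acc''} \<rho> \<rho>' \<Longrightarrow>
      (\<And>i j k. i < na \<Longrightarrow> j < nb \<Longrightarrow> k < nc \<Longrightarrow> \<rho>' X (g i j k) = (\<Sum>u<mu i j k. \<Sum>w<mw i j k. f i j k u w)) \<Longrightarrow>
      (\<And>is. (\<And>i j k. i < na \<Longrightarrow> j < nb \<Longrightarrow> k < nc \<Longrightarrow> is \<noteq> g i j k) \<Longrightarrow> \<rho>' X is = \<rho> X is) \<Longrightarrow> Q \<rho>'"
  shows "run member ops \<nu> (Tab X ix ha hb hc h1 h2 r) \<rho> a 0 Q"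
proof (rule run_weaken[OF run_Tab[where g = "\<lambda>(i, j, k). g i j k" and f = f]])
  fix \<rho>' assume post: "tab_post X ({..<na} \<times> {..<nb} \<times> {..<nc}) (\<lambda>(i, j, k). g i j k) (\<lambda>(i, j, k). \<Sum>u<mu i j k. \<Sum>w<mw i j k. f i j k u w) \<rho> \<rho>'"
  show "Q \<rho>'"
  proof (rule Q)
    show "\<rho>' X is = \<rho> X is" if "\<And>i j k. i < na \<Longrightarrow> j < nb \<Longrightarrow> k < nc \<Longrightarrow> is \<noteq> g i j k" for "is"
    proof -
      have "is \<notin> (\<lambda>(i, j, k). g i j k) ` ({..<na} \<times> {..<nb} \<times> {..<nc})" using that by auto
      then show ?thesis using post unfolding tab_post_def by blast
    qed
  qed (use post in \<open>auto simp: tab_post_def\<close>)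
next
  show "inj_on (\<lambda>(i, j, k). g i j k) ({..<na} \<times> {..<nb} \<times> {..<nc})"
  proof (rule inj_onI, goal_cases)
    case (1 s t)
    obtain i j k where s: "s = (i, j, k)" by (cases s)
    obtain i' j' k' where t: "t = (i', j', k')" by (cases t)
    show ?case using 1 assms(13)[of i j k i' j' k'] unfolding s t by simp
  qed
  show "map (\<lambda>e. nval e (\<nu>(''i1'' := i, ''i2'' := j, ''i3'' := k))) ix = (case (i, j, k) of (i, j, k) \<Rightarrow> g i j k)" for i j k
    using assms(12) by simp
qed (fact assms | simp)+

text \<open>Semantic premises are traded for conditions on occurring names, which simplification
  decides for a concrete program. As \<open>r\<close> reads neither the target nor the accumulator,
  all cells may be computed from the initial store.\<close>

lemma run_TabS:
  assumes \<nu>: "\<nu> ''i1'' = 0 \<and> \<nu> ''i2'' = 0 \<and> \<nu> ''i3'' = 0 \<and> \<nu> ''v1'' = 0 \<and> \<nu> ''v2'' = 0"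
    and check: "X \<noteq> ''acc''" "X \<notin> arrays r" "''acc'' \<notin> arrays r"
      "(nvars ha \<union> nvars hb \<union> nvars hc) \<inter> {''i1'', ''i2'', ''i3''} = {}" "(nvars h1 \<union> nvars h2) \<inter> {''v1'', ''v2''} = {}"
    and inj: "\<And>i j k i' j' k'. i < nval ha \<nu> \<Longrightarrow> j < nval hb \<nu> \<Longrightarrow> k < nval hc \<nu> \<Longrightarrow>
      i' < nval ha \<nu> \<Longrightarrow> j' < nval hb \<nu> \<Longrightarrow> k' < nval hc \<nu> \<Longrightarrow>
      map (\<lambda>e. nval e (\<nu>(''i1'' := i, ''i2'' := j, ''i3'' := k))) ix = map (\<lambda>e. nval e (\<nu>(''i1'' := i', ''i2'' := j', ''i3'' := k'))) ix \<Longrightarrow>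
      i = i' \<and> j = j' \<and> k = k'"
    and hm: "\<And>i j k. i < nval ha \<nu> \<Longrightarrow> j < nval hb \<nu> \<Longrightarrow> k < nval hc \<nu> \<Longrightarrow>
      nval h1 (\<nu>(''i1'' := i, ''i2'' := j, ''i3'' := k)) * nval h2 (\<nu>(''i1'' := i, ''i2'' := j, ''i3'' := k)) \<le> hm"
    and a: "nval ha \<nu> * (nval hb \<nu> * (nval hc \<nu> * (hm * Suc (arith_ops r)))) \<le> a"
    and Q: "\<And>\<rho>'. same_off {X, ''acc''} \<rho> \<rho>' \<Longrightarrow>
      (\<And>i j k. i < nval ha \<nu> \<Longrightarrow> j < nval hb \<nu> \<Longrightarrow> k < nval hc \<nu> \<Longrightarrow>
        \<rho>' X (map (\<lambda>e. nval e (\<nu>(''i1'' := i, ''i2'' := j, ''i3'' := k))) ix) =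
          (\<Sum>u<nval h1 (\<nu>(''i1'' := i, ''i2'' := j, ''i3'' := k)). \<Sum>w<nval h2 (\<nu>(''i1'' := i, ''i2'' := j, ''i3'' := k)).
            rval r (\<nu>(''i1'' := i, ''i2'' := j, ''i3'' := k, ''v1'' := u, ''v2'' := w)) \<rho>)) \<Longrightarrow>
      (\<And>is. (\<And>i j k. i < nval ha \<nu> \<Longrightarrow> j < nval hb \<nu> \<Longrightarrow> k < nval hc \<nu> \<Longrightarrow>
         is \<noteq> map (\<lambda>e. nval e (\<nu>(''i1'' := i, ''i2'' := j, ''i3'' := k))) ix) \<Longrightarrow> \<rho>' X is = \<rho> X is) \<Longrightarrow> Q \<rho>'"
  shows "run member ops \<nu> (Tab X ix ha hb hc h1 h2 r) \<rho> a 0 Q"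
proof (rule run_TabQ[where g = "\<lambda>i j k. map (\<lambda>e. nval e (\<nu>(''i1'' := i, ''i2'' := j, ''i3'' := k))) ix" and
      f = "\<lambda>i j k u w. rval r (\<nu>(''i1'' := i, ''i2'' := j, ''i3'' := k, ''v1'' := u, ''v2'' := w)) \<rho>"])
  show "nval ha (\<nu>(''i1'' := i, ''i2'' := j, ''i3'' := k)) = nval ha \<nu>"
       "nval hb (\<nu>(''i1'' := i, ''i2'' := j, ''i3'' := k)) = nval hb \<nu>"
       "nval hc (\<nu>(''i1'' := i, ''i2'' := j, ''i3'' := k)) = nval hc \<nu>" for i j k
    using check(4) by (auto intro!: nval_cong)
  show "nval h1 (\<nu>(''i1'' := i, ''i2'' := j, ''i3'' := k, ''v1'' := u, ''v2'' := w)) = nval h1 (\<nu>(''i1'' := i, ''i2'' := j, ''i3'' := k))"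
       "nval h2 (\<nu>(''i1'' := i, ''i2'' := j, ''i3'' := k, ''v1'' := u, ''v2'' := w)) = nval h2 (\<nu>(''i1'' := i, ''i2'' := j, ''i3'' := k))" for i j k u w
    using check(5) by (auto intro!: nval_cong)
  show "rval r \<nu>' \<rho>' = rval r \<nu>' \<rho>" if "same_off {X, ''acc''} \<rho> \<rho>'" for \<nu>' \<rho>'
    using that check(2,3) by (intro rval_cong) (auto simp: same_off_def)
qed ((use \<nu> in simp; fail)?, (fact check hm a inj Q refl | (use \<nu> in simp; fail))+)

text \<open>The answer bit is reset, so both answers lead to the same continuation; after a negative
  answer the array \<open>c\<close> keeps its old contents.\<close>

lemma run_Member:
  assumes w: "real (ops (rval r \<nu> \<rho>) (gens \<rho> g n)) \<le> e" and b: "\<nu> b = 0" and k: "nval k \<nu> = n"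
    and yes: "\<And>cs. member (rval r \<nu> \<rho>) (gens \<rho> g n) = Some cs \<Longrightarrow> Q (store_list c cs \<rho>)"
    and no: "member (rval r \<nu> \<rho>) (gens \<rho> g n) = None \<Longrightarrow> Q \<rho>"
  shows "run member ops \<nu> (Seq (Member b r g k c) (NAssign b (NConst 0))) \<rho> (arith_ops r) e Q"
proof -
  have reset: "exec member ops (NAssign b (NConst 0)) (\<nu>(b := i), \<rho>') 0 0 (\<nu>, \<rho>')" for i \<rho>'
    using exec.NAssign[of member ops b "NConst 0" "\<nu>(b := i)" \<rho>'] b by (simp add: fun_upd_idem)
  show ?thesis
  proof (cases "member (rval r \<nu> \<rho>) (gens \<rho> g n)")
    case None
    then have "exec member ops (Member b r g k c) (\<nu>, \<rho>) (arith_ops r) (ops (rval r \<nu> \<rho>) (gens \<rho> g n)) (\<nu>(b := 0), \<rho>)"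
      using exec.MemberNo[OF refl refl, of member r \<nu> \<rho> g k ops b c] k by simp
    from exec.Seq[OF this reset] show ?thesis unfolding run_def using w no[OF None] by fastforce
  next
    case (Some cs)
    then have "exec member ops (Member b r g k c) (\<nu>, \<rho>) (arith_ops r) (ops (rval r \<nu> \<rho>) (gens \<rho> g n)) (\<nu>(b := 1), store_list c cs \<rho>)"
      using exec.MemberYes[OF refl refl, of member r \<nu> \<rho> g k cs ops b c] k by simp
    from exec.Seq[OF this reset] show ?thesis unfolding run_def using w yes[OF Some] by fastforce
  qed
qed

end

section \<open>The program\<close>

abbreviation "I1 \<equiv> NVar ''i1''"
abbreviation "I2 \<equiv> NVar ''i2''"
abbreviation "I3 \<equiv> NVar ''i3''"
abbreviation "V1 \<equiv> NVar ''v1''"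
abbreviation "V2 \<equiv> NVar ''v2''"
abbreviation "PP \<equiv> NVar ''p''"
abbreviation "QQ \<equiv> NVar ''q''"
abbreviation "TT \<equiv> NVar ''T''"
abbreviation "KK \<equiv> NVar ''k''"
abbreviation "N0 \<equiv> NConst 0"
abbreviation "N1 \<equiv> NConst 1"
abbreviation "succ_exp n \<equiv> NAdd n N1"
abbreviation "dist_exp a b \<equiv> NAdd (NSub a b) (NSub b a)"

text \<open>
  The last index of the arrays \<open>S\<close>, \<open>G\<close>, \<open>D\<close>, \<open>F\<close> and \<open>one\<close> is a guard: only cells with guard 0 are ever
  written, so a nonzero guard reads 0. This replaces case distinctions inside ring expressions.
\<close>

definition gram_prog :: com where
  "gram_prog = Tab ''M'' [I1, I2, I3] PP PP TT QQ N1
     (RMul (RCell ''S'' [I1, V1, N0]) (RCell ''S'' [I2, V1, dist_exp I3 (NMul (NConst 2) (NAdd V1 I2))]))"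

text \<open>
  Division-free: the characteristic polynomial of the leading principal submatrix of size \<open>k + 1\<close> is
  found together with the last column of the adjugate, whose corner entry is the polynomial of size \<open>k\<close>.
\<close>

definition char_step_prog :: com where
  "char_step_prog =
     Seq (Tab ''W'' [I1, I2] (succ_exp KK) TT N1 (succ_exp KK) (succ_exp I2)
           (RMul (RCell ''M'' [I1, V1, V2]) (RCell ''U'' [V1, NSub I2 V2])))
    (Seq (Tab ''U'' [I1, I2] KK TT N1 N1 N1 (RCell ''W'' [I1, I2]))
    (Seq (Tab ''U'' [KK, I2] N1 TT N1 N1 N1 (RCell ''G'' [succ_exp (NVar ''r''), I2, N0]))
    (Seq (Tab ''H'' [I2] N1 TT N1 N1 N1 (RSub (RCell ''G'' [succ_exp (NVar ''r''), I2, N0]) (RCell ''W'' [KK, I2])))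
         (Tab ''G'' [succ_exp (NVar ''r''), I2, N0] N1 TT N1 N1 N1 (RCell ''H'' [I2])))))"

text \<open>\<open>U\<close> starts as the last column of the identity, the top coefficient of the
  adjugate. The upper bound of its first summation loop is 1 for degree 0 and \<open>i = k\<close>,
  and 0 otherwise, so summing \<open>ROne\<close> produces this column.\<close>

definition char_prog :: com where
  "char_prog = Seq (RAssign ''G'' [N0, N0, N0] ROne)
     (For ''k'' PP (Seq
       (Tab ''U'' [I1, I2] (succ_exp KK) TT N1 (NMul (NSub N1 I2) (NSub N1 (NSub KK I1))) N1 ROne)
       (For ''r'' (succ_exp KK) char_step_prog)))"

text \<open>The recursion \<open>adj_coeff_rec\<close>: round \<open>k\<close> obtains coefficient
  \<open>p - 1 - k\<close> from coefficient \<open>p - k\<close>. It starts at coefficient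
  \<open>p\<close>, which is 0 like the fresh array \<open>D\<close>. The guard of \<open>G\<close>
  restricts the scalar term to the diagonal.\<close>

definition adj_prog :: com where
  "adj_prog = For ''k'' PP (Seq
     (Tab ''E'' [I1, I2, I3] PP PP TT PP (succ_exp I3)
       (RMul (RCell ''M'' [I1, V1, V2]) (RCell ''D'' [NSub PP KK, V1, I2, NSub I3 V2, N0])))
     (Tab ''D'' [NSub (NSub PP N1) KK, I1, I2, I3, N0] PP PP TT N1 N1
       (RAdd (RCell ''E'' [I1, I2, I3]) (RCell ''G'' [KK, I3, dist_exp I1 I2]))))"

text \<open>The guard \<open>c * k - l\<close> is nonzero exactly for the weights below that of
  \<open>Y^k\<close>, where \<open>gram_coeff\<close> is 0 by definition.\<close>

definition coeff_prog :: com where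
  "coeff_prog = Seq
     (Tab ''C'' [I1, I2] (succ_exp PP) TT N1 N1 N1
       (RCell ''G'' [NSub PP I1, NSub I2 (NMul (NVar ''c'') I1), NSub (NMul (NVar ''c'') I1) I2]))
     (Tab ''F'' [I1, I2, N0] (succ_exp PP) TT N1 (succ_exp I1) N1 (RCell ''C'' [V1, I2]))"

text \<open>The update multiplies \<open>1 - f\<close> by 1 minus the response, and
  \<open>xi\<close> records how \<open>f\<close> is combined from prefix sums. \<open>xi\<close> is
  updated before \<open>f\<close> because it needs the old \<open>f\<close>; both pass through
  \<open>t\<close>, since a table must not read its own target.\<close>

definition test_step_prog :: com where
  "test_step_prog =
     Seq (Tab ''g'' [I1] TT N1 N1 (succ_exp PP) N1
           (RMul (RCell ''C'' [V1, NVar ''l'']) (RCell ''F'' [V1, NSub I1 V1, NSub V1 I1])))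
    (Seq (Tab ''y'' [] N1 N1 N1 (succ_exp PP) N1 (RCell ''C'' [V1, NVar ''l'']))
    (Seq (Seq (Member ''b'' (RCell ''y'' []) ''g'' TT ''x'') (NAssign ''b'' N0))
    (Seq (Tab ''e'' [I1] (succ_exp PP) N1 N1 TT N1 (RMul (RCell ''x'' [NAdd V1 I1]) (RCell ''F'' [I1, V1, N0])))
    (Seq (Tab ''t'' [I1, I2] (succ_exp PP) TT N1 N1 N1
           (RAdd (RCell ''xi'' [I1, I2]) (RMul (RSub ROne (RCell ''f'' [I1])) (RCell ''x'' [NAdd I2 I1]))))
    (Seq (Tab ''xi'' [I1, I2] (succ_exp PP) TT N1 N1 N1 (RCell ''t'' [I1, I2]))
    (Seq (Tab ''t'' [I1] (succ_exp PP) N1 N1 N1 N1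
           (RAdd (RCell ''f'' [I1]) (RMul (RSub ROne (RCell ''f'' [I1])) (RCell ''e'' [I1]))))
         (Tab ''f'' [I1] (succ_exp PP) N1 N1 N1 N1 (RCell ''t'' [I1]))))))))"

definition test_prog :: com where
  "test_prog = For ''l'' (succ_exp (NVar ''L'')) test_step_prog"

text \<open>\<open>s\<close> is the sum of the idempotents found so far, \<open>d\<close> the new
  one, and \<open>ze\<close> its product with the coefficient that cancels \<open>f\<close>.\<close>

definition split_step_prog :: com where
  "split_step_prog =
     Seq (Tab ''v'' [] N1 N1 N1 N1 N1 (RMul (RCell ''f'' [KK]) (RSub ROne (RCell ''s'' []))))
    (Seq (Tab ''g'' [I1] N1 N1 N1 N1 N1 (RMul (RCell ''v'' []) (RCell ''v'' [])))
    (Seq (Seq (Member ''b'' (RCell ''v'' []) ''g'' N1 ''z'') (NAssign ''b'' N0))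
    (Seq (Tab ''d'' [] N1 N1 N1 N1 N1 (RMul (RCell ''v'' []) (RCell ''z'' [N0])))
    (Seq (Tab ''ze'' [KK] N1 N1 N1 N1 N1 (RMul (RCell ''d'' []) (RCell ''z'' [N0])))
    (Seq (Tab ''t'' [] N1 N1 N1 N1 N1 (RAdd (RCell ''s'' []) (RCell ''d'' [])))
         (Tab ''s'' [] N1 N1 N1 N1 N1 (RCell ''t'' [])))))))"

definition split_prog :: com where
  "split_prog = For ''k'' (succ_exp PP) split_step_prog"

text \<open>The minus sign of \<open>partial_inverse\<close> is postponed to the second table, so
  \<open>Z\<close> holds the negated combinations.\<close>

definition inverse_prog :: com where
  "inverse_prog = Seq
     (Tab ''Z'' [I1, I2, I3] (succ_exp PP) QQ PP TT PP
       (RMul (RCell ''xi'' [I1, V1]) (RMul (RCell ''S'' [V2, I2, N0])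
         (RCell ''D'' [I1, V2, I3, NSub V1 (NAdd (NMul (NVar ''c'') I1) (NMul (NConst 2) (NAdd I2 V2))),
           NSub (NAdd (NMul (NVar ''c'') I1) (NMul (NConst 2) (NAdd I2 V2))) V1]))))
     (Tab ''X'' [I1, I2] QQ PP N1 (succ_exp PP) N1
       (RSub RZero (RMul (RCell ''ze'' [V1]) (RCell ''Z'' [V1, I1, I2]))))"

definition products_prog :: com where
  "products_prog =
     Seq (Tab ''SX'' [I1, I2] PP PP N1 QQ N1 (RMul (RCell ''S'' [I1, V1, N0]) (RCell ''X'' [V1, I2])))
    (Seq (Tab ''SXS'' [I1, I2] PP QQ N1 PP N1 (RMul (RCell ''SX'' [I1, V1]) (RCell ''S'' [V1, I2, N0])))
    (Seq (Tab ''XS'' [I1, I2] QQ QQ N1 PP N1 (RMul (RCell ''X'' [I1, V1]) (RCell ''S'' [V1, I2, N0])))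
    (Seq (Tab ''Y'' [I1, I2] QQ PP N1 QQ N1 (RMul (RCell ''XS'' [I1, V1]) (RCell ''X'' [V1, I2])))
    (Seq (Tab ''SY'' [I1, I2] PP PP N1 QQ N1 (RMul (RCell ''S'' [I1, V1, N0]) (RCell ''Y'' [V1, I2])))
    (Seq (Tab ''YS'' [I1, I2] QQ QQ N1 PP N1 (RMul (RCell ''Y'' [I1, V1]) (RCell ''S'' [V1, I2, N0])))
         (RAssign ''one'' [N0] ROne))))))"

definition env :: "nat \<Rightarrow> nat \<Rightarrow> nstore \<Rightarrow> bool" where
  "env p q \<nu> \<longleftrightarrow> \<nu> ''p'' = p \<and> \<nu> ''q'' = q \<and> \<nu> ''c'' = 2 * (p + q) \<and> \<nu> ''L'' = 2 * (p + q) * p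
     \<and> \<nu> ''T'' = 2 * (p + q) * p + p + 1 \<and> (\<forall>x\<in>{''i1'', ''i2'', ''i3'', ''v1'', ''v2'', ''k'', ''r'', ''l'', ''b''}. \<nu> x = 0)"

section \<open>Verification of the components\<close>

text \<open>The cost bound \<open>w\<close> is an arbitrary function of the number of generators.
  One verification thus serves the run with free tests and the run with a power bound.\<close>

locale matrix_program =
  fixes member :: "'a :: comm_ring_1 \<Rightarrow> 'a list \<Rightarrow> 'a list option" and ops :: "'a \<Rightarrow> 'a list \<Rightarrow> nat"
    and w :: "nat \<Rightarrow> real" and \<nu> :: nstore and p q :: nat and S :: "'a mat"
  assumes w: "\<And>x xs. real (ops x xs) \<le> w (length xs)" and sd: "strongly_discrete member"
    and env: "env p q \<nu>" and S: "S \<in> carrier_mat p q"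
begin

text \<open>Both the number of generators of a test and the number of coefficients kept of each
  power series: the prefix sums are needed at the weights below \<open>gens_count S\<close>.\<close>

definition "T = 2 * (p + q) * p + p + 1"

lemma env_simps [simp]:
  "\<nu> ''p'' = p" "\<nu> ''q'' = q" "\<nu> ''c'' = 2 * (p + q)" "\<nu> ''L'' = 2 * (p + q) * p" "\<nu> ''T'' = T"
  "\<nu> ''i1'' = 0" "\<nu> ''i2'' = 0" "\<nu> ''i3'' = 0" "\<nu> ''v1'' = 0" "\<nu> ''v2'' = 0" "\<nu> ''k'' = 0" "\<nu> ''r'' = 0" "\<nu> ''l'' = 0" "\<nu> ''b'' = 0"
  using env by (auto simp: env_def T_def)

lemma dims: "dim_row S = p" "dim_col S = q"
  using S by auto

definition S_array :: "'a rstore \<Rightarrow> bool" where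
  "S_array \<rho> \<longleftrightarrow> (\<forall>i<p. \<forall>j<q. \<rho> ''S'' [i, j, 0] = S $$ (i, j)) \<and> (\<forall>i j g. g \<noteq> 0 \<longrightarrow> \<rho> ''S'' [i, j, g] = 0)"

definition M_array :: "'a rstore \<Rightarrow> bool" where
  "M_array \<rho> \<longleftrightarrow> (\<forall>i<p. \<forall>j<p. \<forall>d<T. \<rho> ''M'' [i, j, d] = fps_nth (gram S $$ (i, j)) d)"

text \<open>With truncated subtraction, \<open>d - e + (e - d)\<close> is 0 only for
  \<open>d = e\<close>, and \<open>e - d\<close> is 0 only for \<open>e \<le> d\<close>.\<close>

lemma guard_cell:
  assumes "\<And>g. g \<noteq> (0 :: nat) \<Longrightarrow> h g = (0 :: 'a)"
  shows "h (d - e + (e - d)) = (if d = e then h 0 else 0)" and "h (e - d) = (if e \<le> d then h 0 else 0)"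
  using assms[of "d - e + (e - d)"] assms[of "e - d"] by (cases "d = e"; cases "e \<le> d"; simp)+

lemma S_guard: "S_array \<rho> \<Longrightarrow> i < p \<Longrightarrow> j < q \<Longrightarrow> \<rho> ''S'' [i, j, d - e + (e - d)] = (if d = e then S $$ (i, j) else 0)"
  unfolding S_array_def by (subst guard_cell(1)[of "\<lambda>g. \<rho> ''S'' [i, j, g]"]) auto

lemma run_Seq':
  assumes "run member ops \<nu>' P \<rho> a1 e1 Q" "\<And>\<rho>'. Q \<rho>' \<Longrightarrow> run member ops \<nu>' P' \<rho>' a2 e2 R" "a1 + a2 \<le> a" "e1 + e2 \<le> e"
  shows "run member ops \<nu>' (Seq P P') \<rho> a e R"
  using run_weaken[OF run_Seq[OF assms(1,2)] assms(3,4)] by blast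

lemma gram_prog_run:
  assumes "S_array \<rho>"
  shows "run member ops \<nu> gram_prog \<rho> (p * (p * (T * (q * 2)))) 0 (\<lambda>\<rho>'. same_off {''M'', ''acc''} \<rho> \<rho>' \<and> M_array \<rho>')"
  unfolding gram_prog_def
proof (rule run_TabS[where hm = q], goal_cases)
  case (10 \<rho>')
  note val = 10(2)[simplified]
  have "\<rho>' ''M'' [i, j, d] = fps_nth (gram S $$ (i, j)) d" if "i < p" "j < p" "d < T" for i j d
    unfolding val[OF that] using S_guard[OF assms that(2)] assms that
    by (auto simp: S_array_def gram_def dims fps_sum_nth fps_X_power_nth intro!: sum.cong)
  then show ?case using 10(1) by (simp add: M_array_def)
qed simp_all

section \<open>The characteristic polynomial and the adjugate by recursion\<close>

definition lead_gram :: "nat \<Rightarrow> 'a fps mat" where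
  "lead_gram n = mat n n (\<lambda>(i, j). gram S $$ (i, j))"

text \<open>Counted from the leading coefficient downwards. Index 0 is then 1 for every size, and
  the array can be updated in place from size \<open>k\<close> to size \<open>k + 1\<close>.\<close>

definition lead_char_coeff :: "nat \<Rightarrow> nat \<Rightarrow> 'a fps" where
  "lead_char_coeff n r = (if r \<le> n then coeff (char_poly (lead_gram n)) (n - r) else 0)"

definition G_array :: "(nat \<Rightarrow> 'a fps) \<Rightarrow> 'a rstore \<Rightarrow> bool" where
  "G_array h \<rho> \<longleftrightarrow> (\<forall>r. \<forall>d<T. \<rho> ''G'' [r, d, 0] = fps_nth (h r) d) \<and> (\<forall>r d g. g \<noteq> 0 \<longrightarrow> \<rho> ''G'' [r, d, g] = 0)"

definition U_array :: "(nat \<Rightarrow> 'a fps) \<Rightarrow> nat \<Rightarrow> 'a rstore \<Rightarrow> bool" where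
  "U_array u n \<rho> \<longleftrightarrow> (\<forall>i<n. \<forall>d<T. \<rho> ''U'' [i, d] = fps_nth (u i) d)"

lemma lead_gram_carrier: "lead_gram n \<in> carrier_mat n n"
  by (simp add: lead_gram_def)

lemma convolution:
  fixes f g :: "'a fps"
  assumes "\<And>w. w \<le> d \<Longrightarrow> x w = fps_nth f w" "\<And>w. w \<le> d \<Longrightarrow> y (d - w) = fps_nth g (d - w)"
  shows "(\<Sum>w<Suc d. x w * y (d - w)) = fps_nth (f * g) d"
  unfolding fps_mult_nth using assms by (intro sum.cong) auto

definition char_step_cost :: nat where
  "char_step_cost = p * (T * (p * T * 2)) + p * T + 4 * T"

text \<open>At stage \<open>r\<close>, \<open>G\<close> is new up to index \<open>r\<close> and
  still old beyond, and \<open>U\<close> is the last column of the adjugate at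
  \<open>Y^(k - r)\<close>. The corner entry of the next column is an old coefficient by
  \<open>adj_coeff_leading_minor\<close>, and the recursion there is solved for the new one.\<close>

lemma char_step_run:
  assumes k: "k < p" and r: "r \<le> k" and M: "M_array \<rho>"
    and G: "G_array (\<lambda>x. if x \<le> r then lead_char_coeff (Suc k) x else lead_char_coeff k x) \<rho>"
    and U: "U_array (\<lambda>i. adj_coeff (lead_gram (Suc k)) (k - r) i k) (Suc k) \<rho>"
  shows "run member ops (\<nu>(''k'' := k, ''r'' := r)) char_step_prog \<rho> char_step_cost 0
    (\<lambda>\<rho>'. same_off {''W'', ''U'', ''H'', ''G'', ''acc''} \<rho> \<rho>'
      \<and> G_array (\<lambda>x. if x \<le> Suc r then lead_char_coeff (Suc k) x else lead_char_coeff k x) \<rho>'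
      \<and> (r < k \<longrightarrow> U_array (\<lambda>i. adj_coeff (lead_gram (Suc k)) (k - Suc r) i k) (Suc k) \<rho>'))"
proof -
  let ?\<nu> = "\<nu>(''k'' := k, ''r'' := r)"
  let ?L = "lead_gram (Suc k)"
  note L = lead_gram_carrier[of "Suc k"]
  define W where "W i = (\<Sum>l<Suc k. ?L $$ (i, l) * adj_coeff ?L (k - r) l k)" for i
  let ?Gold = "\<lambda>x. if x \<le> r then lead_char_coeff (Suc k) x else lead_char_coeff k x"
  have "mat k k (\<lambda>(i, j). ?L $$ (i, j)) = lead_gram k"
    by (intro eq_matI) (auto simp: lead_gram_def)
  then have minor: "adj_coeff ?L \<kappa> k k = coeff (char_poly (lead_gram k)) \<kappa>" for \<kappa>
    using adj_coeff_leading_minor[OF L, of \<kappa>] by metis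
  have adj: "adj_coeff ?L (k - Suc r) i k = (if i = k then coeff (char_poly ?L) (k - r) else 0) + W i"
    if "r < k" "i < Suc k" for i
    using adj_coeff_rec[OF L that(2) lessI, of "k - Suc r"] that(1) by (simp add: W_def Suc_diff_Suc)
  \<comment> \<open>For \<open>r = k\<close> the recursion has reached its bottom: the corner entry
    is replaced by 0, which is the value of \<open>lead_char_coeff k (Suc k)\<close>.\<close>
  have Gnew: "lead_char_coeff (Suc k) (Suc r) = lead_char_coeff k (Suc r) - W k"
  proof (cases "r < k")
    case True
    have "lead_char_coeff k (Suc r) = lead_char_coeff (Suc k) (Suc r) + W k"
      using adj[OF True lessI] True by (simp add: lead_char_coeff_def minor)
    then show ?thesis by simp
  next
    case False
    then have "r = k" using r by simp
    then show ?thesis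
      using adj_coeff_bottom[OF L lessI lessI]
      by (simp add: W_def lead_char_coeff_def eq_neg_iff_add_eq_0 del: sum.lessThan_Suc)
  qed
  define Q1 where "Q1 \<rho>' \<longleftrightarrow> same_off {''W'', ''acc''} \<rho> \<rho>' \<and> (\<forall>i\<le>k. \<forall>d<T. \<rho>' ''W'' [i, d] = fps_nth (W i) d)" for \<rho>'
  define Q2 where "Q2 \<rho>' \<longleftrightarrow> same_off {''W'', ''U'', ''acc''} \<rho> \<rho>' \<and> (\<forall>i\<le>k. \<forall>d<T. \<rho>' ''W'' [i, d] = fps_nth (W i) d)
    \<and> (\<forall>i<k. \<forall>d<T. \<rho>' ''U'' [i, d] = fps_nth (W i) d)" for \<rho>'
  define Q3 where "Q3 \<rho>' \<longleftrightarrow> same_off {''W'', ''U'', ''acc''} \<rho> \<rho>' \<and> (\<forall>i\<le>k. \<forall>d<T. \<rho>' ''W'' [i, d] = fps_nth (W i) d)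
    \<and> (\<forall>i<k. \<forall>d<T. \<rho>' ''U'' [i, d] = fps_nth (W i) d) \<and> (\<forall>d<T. \<rho>' ''U'' [k, d] = fps_nth (lead_char_coeff k (Suc r)) d)" for \<rho>'
  define Q4 where "Q4 \<rho>' \<longleftrightarrow> same_off {''W'', ''U'', ''H'', ''acc''} \<rho> \<rho>'
    \<and> (\<forall>i<k. \<forall>d<T. \<rho>' ''U'' [i, d] = fps_nth (W i) d) \<and> (\<forall>d<T. \<rho>' ''U'' [k, d] = fps_nth (lead_char_coeff k (Suc r)) d)
    \<and> (\<forall>d<T. \<rho>' ''H'' [d] = fps_nth (lead_char_coeff (Suc k) (Suc r)) d)" for \<rho>'
  have 1: "run member ops ?\<nu> (Tab ''W'' [I1, I2] (succ_exp KK) TT N1 (succ_exp KK) (succ_exp I2)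
      (RMul (RCell ''M'' [I1, V1, V2]) (RCell ''U'' [V1, NSub I2 V2]))) \<rho> (p * (T * (p * T * 2))) 0 Q1"
  proof (rule run_TabS[where hm = "Suc k * T"], goal_cases)
    case (10 \<rho>')
    have "\<rho>' ''W'' [i, d] = fps_nth (W i) d" if "i \<le> k" "d < T" for i d
    proof -
      have val: "\<rho>' ''W'' [i, d] = (\<Sum>u<Suc k. \<Sum>w<Suc d. \<rho> ''M'' [i, u, w] * \<rho> ''U'' [u, d - w])"
        using 10(2)[of i d 0] that by (simp del: sum.lessThan_Suc)
      have "(\<Sum>w<Suc d. \<rho> ''M'' [i, u, w] * \<rho> ''U'' [u, d - w]) = fps_nth (?L $$ (i, u) * adj_coeff ?L (k - r) u k) d"
        if "u < Suc k" for u
        using that \<open>i \<le> k\<close> \<open>d < T\<close> M U k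
        by (intro convolution) (auto simp: M_array_def U_array_def lead_gram_def)
      then show ?thesis by (simp add: val W_def fps_sum_nth del: sum.lessThan_Suc)
    qed
    then show ?case using 10(1) by (simp add: Q1_def)
  next
    case (8 i j l)
    then have "Suc k * Suc j \<le> Suc k * T" by (intro mult_le_mono) auto
    then show ?case by simp
  next
    case 9
    have "Suc k * (T * (Suc k * T * 2)) \<le> p * (T * (p * T * 2))" using k by (intro mult_le_mono) auto
    then show ?case by (simp add: algebra_simps)
  qed auto
  have 2: "run member ops ?\<nu> (Tab ''U'' [I1, I2] KK TT N1 N1 N1 (RCell ''W'' [I1, I2])) \<rho>' (p * T) 0 Q2" if "Q1 \<rho>'" for \<rho>'
  proof (rule run_TabS[where hm = 1], goal_cases)
    case (10 \<rho>')
    note val = 10(2)[of _ _ 0, simplified]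
    show ?case using 10(1) val that by (auto simp: Q1_def Q2_def same_off_def)
  qed (use k in auto)
  have 3: "run member ops ?\<nu> (Tab ''U'' [KK, I2] N1 TT N1 N1 N1 (RCell ''G'' [succ_exp (NVar ''r''), I2, N0])) \<rho>' T 0 Q3" if "Q2 \<rho>'" for \<rho>'
  proof (rule run_TabS[where hm = 1], goal_cases)
    case (10 \<rho>'')
    note val = 10(2)[of 0 _ 0, simplified]
    have other: "\<rho>'' ''U'' [i, d] = \<rho>' ''U'' [i, d]" if "i < k" for i d using 10(3)[of "[i, d]"] that by auto
    have "\<rho>' ''G'' = \<rho> ''G''" using that by (auto simp: Q2_def same_off_def)
    then have "\<rho>'' ''U'' [k, d] = fps_nth (lead_char_coeff k (Suc r)) d" if "d < T" for d
      using val[OF that] G that by (simp add: G_array_def)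
    then show ?case using 10(1) that other by (auto simp: Q2_def Q3_def same_off_def)
  qed (use k in auto)
  have 4: "run member ops ?\<nu> (Tab ''H'' [I2] N1 TT N1 N1 N1 (RSub (RCell ''G'' [succ_exp (NVar ''r''), I2, N0]) (RCell ''W'' [KK, I2]))) \<rho>' (2 * T) 0 Q4" if "Q3 \<rho>'" for \<rho>'
  proof (rule run_TabS[where hm = 1], goal_cases)
    case (10 \<rho>'')
    note val = 10(2)[of 0 _ 0, simplified]
    have "\<rho>' ''G'' = \<rho> ''G''" using that by (auto simp: Q3_def same_off_def)
    then have "\<rho>'' ''H'' [d] = fps_nth (lead_char_coeff (Suc k) (Suc r)) d" if "d < T" for d
      using val[OF that] G that \<open>Q3 \<rho>'\<close> by (simp add: G_array_def Gnew Q3_def)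
    then show ?case using 10(1) that by (auto simp: Q3_def Q4_def same_off_def)
  qed (use k in auto)
  have 5: "run member ops ?\<nu> (Tab ''G'' [succ_exp (NVar ''r''), I2, N0] N1 TT N1 N1 N1 (RCell ''H'' [I2])) \<rho>' T 0
    (\<lambda>\<rho>'. same_off {''W'', ''U'', ''H'', ''G'', ''acc''} \<rho> \<rho>'
      \<and> G_array (\<lambda>x. if x \<le> Suc r then lead_char_coeff (Suc k) x else lead_char_coeff k x) \<rho>'
      \<and> (r < k \<longrightarrow> U_array (\<lambda>i. adj_coeff (lead_gram (Suc k)) (k - Suc r) i k) (Suc k) \<rho>'))" if Q: "Q4 \<rho>'" for \<rho>'
  proof (rule run_TabS[where hm = 1], goal_cases)
    case (10 \<rho>'')
    note val = 10(2)[of 0 _ 0, simplified]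
    have G0: "\<rho>' ''G'' = \<rho> ''G''" using that by (auto simp: Q4_def same_off_def)
    have other: "\<rho>'' ''G'' [x, d, g] = \<rho> ''G'' [x, d, g]" if "x \<noteq> Suc r \<or> g \<noteq> 0" for x d g
      using 10(3)[of "[x, d, g]"] that G0 by auto
    have "G_array (\<lambda>x. if x \<le> Suc r then lead_char_coeff (Suc k) x else lead_char_coeff k x) \<rho>''"
      unfolding G_array_def
    proof (intro conjI allI impI)
      fix x d assume d: "d < T"
      show "\<rho>'' ''G'' [x, d, 0] = fps_nth (if x \<le> Suc r then lead_char_coeff (Suc k) x else lead_char_coeff k x) d"
        using val[OF d] other[of x 0 d] G d Q by (cases "x = Suc r") (auto simp: G_array_def Q4_def)
    next
      fix x d and g :: nat assume "g \<noteq> 0"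
      then show "\<rho>'' ''G'' [x, d, g] = 0" using other[of x g d] G by (simp add: G_array_def)
    qed
    moreover have "\<rho>'' ''U'' = \<rho>' ''U''" using 10(1) by (auto simp: same_off_def)
    then have "U_array (\<lambda>i. adj_coeff (lead_gram (Suc k)) (k - Suc r) i k) (Suc k) \<rho>''" if rk: "r < k"
    proof -
      have "adj_coeff ?L (k - Suc r) i k = W i" if "i < k" for i using adj[OF rk, of i] that by simp
      moreover have "adj_coeff ?L (k - Suc r) k k = lead_char_coeff k (Suc r)" using rk by (simp add: lead_char_coeff_def minor)
      ultimately show ?thesis
        using \<open>\<rho>'' ''U'' = \<rho>' ''U''\<close> Q by (simp add: U_array_def Q4_def less_Suc_eq)
    qed
    ultimately show ?case using 10(1) Q by (auto simp: Q4_def same_off_def)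
  qed (use k in auto)
  show ?thesis
    unfolding char_step_prog_def
    by (rule run_weaken[OF run_Seq[OF 1 run_Seq[OF 2 run_Seq[OF 3 run_Seq[OF 4 5]]]]], assumption+)
       (auto simp: char_step_cost_def)
qed

lemma char_prog_run:
  assumes M: "M_array \<rho>" and G0: "\<rho> ''G'' = (\<lambda>_. 0)"
  shows "run member ops \<nu> char_prog \<rho> (p * (p * T + p * char_step_cost)) 0
    (\<lambda>\<rho>'. same_off {''W'', ''U'', ''H'', ''G'', ''acc''} \<rho> \<rho>' \<and> G_array (lead_char_coeff p) \<rho>')"
proof -
  let ?off = "{''W'', ''U'', ''H'', ''G'', ''acc''}"
  \<comment> \<open>The empty matrix has characteristic polynomial 1.\<close>
  have c0: "lead_char_coeff 0 = (\<lambda>x. if x = 0 then 1 else 0)"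
    by (auto simp: lead_char_coeff_def fun_eq_iff char_poly_def char_poly_matrix_def lead_gram_def)
  have 1: "run member ops \<nu> (RAssign ''G'' [N0, N0, N0] ROne) \<rho> 0 0 (\<lambda>\<rho>'. same_off ?off \<rho> \<rho>' \<and> G_array (lead_char_coeff 0) \<rho>')"
    by (rule run_weaken[OF run_RAssign[where Q = "\<lambda>\<rho>'. same_off ?off \<rho> \<rho>' \<and> G_array (lead_char_coeff 0) \<rho>'"]])
       (auto simp: store_cell_def same_off_def G_array_def c0 G0 fps_one_nth)
  have 2: "run member ops \<nu> (For ''k'' PP (Seq
       (Tab ''U'' [I1, I2] (succ_exp KK) TT N1 (NMul (NSub N1 I2) (NSub N1 (NSub KK I1))) N1 ROne)
       (For ''r'' (succ_exp KK) char_step_prog))) \<rho>0 (p * (p * T + p * char_step_cost)) (real p * 0)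
      (\<lambda>\<rho>'. same_off ?off \<rho> \<rho>' \<and> G_array (lead_char_coeff p) \<rho>')"
    if "same_off ?off \<rho> \<rho>0 \<and> G_array (lead_char_coeff 0) \<rho>0" for \<rho>0
  proof (rule run_For[where I = "\<lambda>k \<rho>'. same_off ?off \<rho> \<rho>' \<and> G_array (lead_char_coeff k) \<rho>'"])
    fix k \<rho>1 assume k: "k < p" and I: "same_off ?off \<rho> \<rho>1 \<and> G_array (lead_char_coeff k) \<rho>1"
    let ?L = "lead_gram (Suc k)"
    note L = lead_gram_carrier[of "Suc k"]
    let ?Q = "\<lambda>r \<rho>'. same_off ?off \<rho> \<rho>' \<and> G_array (\<lambda>x. if x \<le> r then lead_char_coeff (Suc k) x else lead_char_coeff k x) \<rho>'
      \<and> (r \<le> k \<longrightarrow> U_array (\<lambda>i. adj_coeff ?L (k - r) i k) (Suc k) \<rho>')"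
    have top: "adj_coeff ?L k i k = (if i = k then 1 else 0)" if "i < Suc k" for i
      using adj_coeff_rec[OF L that lessI, of k] adj_coeff_eq_0[OF L _ lessI, of _ "Suc k"] char_poly_coeff_ge(1)[OF L] by simp
    have lc0: "lead_char_coeff n 0 = 1" for n using char_poly_coeff_ge(1)[OF lead_gram_carrier] by (simp add: lead_char_coeff_def)
    have 1: "run member ops (\<nu>(''k'' := k)) (Tab ''U'' [I1, I2] (succ_exp KK) TT N1 (NMul (NSub N1 I2) (NSub N1 (NSub KK I1))) N1 ROne) \<rho>1
      (p * T) 0 (?Q 0)"
    proof (rule run_TabS[where hm = 1], goal_cases)
      case (10 \<rho>')
      note val = 10(2)[of _ _ 0, simplified]
      have "U_array (\<lambda>i. adj_coeff ?L (k - 0) i k) (Suc k) \<rho>'"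
        by (auto simp: U_array_def val top fps_one_nth)
      moreover have "G_array (\<lambda>x. if x \<le> 0 then lead_char_coeff (Suc k) x else lead_char_coeff k x) \<rho>'"
        using I 10(1) lc0 by (auto simp: G_array_def same_off_def)
      ultimately show ?case using I 10(1) by (auto simp: same_off_def)
    next
      case (8 i j l)
      show ?case by (cases j; cases "k - i") auto
    next
      case 9
      have "Suc k * T \<le> p * T" using k by (intro mult_le_mono) auto
      then show ?case by simp
    qed auto
    have 2: "run member ops (\<nu>(''k'' := k)) (For ''r'' (succ_exp KK) char_step_prog) \<rho>2 (Suc k * char_step_cost) (real (Suc k) * 0) (?Q (Suc k))"
      if "?Q 0 \<rho>2" for \<rho>2
    proof (rule run_For[where I = ?Q])
      fix r \<rho>3 assume r: "r < Suc k" and Q: "?Q r \<rho>3"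
      have M3: "M_array \<rho>3" using M Q by (auto simp: M_array_def same_off_def)
      show "run member ops (\<nu>(''k'' := k, ''r'' := r)) char_step_prog \<rho>3 char_step_cost 0 (?Q (Suc r))"
        by (rule run_weaken[OF char_step_run[OF k _ M3]]) (use r Q in \<open>auto simp: same_off_def\<close>)
    qed (use that in auto)
    have all: "G_array (lead_char_coeff (Suc k)) \<rho>'" if "?Q (Suc k) \<rho>'" for \<rho>'
    proof -
      have "(\<lambda>x. if x \<le> Suc k then lead_char_coeff (Suc k) x else lead_char_coeff k x) = lead_char_coeff (Suc k)"
        by (auto simp: fun_eq_iff lead_char_coeff_def)
      then show ?thesis using that by simp
    qed
    show "run member ops (\<nu>(''k'' := k)) (Seq
       (Tab ''U'' [I1, I2] (succ_exp KK) TT N1 (NMul (NSub N1 I2) (NSub N1 (NSub KK I1))) N1 ROne)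
       (For ''r'' (succ_exp KK) char_step_prog)) \<rho>1 (p * T + p * char_step_cost) 0
       (\<lambda>\<rho>'. same_off ?off \<rho> \<rho>' \<and> G_array (lead_char_coeff (Suc k)) \<rho>')"
      by (rule run_Seq'[OF 1 run_weaken[OF 2 le_refl order_refl]])
         (use k all in \<open>auto intro!: mult_le_mono simp del: mult_Suc\<close>)
  qed (use that in auto)
  show ?thesis
    unfolding char_prog_def by (rule run_Seq'[OF 1 2]) auto
qed

text \<open>\<open>h\<close> is the lowest coefficient already stored. The range includes
  coefficient \<open>p\<close>, which is 0 and starts the recursion.\<close>

definition D_array :: "nat \<Rightarrow> 'a rstore \<Rightarrow> bool" where
  "D_array h \<rho> \<longleftrightarrow> (\<forall>\<kappa>. h \<le> \<kappa> \<longrightarrow> \<kappa> \<le> p \<longrightarrow> (\<forall>i<p. \<forall>j<p. \<forall>d<T. \<rho> ''D'' [\<kappa>, i, j, d, 0] = fps_nth (adj_coeff (gram S) \<kappa> i j) d))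
     \<and> (\<forall>\<kappa> i j d g. g \<noteq> 0 \<longrightarrow> \<rho> ''D'' [\<kappa>, i, j, d, g] = 0)"

definition C_array :: "'a rstore \<Rightarrow> bool" where
  "C_array \<rho> \<longleftrightarrow> (\<forall>k\<le>p. \<forall>l<T. \<rho> ''C'' [k, l] = gram_coeff S k l)"

definition F_array :: "'a rstore \<Rightarrow> bool" where
  "F_array \<rho> \<longleftrightarrow> (\<forall>k\<le>p. \<forall>l<T. \<rho> ''F'' [k, l, 0] = gram_prefix S k l) \<and> (\<forall>k l g. g \<noteq> 0 \<longrightarrow> \<rho> ''F'' [k, l, g] = 0)"

lemma lead_char_coeff_gram: "k \<le> p \<Longrightarrow> lead_char_coeff p (p - k) = coeff (char_poly (gram S)) k"
proof -
  have "lead_gram p = gram S" by (intro eq_matI) (auto simp: lead_gram_def gram_def dims)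
  then show "k \<le> p \<Longrightarrow> ?thesis" by (simp add: lead_char_coeff_def)
qed

lemma gram_S: "gram S \<in> carrier_mat p p"
  using gram_carrier[of S] by (simp add: dims)

lemma adj_prog_run:
  assumes M: "M_array \<rho>" and G: "G_array (lead_char_coeff p) \<rho>" and D0: "\<rho> ''D'' = (\<lambda>_. 0)"
  shows "run member ops \<nu> adj_prog \<rho> (p * (p * (p * (T * (p * T * 2))) + p * (p * (T * 2)))) 0
    (\<lambda>\<rho>'. same_off {''E'', ''D'', ''acc''} \<rho> \<rho>' \<and> D_array 0 \<rho>')"
proof -
  let ?off = "{''E'', ''D'', ''acc''}"
  let ?G = "gram S"
  have D_top: "D_array p \<rho>"
    by (auto simp: D_array_def D0 adj_coeff_eq_0[OF gram_S])
  have "run member ops \<nu> adj_prog \<rho> (p * (p * (p * (T * (p * T * 2))) + p * (p * (T * 2)))) (real p * 0)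
    (\<lambda>\<rho>'. same_off ?off \<rho> \<rho>' \<and> D_array (p - p) \<rho>')"
    unfolding adj_prog_def
  proof (rule run_For[where I = "\<lambda>k \<rho>'. same_off ?off \<rho> \<rho>' \<and> D_array (p - k) \<rho>'"])
    fix k \<rho>1 assume k: "k < p" and I: "same_off ?off \<rho> \<rho>1 \<and> D_array (p - k) \<rho>1"
    have M1: "M_array \<rho>1" and G1: "G_array (lead_char_coeff p) \<rho>1"
      using I M G by (auto simp: M_array_def G_array_def same_off_def)
    let ?E = "\<lambda>i j. \<Sum>u<p. ?G $$ (i, u) * adj_coeff ?G (p - k) u j"
    define Q where "Q \<rho>' \<longleftrightarrow> same_off {''E'', ''acc''} \<rho>1 \<rho>' \<and> (\<forall>i<p. \<forall>j<p. \<forall>d<T. \<rho>' ''E'' [i, j, d] = fps_nth (?E i j) d)" for \<rho>'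
    have 1: "run member ops (\<nu>(''k'' := k)) (Tab ''E'' [I1, I2, I3] PP PP TT PP (succ_exp I3)
       (RMul (RCell ''M'' [I1, V1, V2]) (RCell ''D'' [NSub PP KK, V1, I2, NSub I3 V2, N0]))) \<rho>1
       (p * (p * (T * (p * T * 2)))) 0 Q"
    proof (rule run_TabS[where hm = "p * T"], goal_cases)
      case (10 \<rho>')
      have "\<rho>' ''E'' [i, j, d] = fps_nth (?E i j) d" if "i < p" "j < p" "d < T" for i j d
      proof -
        have val: "\<rho>' ''E'' [i, j, d] = (\<Sum>u<p. \<Sum>w<Suc d. \<rho>1 ''M'' [i, u, w] * \<rho>1 ''D'' [p - k, u, j, d - w, 0])"
          using 10(2)[of i j d] that by (simp del: sum.lessThan_Suc)
        have "(\<Sum>w<Suc d. \<rho>1 ''M'' [i, u, w] * \<rho>1 ''D'' [p - k, u, j, d - w, 0]) = fps_nth (?G $$ (i, u) * adj_coeff ?G (p - k) u j) d"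
          if "u < p" for u
          using that \<open>i < p\<close> \<open>j < p\<close> \<open>d < T\<close> M1 I k
          by (intro convolution) (auto simp: M_array_def D_array_def)
        then show ?thesis by (simp add: val fps_sum_nth del: sum.lessThan_Suc)
      qed
      then show ?case using 10(1) by (simp add: Q_def)
    next
      case (8 i j l)
      then have "p * Suc l \<le> p * T" by (intro mult_le_mono) auto
      then show ?case by simp
    qed auto
    have 2: "run member ops (\<nu>(''k'' := k)) (Tab ''D'' [NSub (NSub PP N1) KK, I1, I2, I3, N0] PP PP TT N1 N1
       (RAdd (RCell ''E'' [I1, I2, I3]) (RCell ''G'' [KK, I3, dist_exp I1 I2]))) \<rho>2 (p * (p * (T * 2))) 0
       (\<lambda>\<rho>'. same_off ?off \<rho> \<rho>' \<and> D_array (p - Suc k) \<rho>')" if Q: "Q \<rho>2" for \<rho>2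
    proof (rule run_TabS[where hm = 1], goal_cases)
      case (10 \<rho>')
      note val = 10(2)[simplified]
      have G2: "\<rho>2 ''G'' = \<rho>1 ''G''" and D2: "\<rho>2 ''D'' = \<rho>1 ''D''" using Q by (auto simp: Q_def same_off_def)
      have guard: "\<rho>1 ''G'' [k, d, i - j + (j - i)] = (if i = j then fps_nth (lead_char_coeff p k) d else 0)" if "d < T" for i j d
        using guard_cell(1)[of "\<lambda>g. \<rho>1 ''G'' [k, d, g]" i j] G1 that by (auto simp: G_array_def)
      have lead: "lead_char_coeff p k = coeff (char_poly ?G) (p - k)"
        using lead_char_coeff_gram[of "p - k"] k by simp
      have new: "\<rho>' ''D'' [p - Suc k, i, j, d, 0] = fps_nth (adj_coeff ?G (p - Suc k) i j) d"
        if "i < p" "j < p" "d < T" for i j d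
        using val[OF that] that Q guard[OF that(3)] adj_coeff_rec[OF gram_S that(1,2), of "p - Suc k"] k
        by (simp add: G2 Q_def lead Suc_diff_Suc)
      have other: "\<rho>' ''D'' [\<kappa>, i, j, d, g] = \<rho>1 ''D'' [\<kappa>, i, j, d, g]" if "\<kappa> \<noteq> p - Suc k \<or> g \<noteq> 0" for \<kappa> i j d g
        using 10(3)[of "[\<kappa>, i, j, d, g]"] that D2 by auto
      have "D_array (p - Suc k) \<rho>'"
        unfolding D_array_def
      proof (intro conjI allI impI)
        fix \<kappa> i j d assume "p - Suc k \<le> \<kappa>" "\<kappa> \<le> p" "i < p" "j < p" "d < T"
        then show "\<rho>' ''D'' [\<kappa>, i, j, d, 0] = fps_nth (adj_coeff ?G \<kappa> i j) d"
          using new[of i j d] other[of \<kappa> 0 i j d] I k by (cases "\<kappa> = p - Suc k") (auto simp: D_array_def)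
      next
        fix \<kappa> i j d and g :: nat assume "g \<noteq> 0"
        then show "\<rho>' ''D'' [\<kappa>, i, j, d, g] = 0" using other I by (auto simp: D_array_def)
      qed
      then show ?case using 10(1) Q I by (auto simp: Q_def same_off_def)
    qed auto
    show "run member ops (\<nu>(''k'' := k)) (Seq
      (Tab ''E'' [I1, I2, I3] PP PP TT PP (succ_exp I3)
        (RMul (RCell ''M'' [I1, V1, V2]) (RCell ''D'' [NSub PP KK, V1, I2, NSub I3 V2, N0])))
      (Tab ''D'' [NSub (NSub PP N1) KK, I1, I2, I3, N0] PP PP TT N1 N1
        (RAdd (RCell ''E'' [I1, I2, I3]) (RCell ''G'' [KK, I3, dist_exp I1 I2])))) \<rho>1
      (p * (p * (T * (p * T * 2))) + p * (p * (T * 2))) 0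
      (\<lambda>\<rho>'. same_off ?off \<rho> \<rho>' \<and> D_array (p - Suc k) \<rho>')"
      by (rule run_Seq'[OF 1 2]) auto
  qed (use D_top in \<open>auto simp: same_off_def\<close>)
  then show ?thesis by simp
qed

lemma coeff_prog_run:
  assumes G: "G_array (lead_char_coeff p) \<rho>" and F0: "\<rho> ''F'' = (\<lambda>_. 0)"
  shows "run member ops \<nu> coeff_prog \<rho> (Suc p * T + Suc p * (T * Suc p)) 0
    (\<lambda>\<rho>'. same_off {''C'', ''F'', ''acc''} \<rho> \<rho>' \<and> C_array \<rho>' \<and> F_array \<rho>')"
proof -
  have 1: "run member ops \<nu> (Tab ''C'' [I1, I2] (succ_exp PP) TT N1 N1 N1
       (RCell ''G'' [NSub PP I1, NSub I2 (NMul (NVar ''c'') I1), NSub (NMul (NVar ''c'') I1) I2])) \<rho> (Suc p * T) 0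
       (\<lambda>\<rho>'. same_off {''C'', ''acc''} \<rho> \<rho>' \<and> C_array \<rho>')"
  proof (rule run_TabS[where hm = 1], goal_cases)
    case (10 \<rho>')
    have "\<rho>' ''C'' [k, l] = gram_coeff S k l" if "k \<le> p" "l < T" for k l
    proof -
      have "\<rho>' ''C'' [k, l] = \<rho> ''G'' [p - k, l - 2 * (p + q) * k, 2 * (p + q) * k - l]"
        using 10(2)[of k l 0] that by simp
      also have "\<dots> = (if 2 * (p + q) * k \<le> l then \<rho> ''G'' [p - k, l - 2 * (p + q) * k, 0] else 0)"
        using guard_cell(2)[of "\<lambda>g. \<rho> ''G'' [p - k, l - 2 * (p + q) * k, g]" "2 * (p + q) * k" l] G
        by (auto simp: G_array_def)
      also have "\<dots> = gram_coeff S k l"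
        using G that by (simp add: G_array_def gram_coeff_def gram_weight_def dims lead_char_coeff_gram)
      finally show ?thesis .
    qed
    then show ?case using 10(1) by (simp add: C_array_def)
  qed auto
  have 2: "run member ops \<nu> (Tab ''F'' [I1, I2, N0] (succ_exp PP) TT N1 (succ_exp I1) N1 (RCell ''C'' [V1, I2])) \<rho>1
      (Suc p * (T * Suc p)) 0 (\<lambda>\<rho>'. same_off {''C'', ''F'', ''acc''} \<rho> \<rho>' \<and> C_array \<rho>' \<and> F_array \<rho>')"
    if I: "same_off {''C'', ''acc''} \<rho> \<rho>1 \<and> C_array \<rho>1" for \<rho>1
  proof (rule run_TabS[where hm = "Suc p"], goal_cases)
    case (10 \<rho>')
    have "\<rho>' ''F'' [k, l, 0] = gram_prefix S k l" if "k \<le> p" "l < T" for k l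
    proof -
      have "\<rho>' ''F'' [k, l, 0] = (\<Sum>u<Suc k. \<rho>1 ''C'' [u, l])" using 10(2)[of k l 0] that by (simp del: sum.lessThan_Suc)
      then show ?thesis using I that by (auto simp: gram_prefix_def C_array_def lessThan_Suc_atMost)
    qed
    moreover have "\<rho>' ''F'' [k, l, g] = 0" if "g \<noteq> 0" for k l g
      using 10(3)[of "[k, l, g]"] that I F0 by (auto simp: same_off_def)
    ultimately have "F_array \<rho>'" by (simp add: F_array_def)
    then show ?case using 10(1) I by (auto simp: same_off_def C_array_def)
  qed auto
  show ?thesis unfolding coeff_prog_def by (rule run_Seq'[OF 1 2]) auto
qed

section \<open>Accumulating the answers of the tests\<close>

definition regular :: "'a mat \<Rightarrow> bool" where
  "regular B \<longleftrightarrow> B \<in> carrier_mat q p \<and> S * B * S = S"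

text \<open>The array of answers is overwritten by each test. What is needed of the family
  \<open>x\<close> survives in \<open>f\<close> and \<open>xi\<close>, so later statements quantify
  \<open>x\<close> existentially.\<close>

definition tested :: "nat \<Rightarrow> (nat \<Rightarrow> nat \<Rightarrow> 'a) \<Rightarrow> 'a rstore \<Rightarrow> bool" where
  "tested h x \<rho> \<longleftrightarrow> (\<forall>l<h. test_elem S l = (\<Sum>j<T. x l j * test_gen S l j)) \<and> (\<forall>l j. T \<le> j \<longrightarrow> x l j = 0)
    \<and> (\<forall>k\<le>p. 1 - \<rho> ''f'' [k] = (\<Prod>l<h. 1 - response S x l k))
    \<and> (\<forall>k\<le>p. \<rho> ''f'' [k] = (\<Sum>n<T. \<rho> ''xi'' [k, n] * gram_prefix S k n))"

lemma gens_count_T: "gens_count S = T"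
  by (simp add: gens_count_def max_height_def gram_weight_def dims T_def)

lemma tested_step:
  assumes x: "tested h x \<rho>" and y: "test_elem S h = (\<Sum>j<T. y j * test_gen S h j)" and y0: "\<And>j. T \<le> j \<Longrightarrow> y j = 0"
    and f: "\<And>k. k \<le> p \<Longrightarrow> \<rho>' ''f'' [k] = \<rho> ''f'' [k] + (1 - \<rho> ''f'' [k]) * (\<Sum>n<T. y (n + k) * gram_prefix S k n)"
    and xi: "\<And>k n. k \<le> p \<Longrightarrow> n < T \<Longrightarrow> \<rho>' ''xi'' [k, n] = \<rho> ''xi'' [k, n] + (1 - \<rho> ''f'' [k]) * y (n + k)"
  shows "tested (Suc h) (x(h := y)) \<rho>'"
proof -
  have old: "response S (x(h := y)) l k = response S x l k" if "l < h" for l k using that by (simp add: response_def)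
  have new: "response S (x(h := y)) h k = (\<Sum>n<T. y (n + k) * gram_prefix S k n)" for k
    by (simp add: response_def gens_count_T)
  have "1 - \<rho>' ''f'' [k] = (\<Prod>l<Suc h. 1 - response S (x(h := y)) l k)" if "k \<le> p" for k
  proof -
    have "1 - \<rho>' ''f'' [k] = (1 - \<rho> ''f'' [k]) * (1 - (\<Sum>n<T. y (n + k) * gram_prefix S k n))"
      by (simp add: f[OF that] algebra_simps)
    also have "1 - \<rho> ''f'' [k] = (\<Prod>l<h. 1 - response S x l k)"
      using x that unfolding tested_def by blast
    also have "\<dots> = (\<Prod>l<h. 1 - response S (x(h := y)) l k)"
      by (intro prod.cong) (simp_all add: old)
    finally show ?thesis by (simp add: new)
  qed
  moreover have "\<rho>' ''f'' [k] = (\<Sum>n<T. \<rho>' ''xi'' [k, n] * gram_prefix S k n)" if "k \<le> p" for k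
  proof -
    have "\<rho> ''f'' [k] = (\<Sum>n<T. \<rho> ''xi'' [k, n] * gram_prefix S k n)" using x that by (simp add: tested_def)
    then show ?thesis using that
      by (simp add: f xi distrib_right sum.distrib sum_distrib_left mult.assoc)
  qed
  ultimately show ?thesis
    using x y y0 by (simp add: tested_def less_Suc_eq)
qed

definition test_cost :: nat where
  "test_cost = 9 * (T * Suc p) + 6 * Suc p"

definition test_off :: "vname set" where
  "test_off = {''g'', ''y'', ''x'', ''e'', ''t'', ''xi'', ''f'', ''acc''}"

text \<open>Costs and array shapes hold unconditionally; the meaning of \<open>f\<close> and
  \<open>xi\<close> is claimed only if some \<open>B\<close> satisfies
  \<open>regular B\<close>.\<close>

lemma test_step_run:
  assumes l: "l \<le> 2 * (p + q) * p" and C: "C_array \<rho>" and F: "F_array \<rho>" and x0: "\<And>j. T \<le> j \<Longrightarrow> \<rho> ''x'' [j] = 0"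
    and tested: "\<And>B. regular B \<Longrightarrow> \<exists>x. tested l x \<rho>"
  shows "run member ops (\<nu>(''l'' := l)) test_step_prog \<rho> test_cost (w T)
    (\<lambda>\<rho>'. same_off test_off \<rho> \<rho>' \<and> (\<forall>j\<ge>T. \<rho>' ''x'' [j] = 0) \<and> (\<forall>B. regular B \<longrightarrow> (\<exists>x. tested (Suc l) x \<rho>')))"
proof -
  let ?\<nu> = "\<nu>(''l'' := l)"
  have lT: "l < T" using l by (simp add: T_def)
  define resp where "resp y k = (\<Sum>n<T. y (n + k) * gram_prefix S k n)" for y :: "nat \<Rightarrow> 'a" and k
  define X where "X \<rho>' \<longleftrightarrow> (\<forall>j\<ge>T. \<rho>' ''x'' [j] = 0) \<and>
    (\<forall>B. regular B \<longrightarrow> test_elem S l = (\<Sum>j<T. \<rho>' ''x'' [j] * test_gen S l j))" for \<rho>' :: "'a rstore"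
  define Q1 where "Q1 \<rho>' \<longleftrightarrow> same_off {''g'', ''acc''} \<rho> \<rho>' \<and> (\<forall>j<T. \<rho>' ''g'' [j] = test_gen S l j)" for \<rho>' :: "'a rstore"
  define Q2 where "Q2 \<rho>' \<longleftrightarrow> same_off {''g'', ''y'', ''acc''} \<rho> \<rho>' \<and> (\<forall>j<T. \<rho>' ''g'' [j] = test_gen S l j)
    \<and> \<rho>' ''y'' [] = test_elem S l" for \<rho>' :: "'a rstore"
  define Q3 where "Q3 \<rho>' \<longleftrightarrow> same_off {''g'', ''y'', ''x'', ''acc''} \<rho> \<rho>' \<and> X \<rho>'" for \<rho>' :: "'a rstore"
  define Q4 where "Q4 \<rho>' \<longleftrightarrow> same_off {''g'', ''y'', ''x'', ''e'', ''acc''} \<rho> \<rho>' \<and> X \<rho>'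
    \<and> (\<forall>k\<le>p. \<rho>' ''e'' [k] = resp (\<lambda>j. \<rho>' ''x'' [j]) k)" for \<rho>' :: "'a rstore"
  define Q5 where "Q5 \<rho>' \<longleftrightarrow> same_off {''g'', ''y'', ''x'', ''e'', ''t'', ''acc''} \<rho> \<rho>' \<and> X \<rho>'
    \<and> (\<forall>k\<le>p. \<rho>' ''e'' [k] = resp (\<lambda>j. \<rho>' ''x'' [j]) k)
    \<and> (\<forall>k\<le>p. \<forall>n<T. \<rho>' ''t'' [k, n] = \<rho> ''xi'' [k, n] + (1 - \<rho> ''f'' [k]) * \<rho>' ''x'' [n + k])" for \<rho>' :: "'a rstore"
  define Q6 where "Q6 \<rho>' \<longleftrightarrow> same_off {''g'', ''y'', ''x'', ''e'', ''t'', ''xi'', ''acc''} \<rho> \<rho>' \<and> X \<rho>'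
    \<and> (\<forall>k\<le>p. \<rho>' ''e'' [k] = resp (\<lambda>j. \<rho>' ''x'' [j]) k)
    \<and> (\<forall>k\<le>p. \<forall>n<T. \<rho>' ''xi'' [k, n] = \<rho> ''xi'' [k, n] + (1 - \<rho> ''f'' [k]) * \<rho>' ''x'' [n + k])" for \<rho>' :: "'a rstore"
  define Q7 where "Q7 \<rho>' \<longleftrightarrow> same_off {''g'', ''y'', ''x'', ''e'', ''t'', ''xi'', ''acc''} \<rho> \<rho>' \<and> X \<rho>'
    \<and> (\<forall>k\<le>p. \<rho>' ''t'' [k] = \<rho> ''f'' [k] + (1 - \<rho> ''f'' [k]) * resp (\<lambda>j. \<rho>' ''x'' [j]) k)
    \<and> (\<forall>k\<le>p. \<forall>n<T. \<rho>' ''xi'' [k, n] = \<rho> ''xi'' [k, n] + (1 - \<rho> ''f'' [k]) * \<rho>' ''x'' [n + k])" for \<rho>' :: "'a rstore"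
  have 1: "run member ops ?\<nu> (Tab ''g'' [I1] TT N1 N1 (succ_exp PP) N1
      (RMul (RCell ''C'' [V1, NVar ''l'']) (RCell ''F'' [V1, NSub I1 V1, NSub V1 I1]))) \<rho> (T * (Suc p * 2)) 0 Q1"
  proof (rule run_TabS[where hm = "Suc p"], goal_cases)
    case (10 \<rho>')
    have "\<rho>' ''g'' [j] = test_gen S l j" if "j < T" for j
    proof -
      have "\<rho>' ''g'' [j] = (\<Sum>k<Suc p. \<rho> ''C'' [k, l] * \<rho> ''F'' [k, j - k, k - j])"
        using 10(2)[of j 0 0] that by (simp del: sum.lessThan_Suc)
      also have "\<dots> = (\<Sum>k<Suc p. gram_coeff S k l * (if k \<le> j then gram_prefix S k (j - k) else 0))"
      proof (rule sum.cong[OF refl], goal_cases)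
        case (1 k)
        then show ?case
          using guard_cell(2)[of "\<lambda>g. \<rho> ''F'' [k, j - k, g]" k j] C F lT that by (auto simp: C_array_def F_array_def)
      qed
      finally show ?thesis by (simp add: test_gen_def dims lessThan_Suc_atMost)
    qed
    then show ?case using 10(1) by (simp add: Q1_def)
  qed auto
  have 2: "run member ops ?\<nu> (Tab ''y'' [] N1 N1 N1 (succ_exp PP) N1 (RCell ''C'' [V1, NVar ''l''])) \<rho>1 (Suc p) 0 Q2"
    if Q: "Q1 \<rho>1" for \<rho>1
  proof (rule run_TabS[where hm = "Suc p"], goal_cases)
    case (10 \<rho>')
    have "\<rho>1 ''C'' = \<rho> ''C''" using Q by (auto simp: Q1_def same_off_def)
    then have "\<rho>' ''y'' [] = (\<Sum>k<Suc p. \<rho> ''C'' [k, l])" using 10(2)[of 0 0 0] by (simp del: sum.lessThan_Suc)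
    also have "\<dots> = test_elem S l" using C lT by (simp add: C_array_def test_elem_def dims lessThan_Suc_atMost)
    finally show ?case using 10(1) Q by (auto simp: Q1_def Q2_def same_off_def)
  qed auto
  have 3: "run member ops ?\<nu> (Seq (Member ''b'' (RCell ''y'' []) ''g'' TT ''x'') (NAssign ''b'' N0)) \<rho>2 0 (w T) Q3"
    if Q: "Q2 \<rho>2" for \<rho>2
  proof -
    have gens: "gens \<rho>2 ''g'' T = map (test_gen S l) [0..<T]" using Q by (auto simp: gens_def Q2_def)
    have val: "rval (RCell ''y'' []) ?\<nu> \<rho>2 = test_elem S l" using Q by (simp add: Q2_def)
    have x: "\<rho>2 ''x'' = \<rho> ''x''" using Q by (auto simp: Q2_def same_off_def)
    have "run member ops ?\<nu> (Seq (Member ''b'' (RCell ''y'' []) ''g'' TT ''x'') (NAssign ''b'' N0)) \<rho>2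
      (arith_ops (RCell ''y'' [])) (w T) Q3"
    proof (rule run_Member[where n = T], unfold gens val, goal_cases)
      case 1
      show ?case using w[of "test_elem S l" "map (test_gen S l) [0..<T]"] by simp
    next
      case (4 cs)
      then have cs: "length cs = T" "test_elem S l = lin_comb cs (map (test_gen S l) [0..<T])"
        using sd unfolding strongly_discrete_def by (metis (mono_tags, lifting) option.simps(5) length_map diff_zero length_upt)+
      have "X (store_list ''x'' cs \<rho>2)"
        using cs x x0 by (simp add: X_def store_list_def lin_comb_def)
      then show ?case using Q by (auto simp: Q2_def Q3_def same_off_def store_list_def)
    next
      case 5
      then have "test_elem S l \<notin> fg_ideal (map (test_gen S l) [0..<T])"
        using sd unfolding strongly_discrete_def by (metis (mono_tags, lifting) option.simps(4))
      \<comment> \<open>By \<open>test_elem_in_ideal\<close> a negative answer excludes every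
        \<open>B\<close>, so nothing remains to be shown about the answers.\<close>
      then have "\<not> regular B" for B
        using test_elem_in_ideal[OF S, of B l] by (auto simp: regular_def gens_count_T)
      then show ?case using Q x x0 by (auto simp: X_def Q2_def Q3_def same_off_def)
    qed simp_all
    then show ?thesis by simp
  qed
  have 4: "run member ops ?\<nu> (Tab ''e'' [I1] (succ_exp PP) N1 N1 TT N1
      (RMul (RCell ''x'' [NAdd V1 I1]) (RCell ''F'' [I1, V1, N0]))) \<rho>3 (Suc p * (T * 2)) 0 Q4"
    if Q: "Q3 \<rho>3" for \<rho>3
  proof (rule run_TabS[where hm = T], goal_cases)
    case (10 \<rho>')
    have "\<rho>3 ''F'' = \<rho> ''F''" "\<rho>' ''x'' = \<rho>3 ''x''" using Q 10(1) by (auto simp: Q3_def same_off_def)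
    then have "\<rho>' ''e'' [k] = resp (\<lambda>j. \<rho>' ''x'' [j]) k" if "k \<le> p" for k
      using 10(2)[of k 0 0] that F by (simp add: resp_def F_array_def)
    then show ?case using 10(1) Q by (auto simp: Q3_def Q4_def X_def same_off_def)
  qed auto
  have 5: "run member ops ?\<nu> (Tab ''t'' [I1, I2] (succ_exp PP) TT N1 N1 N1
      (RAdd (RCell ''xi'' [I1, I2]) (RMul (RSub ROne (RCell ''f'' [I1])) (RCell ''x'' [NAdd I2 I1])))) \<rho>4 (Suc p * (T * 4)) 0 Q5"
    if Q: "Q4 \<rho>4" for \<rho>4
  proof (rule run_TabS[where hm = 1], goal_cases)
    case (10 \<rho>')
    have "\<rho>4 ''xi'' = \<rho> ''xi''" "\<rho>4 ''f'' = \<rho> ''f''" "\<rho>' ''x'' = \<rho>4 ''x''" using Q 10(1) by (auto simp: Q4_def same_off_def)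
    then have "\<rho>' ''t'' [k, n] = \<rho> ''xi'' [k, n] + (1 - \<rho> ''f'' [k]) * \<rho>' ''x'' [n + k]" if "k \<le> p" "n < T" for k n
      using 10(2)[of k n 0] that by simp
    then show ?case using 10(1) Q by (auto simp: Q4_def Q5_def X_def same_off_def)
  qed auto
  have 6: "run member ops ?\<nu> (Tab ''xi'' [I1, I2] (succ_exp PP) TT N1 N1 N1 (RCell ''t'' [I1, I2])) \<rho>5 (Suc p * T) 0 Q6"
    if Q: "Q5 \<rho>5" for \<rho>5
  proof (rule run_TabS[where hm = 1], goal_cases)
    case (10 \<rho>')
    have "\<rho>' ''x'' = \<rho>5 ''x''" using 10(1) by (auto simp: same_off_def)
    then have "\<rho>' ''xi'' [k, n] = \<rho> ''xi'' [k, n] + (1 - \<rho> ''f'' [k]) * \<rho>' ''x'' [n + k]" if "k \<le> p" "n < T" for k n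
      using 10(2)[of k n 0] that Q by (simp add: Q5_def)
    then show ?case using 10(1) Q by (auto simp: Q5_def Q6_def X_def same_off_def)
  qed auto
  have 7: "run member ops ?\<nu> (Tab ''t'' [I1] (succ_exp PP) N1 N1 N1 N1
      (RAdd (RCell ''f'' [I1]) (RMul (RSub ROne (RCell ''f'' [I1])) (RCell ''e'' [I1])))) \<rho>6 (Suc p * 4) 0 Q7"
    if Q: "Q6 \<rho>6" for \<rho>6
  proof (rule run_TabS[where hm = 1], goal_cases)
    case (10 \<rho>')
    have "\<rho>6 ''f'' = \<rho> ''f''" "\<rho>' ''x'' = \<rho>6 ''x''" using Q 10(1) by (auto simp: Q6_def same_off_def)
    then have "\<rho>' ''t'' [k] = \<rho> ''f'' [k] + (1 - \<rho> ''f'' [k]) * resp (\<lambda>j. \<rho>' ''x'' [j]) k" if "k \<le> p" for k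
      using 10(2)[of k 0 0] that Q by (simp add: Q6_def)
    then show ?case using 10(1) Q by (auto simp: Q6_def Q7_def X_def same_off_def)
  qed auto
  have 8: "run member ops ?\<nu> (Tab ''f'' [I1] (succ_exp PP) N1 N1 N1 N1 (RCell ''t'' [I1])) \<rho>7 (Suc p) 0
    (\<lambda>\<rho>'. same_off test_off \<rho> \<rho>' \<and> (\<forall>j\<ge>T. \<rho>' ''x'' [j] = 0) \<and> (\<forall>B. regular B \<longrightarrow> (\<exists>x. tested (Suc l) x \<rho>')))"
    if Q: "Q7 \<rho>7" for \<rho>7
  proof (rule run_TabS[where hm = 1], goal_cases)
    case (10 \<rho>')
    have x: "\<rho>' ''x'' = \<rho>7 ''x''" and xi: "\<rho>' ''xi'' = \<rho>7 ''xi''" using 10(1) by (auto simp: same_off_def)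
    then have f: "\<rho>' ''f'' [k] = \<rho> ''f'' [k] + (1 - \<rho> ''f'' [k]) * resp (\<lambda>j. \<rho>' ''x'' [j]) k" if "k \<le> p" for k
      using 10(2)[of k 0 0] that Q by (simp add: Q7_def)
    have "\<exists>x. tested (Suc l) x \<rho>'" if reg: "regular B" for B
    proof -
      obtain x where "tested l x \<rho>" using tested[OF reg] by blast
      from tested_step[OF this, of "\<lambda>j. \<rho>' ''x'' [j]" \<rho>'] show ?thesis
        using Q f reg x xi unfolding Q7_def X_def resp_def by auto
    qed
    then show ?case using 10(1) Q x by (auto simp: Q7_def X_def same_off_def test_off_def)
  qed auto
  show ?thesis
    unfolding test_step_prog_def
    by (rule run_weaken[OF run_Seq[OF 1 run_Seq[OF 2 run_Seq[OF 3 run_Seq[OF 4 run_Seq[OF 5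
          run_Seq[OF 6 run_Seq[OF 7 8]]]]]]]], assumption+)
       (auto simp: test_cost_def)
qed

lemma test_prog_run:
  assumes C: "C_array \<rho>" and F: "F_array \<rho>"
    and 0: "\<rho> ''x'' = (\<lambda>_. 0)" "\<rho> ''f'' = (\<lambda>_. 0)" "\<rho> ''xi'' = (\<lambda>_. 0)"
  shows "run member ops \<nu> test_prog \<rho> (Suc (2 * (p + q) * p) * test_cost) (real (Suc (2 * (p + q) * p)) * w T)
    (\<lambda>\<rho>'. same_off test_off \<rho> \<rho>' \<and> (\<forall>B. regular B \<longrightarrow> (\<exists>x. tested (Suc (2 * (p + q) * p)) x \<rho>')))"
proof -
  let ?L = "2 * (p + q) * p"
  let ?I = "\<lambda>h \<rho>'. same_off test_off \<rho> \<rho>' \<and> (\<forall>j\<ge>T. \<rho>' ''x'' [j] = 0) \<and> (\<forall>B. regular B \<longrightarrow> (\<exists>x. tested h x \<rho>'))"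
  have "run member ops \<nu> test_prog \<rho> (Suc ?L * test_cost) (real (Suc ?L) * w T) (?I (Suc ?L))"
    unfolding test_prog_def
  proof (rule run_For[where I = ?I])
    fix l \<rho>1 assume "l < Suc ?L" and I: "?I l \<rho>1"
    then have l: "l \<le> ?L" by simp
    have "C_array \<rho>1" "F_array \<rho>1" using C F I by (auto simp: C_array_def F_array_def same_off_def test_off_def)
    from test_step_run[OF l this] I
    show "run member ops (\<nu>(''l'' := l)) test_step_prog \<rho>1 test_cost (w T) (?I (Suc l))"
      by (intro run_weaken[OF test_step_run[OF l \<open>C_array \<rho>1\<close> \<open>F_array \<rho>1\<close>]]) (auto simp: same_off_def)
  next
    have "tested 0 (\<lambda>_ _. 0) \<rho>" by (simp add: tested_def 0)
    then show "?I 0 \<rho>" using 0 by (auto simp: same_off_def)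
  qed auto
  then show ?thesis by (rule run_weaken) auto
qed

lemma member_Some: "member y xs = Some cs \<Longrightarrow> length cs = length xs \<and> y = lin_comb cs xs"
  using sd unfolding strongly_discrete_def by (metis (mono_tags, lifting) option.simps(5))

lemma member_None: "member y xs = None \<Longrightarrow> y \<notin> fg_ideal xs"
  using sd unfolding strongly_discrete_def by (metis (mono_tags, lifting) option.simps(4))

abbreviation "L \<equiv> 2 * (p + q) * p"
abbreviation "idem B \<equiv> coeff (corank_poly (S * B))"

lemma tested_facts:
  assumes B: "regular B" and t: "tested (Suc L) x \<rho>"
  shows "k \<le> p \<Longrightarrow> \<rho> ''f'' [k] * (1 - (\<Sum>j<k. idem B j)) = idem B k * \<rho> ''f'' [k]"
    and "k \<le> p \<Longrightarrow> \<exists>c. idem B k * \<rho> ''f'' [k] = c * (idem B k * \<rho> ''f'' [k] * (idem B k * \<rho> ''f'' [k]))"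
    and "k \<le> p \<Longrightarrow> idem B k * \<rho> ''f'' [k] = c * (idem B k * \<rho> ''f'' [k] * (idem B k * \<rho> ''f'' [k])) \<Longrightarrow>
      idem B k * \<rho> ''f'' [k] * c = idem B k"
    and "(\<And>k. k \<le> p \<Longrightarrow> idem B k * \<rho> ''f'' [k] * z k = idem B k) \<Longrightarrow> i < p \<Longrightarrow> v < q \<Longrightarrow>
      (\<Sum>u<q. \<Sum>j<p. S $$ (i, u) * (\<Sum>k\<le>p. idem B k * z k * (\<Sum>n<T. \<rho> ''xi'' [k, n] * partial_inverse S k n u j)) * S $$ (j, v))
      = S $$ (i, v)"
proof -
  have BS: "B \<in> carrier_mat q p" "S * B * S = S" using B by (auto simp: regular_def)
  have h: "max_height S = L" by (simp add: max_height_def gram_weight_def dims)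
  have x: "test_elem S l = (\<Sum>j<gens_count S. x l j * test_gen S l j)" if "l \<le> max_height S" for l
    using t that by (simp add: tested_def gens_count_T h)
  have x0: "x l j = 0" if "j \<ge> gens_count S" for l j using t that by (simp add: tested_def gens_count_T)
  have f: "1 - \<rho> ''f'' [k] = (\<Prod>l\<le>max_height S. 1 - response S x l k)" if "k \<le> p" for k
    unfolding h lessThan_Suc_atMost[symmetric] using t that unfolding tested_def by blast
  have xi: "\<rho> ''f'' [k] = (\<Sum>n<gens_count S. \<rho> ''xi'' [k, n] * gram_prefix S k n)" if "k \<le> p" for k
    unfolding gens_count_T using t that unfolding tested_def by blast
  show "k \<le> p \<Longrightarrow> \<rho> ''f'' [k] * (1 - (\<Sum>j<k. idem B j)) = idem B k * \<rho> ''f'' [k]"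
    by (rule residual_eq[OF S BS x x0 f xi])
  show "k \<le> p \<Longrightarrow> \<exists>c. idem B k * \<rho> ''f'' [k] = c * (idem B k * \<rho> ''f'' [k] * (idem B k * \<rho> ''f'' [k]))"
    by (rule residual_in_square[OF S BS x x0 f xi])
  show "k \<le> p \<Longrightarrow> idem B k * \<rho> ''f'' [k] = c * (idem B k * \<rho> ''f'' [k] * (idem B k * \<rho> ''f'' [k])) \<Longrightarrow>
      idem B k * \<rho> ''f'' [k] * c = idem B k"
    by (rule residual_idempotent[OF S BS x x0 f xi])
  show "(\<And>k. k \<le> p \<Longrightarrow> idem B k * \<rho> ''f'' [k] * z k = idem B k) \<Longrightarrow> i < p \<Longrightarrow> v < q \<Longrightarrow>
      (\<Sum>u<q. \<Sum>j<p. S $$ (i, u) * (\<Sum>k\<le>p. idem B k * z k * (\<Sum>n<T. \<rho> ''xi'' [k, n] * partial_inverse S k n u j)) * S $$ (j, v))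
      = S $$ (i, v)"
    using assembled_inverse[OF S BS x x0 f xi, of z i v] unfolding gens_count_T by blast
qed

section \<open>Recovering the rank idempotents and assembling the inverse\<close>

definition split_upto :: "'a mat \<Rightarrow> nat \<Rightarrow> 'a rstore \<Rightarrow> bool" where
  "split_upto B h \<rho> \<longleftrightarrow> \<rho> ''s'' [] = (\<Sum>j<h. idem B j)
    \<and> (\<exists>z. \<forall>j<h. idem B j * \<rho> ''f'' [j] * z j = idem B j \<and> \<rho> ''ze'' [j] = idem B j * z j)"

definition split_off :: "vname set" where
  "split_off = {''v'', ''g'', ''z'', ''d'', ''ze'', ''t'', ''s'', ''acc''}"

lemma split_step_run:
  assumes k: "k \<le> p"
    and split: "\<And>B. regular B \<Longrightarrow> (\<exists>x. tested (Suc L) x \<rho>) \<and> split_upto B k \<rho>"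
  shows "run member ops (\<nu>(''k'' := k)) split_step_prog \<rho> 12 (w 1)
    (\<lambda>\<rho>'. same_off split_off \<rho> \<rho>' \<and> (\<forall>B. regular B \<longrightarrow> split_upto B (Suc k) \<rho>'))"
proof -
  let ?\<nu> = "\<nu>(''k'' := k)"
  define v where "v = \<rho> ''f'' [k] * (1 - \<rho> ''s'' [])"
  \<comment> \<open>If \<open>v\<close> is not a multiple of its square, the test fails,
    \<open>z\<close> keeps its old content, and any value is accepted: by
    \<open>tested_facts\<close> no \<open>B\<close> is regular then.\<close>
  define Z where "Z c \<longleftrightarrow> ((\<exists>c. v = c * (v * v)) \<longrightarrow> v = c * (v * v))" for c
  define Q1 where "Q1 \<rho>' \<longleftrightarrow> same_off {''v'', ''acc''} \<rho> \<rho>' \<and> \<rho>' ''v'' [] = v" for \<rho>' :: "'a rstore"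
  define Q2 where "Q2 \<rho>' \<longleftrightarrow> same_off {''v'', ''g'', ''acc''} \<rho> \<rho>' \<and> \<rho>' ''v'' [] = v \<and> \<rho>' ''g'' [0] = v * v" for \<rho>' :: "'a rstore"
  define Q3 where "Q3 \<rho>' \<longleftrightarrow> same_off {''v'', ''g'', ''z'', ''acc''} \<rho> \<rho>' \<and> \<rho>' ''v'' [] = v \<and> Z (\<rho>' ''z'' [0])" for \<rho>' :: "'a rstore"
  define Q4 where "Q4 \<rho>' \<longleftrightarrow> same_off {''v'', ''g'', ''z'', ''d'', ''acc''} \<rho> \<rho>' \<and> Z (\<rho>' ''z'' [0])
    \<and> \<rho>' ''d'' [] = v * \<rho>' ''z'' [0]" for \<rho>' :: "'a rstore"
  define E where "E \<rho>' \<longleftrightarrow> (\<exists>c. Z c \<and> \<rho>' ''d'' [] = v * c \<and> \<rho>' ''ze'' [k] = v * c * c) \<and> (\<forall>j. j \<noteq> k \<longrightarrow> \<rho>' ''ze'' [j] = \<rho> ''ze'' [j])"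
    for \<rho>' :: "'a rstore"
  define Q5 where "Q5 \<rho>' \<longleftrightarrow> same_off {''v'', ''g'', ''z'', ''d'', ''ze'', ''acc''} \<rho> \<rho>' \<and> E \<rho>'" for \<rho>' :: "'a rstore"
  define Q6 where "Q6 \<rho>' \<longleftrightarrow> same_off {''v'', ''g'', ''z'', ''d'', ''ze'', ''t'', ''acc''} \<rho> \<rho>' \<and> E \<rho>'
    \<and> \<rho>' ''t'' [] = \<rho> ''s'' [] + \<rho>' ''d'' []" for \<rho>' :: "'a rstore"
  have 1: "run member ops ?\<nu> (Tab ''v'' [] N1 N1 N1 N1 N1 (RMul (RCell ''f'' [KK]) (RSub ROne (RCell ''s'' [])))) \<rho> 3 0 Q1"
  proof (rule run_TabS[where hm = 1], goal_cases)
    case (10 \<rho>')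
    then show ?case using 10(2)[of 0 0 0] by (simp add: Q1_def v_def)
  qed auto
  have 2: "run member ops ?\<nu> (Tab ''g'' [I1] N1 N1 N1 N1 N1 (RMul (RCell ''v'' []) (RCell ''v'' []))) \<rho>1 2 0 Q2" if "Q1 \<rho>1" for \<rho>1
  proof (rule run_TabS[where hm = 1], goal_cases)
    case (10 \<rho>')
    then show ?case using 10(2)[of 0 0 0] that by (auto simp: Q1_def Q2_def same_off_def)
  qed auto
  have 3: "run member ops ?\<nu> (Seq (Member ''b'' (RCell ''v'' []) ''g'' N1 ''z'') (NAssign ''b'' N0)) \<rho>2 0 (w 1) Q3" if Q: "Q2 \<rho>2" for \<rho>2
  proof -
    have gens: "gens \<rho>2 ''g'' 1 = [v * v]" and val: "rval (RCell ''v'' []) ?\<nu> \<rho>2 = v" using Q by (auto simp: gens_def Q2_def)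
    have "run member ops ?\<nu> (Seq (Member ''b'' (RCell ''v'' []) ''g'' N1 ''z'') (NAssign ''b'' N0)) \<rho>2
      (arith_ops (RCell ''v'' [])) (w 1) Q3"
    proof (rule run_Member[where n = 1], unfold gens val, goal_cases)
      case 1
      show ?case using w[of v "[v * v]"] by simp
    next
      case (4 cs)
      then have "length cs = 1" "v = lin_comb cs [v * v]" using member_Some by fastforce+
      then obtain c where "cs = [c]" "v = c * (v * v)" by (cases cs) (auto simp: lin_comb_def)
      then show ?case using Q by (auto simp: Q2_def Q3_def Z_def same_off_def store_list_def)
    next
      case 5
      then have "v \<notin> fg_ideal [v * v]" by (rule member_None)
      then have "v \<noteq> c * (v * v)" for c by (auto simp: fg_ideal_iff dest: spec[of _ "\<lambda>_. c"])
      then have "Z c" for c unfolding Z_def by blast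
      then show ?case using Q by (auto simp: Q2_def Q3_def same_off_def)
    qed simp_all
    then show ?thesis by simp
  qed
  have 4: "run member ops ?\<nu> (Tab ''d'' [] N1 N1 N1 N1 N1 (RMul (RCell ''v'' []) (RCell ''z'' [N0]))) \<rho>3 2 0 Q4" if "Q3 \<rho>3" for \<rho>3
  proof (rule run_TabS[where hm = 1], goal_cases)
    case (10 \<rho>')
    then show ?case using 10(2)[of 0 0 0] that by (auto simp: Q3_def Q4_def same_off_def)
  qed auto
  have 5: "run member ops ?\<nu> (Tab ''ze'' [KK] N1 N1 N1 N1 N1 (RMul (RCell ''d'' []) (RCell ''z'' [N0]))) \<rho>4 2 0 Q5" if Q: "Q4 \<rho>4" for \<rho>4
  proof (rule run_TabS[where hm = 1], goal_cases)
    case (10 \<rho>')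
    have "\<rho>' ''ze'' [j] = \<rho> ''ze'' [j]" if "j \<noteq> k" for j
      using 10(3)[of "[j]"] that Q by (auto simp: Q4_def same_off_def)
    moreover have "\<rho>' ''ze'' [k] = v * \<rho>4 ''z'' [0] * \<rho>4 ''z'' [0]" "\<rho>' ''d'' = \<rho>4 ''d''"
      using 10(1) 10(2)[of 0 0 0] Q by (auto simp: Q4_def same_off_def)
    ultimately show ?case using 10(1) Q by (auto simp: Q4_def Q5_def E_def same_off_def)
  qed auto
  have 6: "run member ops ?\<nu> (Tab ''t'' [] N1 N1 N1 N1 N1 (RAdd (RCell ''s'' []) (RCell ''d'' []))) \<rho>5 2 0 Q6" if Q: "Q5 \<rho>5" for \<rho>5
  proof (rule run_TabS[where hm = 1], goal_cases)
    case (10 \<rho>')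
    then show ?case using 10(2)[of 0 0 0] Q by (auto simp: Q5_def Q6_def E_def same_off_def)
  qed auto
  have 7: "run member ops ?\<nu> (Tab ''s'' [] N1 N1 N1 N1 N1 (RCell ''t'' [])) \<rho>6 1 0
    (\<lambda>\<rho>'. same_off split_off \<rho> \<rho>' \<and> (\<forall>B. regular B \<longrightarrow> split_upto B (Suc k) \<rho>'))" if Q: "Q6 \<rho>6" for \<rho>6
  proof (rule run_TabS[where hm = 1], goal_cases)
    case (10 \<rho>')
    obtain c where c: "Z c" "\<rho>6 ''d'' [] = v * c" "\<rho>6 ''ze'' [k] = v * c * c" using Q by (auto simp: Q6_def E_def)
    have s: "\<rho>' ''s'' [] = \<rho> ''s'' [] + v * c" using 10(2)[of 0 0 0] Q c by (simp add: Q6_def)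
    have ze: "\<rho>' ''ze'' = \<rho>6 ''ze''" and f: "\<rho>' ''f'' = \<rho> ''f''" using 10(1) Q by (auto simp: Q6_def same_off_def)
    have "split_upto B (Suc k) \<rho>'" if B: "regular B" for B
    proof -
      obtain x where x: "tested (Suc L) x \<rho>" using split[OF B] by blast
      obtain z where z: "\<And>j. j < k \<Longrightarrow> idem B j * \<rho> ''f'' [j] * z j = idem B j \<and> \<rho> ''ze'' [j] = idem B j * z j"
        and sk: "\<rho> ''s'' [] = (\<Sum>j<k. idem B j)"
        using split[OF B] by (auto simp: split_upto_def)
      have v: "v = idem B k * \<rho> ''f'' [k]" unfolding v_def sk by (rule tested_facts(1)[OF B x k])
      have "v = c * (v * v)" using c(1) tested_facts(2)[OF B x k] unfolding Z_def v by blast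
      then have vc: "v * c = idem B k" using tested_facts(3)[OF B x k, of c] unfolding v by blast
      show ?thesis
        unfolding split_upto_def
      proof (intro conjI exI[of _ "z(k := c)"] allI impI)
        show "\<rho>' ''s'' [] = (\<Sum>j<Suc k. idem B j)" by (simp add: s sk vc)
        fix j assume "j < Suc k"
        then consider "j < k" | "j = k" by linarith
        then show "idem B j * \<rho>' ''f'' [j] * (z(k := c)) j = idem B j"
          by cases (use z vc v in \<open>auto simp: f\<close>)
        show "\<rho>' ''ze'' [j] = idem B j * (z(k := c)) j"
          using \<open>j < Suc k\<close> z[of j] Q c(3) vc by (cases "j = k") (auto simp: ze Q6_def E_def)
      qed
    qed
    then show ?case using 10(1) Q by (auto simp: Q6_def same_off_def split_off_def)
  qed auto
  show ?thesis
    unfolding split_step_prog_def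
    by (rule run_weaken[OF run_Seq[OF 1 run_Seq[OF 2 run_Seq[OF 3 run_Seq[OF 4 run_Seq[OF 5 run_Seq[OF 6 7]]]]]]], assumption+)
       auto
qed

lemma split_prog_run:
  assumes tested: "\<And>B. regular B \<Longrightarrow> \<exists>x. tested (Suc L) x \<rho>" and s: "\<rho> ''s'' = (\<lambda>_. 0)"
  shows "run member ops \<nu> split_prog \<rho> (Suc p * 12) (real (Suc p) * w 1)
    (\<lambda>\<rho>'. same_off split_off \<rho> \<rho>' \<and> (\<forall>B. regular B \<longrightarrow> (\<exists>x. tested (Suc L) x \<rho>') \<and> split_upto B (Suc p) \<rho>'))"
proof -
  have keep: "tested h x \<rho>'" if "tested h x \<rho>" "same_off split_off \<rho> \<rho>'" for h x \<rho>'
  proof -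
    have eq: "\<rho>' ''f'' = \<rho> ''f''" "\<rho>' ''xi'' = \<rho> ''xi''" using that(2) by (auto simp: same_off_def split_off_def)
    show ?thesis using that(1) unfolding tested_def eq .
  qed
  let ?I = "\<lambda>h \<rho>'. same_off split_off \<rho> \<rho>' \<and> (\<forall>B. regular B \<longrightarrow> split_upto B h \<rho>')"
  have "run member ops \<nu> split_prog \<rho> (Suc p * 12) (real (Suc p) * w 1) (?I (Suc p))"
    unfolding split_prog_def
  proof (rule run_For[where I = ?I])
    fix k \<rho>1 assume "k < Suc p" and I: "?I k \<rho>1"
    then have k: "k \<le> p" by simp
    have ex: "\<exists>x. tested (Suc L) x \<rho>1" if "regular B" for B using tested[OF that] keep I by blast
    show "run member ops (\<nu>(''k'' := k)) split_step_prog \<rho>1 12 (w 1) (?I (Suc k))"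
      by (rule run_weaken[OF split_step_run[OF k]]) (use I ex in \<open>auto simp: same_off_def\<close>)
  qed (use s in \<open>auto simp: same_off_def split_upto_def\<close>)
  then show ?thesis by (rule run_weaken) (use tested keep in blast)+
qed

text \<open>Merges the two nested comparisons into one, as the program reads them through a single
  guard of \<open>D\<close>.\<close>

lemma partial_inverse_alt:
  assumes "u < q"
  shows "partial_inverse S k n u j = - (\<Sum>i<p. S $$ (i, u) *
    (if 2 * (p + q) * k + 2 * (u + i) \<le> n then fps_nth (adj_coeff (gram S) k i j) (n - (2 * (p + q) * k + 2 * (u + i))) else 0))"
proof (cases "2 * (p + q) * k \<le> n")
  case True
  then show ?thesis
    unfolding partial_inverse_def gram_weight_def dims
    by (auto intro!: sum.cong simp: algebra_simps)
next
  case False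
  then show ?thesis unfolding partial_inverse_def gram_weight_def dims by (auto intro!: sum.neutral)
qed

lemma inverse_prog_run:
  assumes SA: "S_array \<rho>" and D: "D_array 0 \<rho>"
    and split: "\<And>B. regular B \<Longrightarrow> (\<exists>x. tested (Suc L) x \<rho>) \<and> split_upto B (Suc p) \<rho>"
  shows "run member ops \<nu> inverse_prog \<rho> (Suc p * (q * (p * (T * p * 3))) + q * (p * (Suc p * 3))) 0
    (\<lambda>\<rho>'. same_off {''Z'', ''X'', ''acc''} \<rho> \<rho>' \<and> (\<forall>B. regular B \<longrightarrow>
       (\<forall>i<p. \<forall>v<q. (\<Sum>u<q. \<Sum>j<p. S $$ (i, u) * \<rho>' ''X'' [u, j] * S $$ (j, v)) = S $$ (i, v))))"
proof -
  define Q where "Q \<rho>' \<longleftrightarrow> same_off {''Z'', ''acc''} \<rho> \<rho>' \<and> (\<forall>k\<le>p. \<forall>u<q. \<forall>j<p.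
    \<rho>' ''Z'' [k, u, j] = - (\<Sum>n<T. \<rho> ''xi'' [k, n] * partial_inverse S k n u j))" for \<rho>' :: "'a rstore"
  have 1: "run member ops \<nu> (Tab ''Z'' [I1, I2, I3] (succ_exp PP) QQ PP TT PP
       (RMul (RCell ''xi'' [I1, V1]) (RMul (RCell ''S'' [V2, I2, N0])
         (RCell ''D'' [I1, V2, I3, NSub V1 (NAdd (NMul (NVar ''c'') I1) (NMul (NConst 2) (NAdd I2 V2))),
           NSub (NAdd (NMul (NVar ''c'') I1) (NMul (NConst 2) (NAdd I2 V2))) V1])))) \<rho>
       (Suc p * (q * (p * (T * p * 3)))) 0 Q"
  proof (rule run_TabS[where hm = "T * p"], goal_cases)
    case (10 \<rho>')
    have "\<rho>' ''Z'' [k, u, j] = - (\<Sum>n<T. \<rho> ''xi'' [k, n] * partial_inverse S k n u j)"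
      if "k \<le> p" "u < q" "j < p" for k u j
    proof -
      let ?o = "\<lambda>i. 2 * (p + q) * k + 2 * (u + i)"
      have "\<rho>' ''Z'' [k, u, j] = (\<Sum>n<T. \<Sum>i<p. \<rho> ''xi'' [k, n] * (\<rho> ''S'' [i, u, 0] * \<rho> ''D'' [k, i, j, n - ?o i, ?o i - n]))"
        using 10(2)[of k u j] that by simp
      also have "\<dots> = (\<Sum>n<T. \<Sum>i<p. \<rho> ''xi'' [k, n] * (S $$ (i, u) *
          (if ?o i \<le> n then fps_nth (adj_coeff (gram S) k i j) (n - ?o i) else 0)))"
      proof (intro sum.cong refl, goal_cases)
        case (1 n i)
        then have "\<rho> ''D'' [k, i, j, n - ?o i, ?o i - n] = (if ?o i \<le> n then \<rho> ''D'' [k, i, j, n - ?o i, 0] else 0)"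
          using guard_cell(2)[of "\<lambda>g. \<rho> ''D'' [k, i, j, n - ?o i, g]" "?o i" n] D by (auto simp: D_array_def)
        moreover have "n - ?o i < T" using 1 by simp
        then have "\<rho> ''D'' [k, i, j, n - ?o i, 0] = fps_nth (adj_coeff (gram S) k i j) (n - ?o i)"
          using 1 that D unfolding D_array_def by blast
        moreover have "\<rho> ''S'' [i, u, 0] = S $$ (i, u)" using 1 that SA by (simp add: S_array_def)
        ultimately show ?case by (simp only:)
      qed
      also have "\<dots> = - (\<Sum>n<T. \<rho> ''xi'' [k, n] * partial_inverse S k n u j)"
        unfolding partial_inverse_alt[OF that(2)] by (simp add: sum_distrib_left sum_negf)
      finally show ?thesis .
    qed
    then show ?case using 10(1) by (simp add: Q_def)
  qed (auto simp: algebra_simps)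
  have 2: "run member ops \<nu> (Tab ''X'' [I1, I2] QQ PP N1 (succ_exp PP) N1
       (RSub RZero (RMul (RCell ''ze'' [V1]) (RCell ''Z'' [V1, I1, I2])))) \<rho>1 (q * (p * (Suc p * 3))) 0
    (\<lambda>\<rho>'. same_off {''Z'', ''X'', ''acc''} \<rho> \<rho>' \<and> (\<forall>B. regular B \<longrightarrow>
       (\<forall>i<p. \<forall>v<q. (\<Sum>u<q. \<Sum>j<p. S $$ (i, u) * \<rho>' ''X'' [u, j] * S $$ (j, v)) = S $$ (i, v))))"
    if Q: "Q \<rho>1" for \<rho>1
  proof (rule run_TabS[where hm = "Suc p"], goal_cases)
    case (10 \<rho>')
    have ze: "\<rho>1 ''ze'' = \<rho> ''ze''" using Q by (auto simp: Q_def same_off_def)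
    have X: "\<rho>' ''X'' [u, j] = (\<Sum>k\<le>p. \<rho> ''ze'' [k] * (\<Sum>n<T. \<rho> ''xi'' [k, n] * partial_inverse S k n u j))"
      if "u < q" "j < p" for u j
    proof -
      have "\<rho>' ''X'' [u, j] = (\<Sum>k<Suc p. 0 - \<rho> ''ze'' [k] * \<rho>1 ''Z'' [k, u, j])"
        using 10(2)[of u j 0] that by (simp add: ze del: sum.lessThan_Suc)
      then show ?thesis using Q that by (simp add: Q_def lessThan_Suc_atMost)
    qed
    have "(\<Sum>u<q. \<Sum>j<p. S $$ (i, u) * \<rho>' ''X'' [u, j] * S $$ (j, v)) = S $$ (i, v)"
      if B: "regular B" and iv: "i < p" "v < q" for B i v
    proof -
      obtain x where x: "tested (Suc L) x \<rho>" using split[OF B] by blast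
      obtain z where z: "\<And>k. k \<le> p \<Longrightarrow> idem B k * \<rho> ''f'' [k] * z k = idem B k \<and> \<rho> ''ze'' [k] = idem B k * z k"
        using split[OF B] by (auto simp: split_upto_def less_Suc_eq_le)
      have "(\<Sum>u<q. \<Sum>j<p. S $$ (i, u) * \<rho>' ''X'' [u, j] * S $$ (j, v))
        = (\<Sum>u<q. \<Sum>j<p. S $$ (i, u) * (\<Sum>k\<le>p. idem B k * z k * (\<Sum>n<T. \<rho> ''xi'' [k, n] * partial_inverse S k n u j)) * S $$ (j, v))"
        using z by (intro sum.cong refl arg_cong2[of _ _ _ _ "(*)"]) (simp_all add: X)
      also have "\<dots> = S $$ (i, v)" using tested_facts(4)[OF B x _ iv, of z] z by blast
      finally show ?thesis .
    qed
    then show ?case using 10(1) Q by (auto simp: Q_def same_off_def)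
  qed (auto simp: algebra_simps)
  show ?thesis unfolding inverse_prog_def by (rule run_Seq'[OF 1 2]) auto
qed

section \<open>Matrix products, and the check of the computed matrix\<close>

definition mat_array :: "vname \<Rightarrow> 'a mat \<Rightarrow> 'a rstore \<Rightarrow> bool" where
  "mat_array Z M \<rho> \<longleftrightarrow> (\<forall>i<dim_row M. \<forall>j<dim_col M. \<rho> Z [i, j] = M $$ (i, j))"

lemma product_run:
  assumes Z: "Z \<notin> {''acc''} \<union> arrays r1 \<union> arrays r2" "''acc'' \<notin> arrays r1 \<union> arrays r2"
    and abc: "{a, b, c} \<subseteq> {''p'', ''q''}" and ops0: "arith_ops r1 = 0" "arith_ops r2 = 0"
    and M: "M \<in> carrier_mat (\<nu> a) (\<nu> b)" and N: "N \<in> carrier_mat (\<nu> b) (\<nu> c)"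
    and r1: "\<And>i j u. i < \<nu> a \<Longrightarrow> u < \<nu> b \<Longrightarrow>
      rval r1 (\<nu>(''i1'' := i, ''i2'' := j, ''i3'' := 0, ''v1'' := u, ''v2'' := 0)) \<rho> = M $$ (i, u)"
    and r2: "\<And>i j u. u < \<nu> b \<Longrightarrow> j < \<nu> c \<Longrightarrow>
      rval r2 (\<nu>(''i1'' := i, ''i2'' := j, ''i3'' := 0, ''v1'' := u, ''v2'' := 0)) \<rho> = N $$ (u, j)"
  shows "run member ops \<nu> (Tab Z [I1, I2] (NVar a) (NVar c) N1 (NVar b) N1 (RMul r1 r2)) \<rho> (\<nu> a * (\<nu> c * (\<nu> b * 2))) 0
    (\<lambda>\<rho>'. same_off {Z, ''acc''} \<rho> \<rho>' \<and> mat_array Z (M * N) \<rho>')"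
proof (rule run_TabS[where hm = "\<nu> b"], goal_cases)
  case (10 \<rho>')
  have b: "b \<notin> {''i1'', ''i2'', ''i3'', ''v1'', ''v2''}" using abc by auto
  have "\<rho>' Z [i, j] = (M * N) $$ (i, j)" if "i < \<nu> a" "j < \<nu> c" for i j
    using 10(2)[of i j 0] that r1 r2 b mult_mat_entry[OF M N that] by simp
  then show ?case using 10(1) M N by (simp add: mat_array_def)
qed (use Z abc ops0 in auto)

end

definition core_prog :: com where
  "core_prog = Seq gram_prog (Seq char_prog (Seq adj_prog (Seq coeff_prog
     (Seq test_prog (Seq split_prog (Seq inverse_prog products_prog))))))"

definition zero_test :: "rexp \<Rightarrow> com" where
  "zero_test r = Seq (Member ''b'' r ''g'' N0 ''x'') (Seq (RAssign ''found'' [NVar ''b''] ROne) (NAssign ''b'' N0))"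

text \<open>
  The answers 0 and 1 of the zero tests are collected by setting \<open>found[0]\<close> and \<open>found[1]\<close> to 1. Hence
  \<open>found[0] = 0\<close> means that no test failed, in the zero ring too.
\<close>

definition check_prog :: com where
  "check_prog = For ''i1'' PP (For ''i2'' QQ (zero_test (RSub (RCell ''SXS'' [I1, I2]) (RCell ''S'' [I1, I2, N0]))))"

context matrix_program
begin

lemma product_S_left:
  assumes SA: "S_array \<rho>" and N: "N \<in> carrier_mat q (\<nu> c)" "mat_array Y N \<rho>"
    and c: "c \<in> {''p'', ''q''}" and Z: "Z \<notin> {''acc'', ''S'', Y}" "Y \<noteq> ''acc''"
  shows "run member ops \<nu> (Tab Z [I1, I2] PP (NVar c) N1 QQ N1 (RMul (RCell ''S'' [I1, V1, N0]) (RCell Y [V1, I2]))) \<rho> (p * (\<nu> c * (q * 2))) 0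
    (\<lambda>\<rho>'. same_off {Z, ''acc''} \<rho> \<rho>' \<and> mat_array Z (S * N) \<rho>')"
proof -
  have "run member ops \<nu> (Tab Z [I1, I2] PP (NVar c) N1 QQ N1 (RMul (RCell ''S'' [I1, V1, N0]) (RCell Y [V1, I2]))) \<rho> (\<nu> ''p'' * (\<nu> c * (\<nu> ''q'' * 2))) 0
    (\<lambda>\<rho>'. same_off {Z, ''acc''} \<rho> \<rho>' \<and> mat_array Z (S * N) \<rho>')"
    by (rule product_run) (use assms S in \<open>auto simp: S_array_def mat_array_def\<close>)
  then show ?thesis by simp
qed

lemma product_S_right:
  assumes SA: "S_array \<rho>" and N: "N \<in> carrier_mat (\<nu> a) p" "mat_array Y N \<rho>"
    and a: "a \<in> {''p'', ''q''}" and Z: "Z \<notin> {''acc'', ''S'', Y}" "Y \<noteq> ''acc''"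
  shows "run member ops \<nu> (Tab Z [I1, I2] (NVar a) QQ N1 PP N1 (RMul (RCell Y [I1, V1]) (RCell ''S'' [V1, I2, N0]))) \<rho> (\<nu> a * (q * (p * 2))) 0
    (\<lambda>\<rho>'. same_off {Z, ''acc''} \<rho> \<rho>' \<and> mat_array Z (N * S) \<rho>')"
proof -
  have "run member ops \<nu> (Tab Z [I1, I2] (NVar a) QQ N1 PP N1 (RMul (RCell Y [I1, V1]) (RCell ''S'' [V1, I2, N0]))) \<rho> (\<nu> a * (\<nu> ''q'' * (\<nu> ''p'' * 2))) 0
    (\<lambda>\<rho>'. same_off {Z, ''acc''} \<rho> \<rho>' \<and> mat_array Z (N * S) \<rho>')"
    by (rule product_run) (use assms S in \<open>auto simp: S_array_def mat_array_def\<close>)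
  then show ?thesis by simp
qed

definition products_off :: "vname set" where
  "products_off = {''SX'', ''SXS'', ''XS'', ''Y'', ''SY'', ''YS'', ''one'', ''acc''}"

definition products_post :: "'a mat \<Rightarrow> 'a rstore \<Rightarrow> bool" where
  "products_post X \<rho> \<longleftrightarrow> mat_array ''SXS'' (S * X * S) \<rho> \<and> mat_array ''Y'' (X * S * X) \<rho>
    \<and> mat_array ''SY'' (S * (X * S * X)) \<rho> \<and> mat_array ''YS'' (X * S * X * S) \<rho>
    \<and> (\<forall>g. \<rho> ''one'' [g] = (if g = 0 then 1 else 0))"

definition products_cost :: nat where
  "products_cost = 3 * (p * (p * (q * 2))) + 3 * (q * (q * (p * 2)))"

lemma products_prog_run:
  assumes SA: "S_array \<rho>" and one: "\<rho> ''one'' = (\<lambda>_. 0)"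
    and X: "X \<in> carrier_mat q p" and XA: "mat_array ''X'' X \<rho>"
  shows "run member ops \<nu> products_prog \<rho> products_cost 0
    (\<lambda>\<rho>'. same_off products_off \<rho> \<rho>' \<and> products_post X \<rho>')"
proof -
  have SX: "S * X \<in> carrier_mat p p" and XS: "X * S \<in> carrier_mat q q" and Y: "X * S * X \<in> carrier_mat q p"
    using S X by auto
  define Q1 where "Q1 \<rho>' \<longleftrightarrow> same_off {''SX'', ''acc''} \<rho> \<rho>' \<and> mat_array ''SX'' (S * X) \<rho>'" for \<rho>' :: "'a rstore"
  define Q2 where "Q2 \<rho>' \<longleftrightarrow> same_off {''SX'', ''SXS'', ''acc''} \<rho> \<rho>' \<and> mat_array ''SXS'' (S * X * S) \<rho>'" for \<rho>' :: "'a rstore"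
  define Q3 where "Q3 \<rho>' \<longleftrightarrow> same_off {''SX'', ''SXS'', ''XS'', ''acc''} \<rho> \<rho>' \<and> mat_array ''SXS'' (S * X * S) \<rho>'
    \<and> mat_array ''XS'' (X * S) \<rho>'" for \<rho>' :: "'a rstore"
  define Q4 where "Q4 \<rho>' \<longleftrightarrow> same_off {''SX'', ''SXS'', ''XS'', ''Y'', ''acc''} \<rho> \<rho>' \<and> mat_array ''SXS'' (S * X * S) \<rho>'
    \<and> mat_array ''Y'' (X * S * X) \<rho>'" for \<rho>' :: "'a rstore"
  define Q5 where "Q5 \<rho>' \<longleftrightarrow> same_off {''SX'', ''SXS'', ''XS'', ''Y'', ''SY'', ''acc''} \<rho> \<rho>' \<and> mat_array ''SXS'' (S * X * S) \<rho>'
    \<and> mat_array ''Y'' (X * S * X) \<rho>' \<and> mat_array ''SY'' (S * (X * S * X)) \<rho>'" for \<rho>' :: "'a rstore"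
  define Q6 where "Q6 \<rho>' \<longleftrightarrow> same_off {''SX'', ''SXS'', ''XS'', ''Y'', ''SY'', ''YS'', ''acc''} \<rho> \<rho>' \<and> mat_array ''SXS'' (S * X * S) \<rho>'
    \<and> mat_array ''Y'' (X * S * X) \<rho>' \<and> mat_array ''SY'' (S * (X * S * X)) \<rho>' \<and> mat_array ''YS'' (X * S * X * S) \<rho>'" for \<rho>' :: "'a rstore"
  have 1: "run member ops \<nu> (Tab ''SX'' [I1, I2] PP PP N1 QQ N1 (RMul (RCell ''S'' [I1, V1, N0]) (RCell ''X'' [V1, I2]))) \<rho> (p * (p * (q * 2))) 0 Q1"
    using product_S_left[OF SA _ XA, of "''p''" "''SX''"] X unfolding Q1_def by simp
  have 2: "run member ops \<nu> (Tab ''SXS'' [I1, I2] PP QQ N1 PP N1 (RMul (RCell ''SX'' [I1, V1]) (RCell ''S'' [V1, I2, N0]))) \<rho>1 (p * (q * (p * 2))) 0 Q2"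
    if "Q1 \<rho>1" for \<rho>1
  proof -
    have "S_array \<rho>1" using that SA by (auto simp: Q1_def S_array_def same_off_def)
    from run_weaken[OF product_S_right[OF this, of "S * X" "''p''" "''SX''" "''SXS''"] order_refl order_refl, of Q2]
    show ?thesis using SX that by (auto simp: Q1_def Q2_def same_off_def mat_array_def)
  qed
  have 3: "run member ops \<nu> (Tab ''XS'' [I1, I2] QQ QQ N1 PP N1 (RMul (RCell ''X'' [I1, V1]) (RCell ''S'' [V1, I2, N0]))) \<rho>1 (q * (q * (p * 2))) 0 Q3"
    if "Q2 \<rho>1" for \<rho>1
  proof -
    have "S_array \<rho>1" using that SA by (auto simp: Q2_def S_array_def same_off_def)
    moreover have "mat_array ''X'' X \<rho>1" using that XA by (auto simp: Q2_def mat_array_def same_off_def)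
    ultimately show ?thesis
      using run_weaken[OF product_S_right[of \<rho>1 X "''q''" "''X''" "''XS''"] order_refl order_refl, of Q3] X that
      by (auto simp: Q2_def Q3_def same_off_def mat_array_def)
  qed
  have 4: "run member ops \<nu> (Tab ''Y'' [I1, I2] QQ PP N1 QQ N1 (RMul (RCell ''XS'' [I1, V1]) (RCell ''X'' [V1, I2]))) \<rho>1 (q * (p * (q * 2))) 0 Q4"
    if Q: "Q3 \<rho>1" for \<rho>1
  proof -
    have "\<rho>1 ''X'' = \<rho> ''X''" using Q by (auto simp: Q3_def same_off_def)
    then have "run member ops \<nu> (Tab ''Y'' [I1, I2] QQ PP N1 QQ N1 (RMul (RCell ''XS'' [I1, V1]) (RCell ''X'' [V1, I2]))) \<rho>1
      (\<nu> ''q'' * (\<nu> ''p'' * (\<nu> ''q'' * 2))) 0 (\<lambda>\<rho>'. same_off {''Y'', ''acc''} \<rho>1 \<rho>' \<and> mat_array ''Y'' (X * S * X) \<rho>')"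
      by (intro product_run) (use Q XA X XS in \<open>auto simp: Q3_def mat_array_def simp del: index_mult_mat(1)\<close>)
    from run_weaken[OF this order_refl order_refl, of Q4] show ?thesis
      using Q by (auto simp: Q3_def Q4_def same_off_def mat_array_def)
  qed
  have 5: "run member ops \<nu> (Tab ''SY'' [I1, I2] PP PP N1 QQ N1 (RMul (RCell ''S'' [I1, V1, N0]) (RCell ''Y'' [V1, I2]))) \<rho>1 (p * (p * (q * 2))) 0 Q5"
    if "Q4 \<rho>1" for \<rho>1
  proof -
    have "S_array \<rho>1" using that SA by (auto simp: Q4_def S_array_def same_off_def)
    from run_weaken[OF product_S_left[OF this, of "X * S * X" "''p''" "''Y''" "''SY''"] order_refl order_refl, of Q5]
    show ?thesis using Y that by (auto simp: Q4_def Q5_def same_off_def mat_array_def)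
  qed
  have 6: "run member ops \<nu> (Tab ''YS'' [I1, I2] QQ QQ N1 PP N1 (RMul (RCell ''Y'' [I1, V1]) (RCell ''S'' [V1, I2, N0]))) \<rho>1 (q * (q * (p * 2))) 0 Q6"
    if "Q5 \<rho>1" for \<rho>1
  proof -
    have "S_array \<rho>1" using that SA by (auto simp: Q5_def S_array_def same_off_def)
    from run_weaken[OF product_S_right[OF this, of "X * S * X" "''q''" "''Y''" "''YS''"] order_refl order_refl, of Q6]
    show ?thesis using Y that by (auto simp: Q5_def Q6_def same_off_def mat_array_def)
  qed
  have 7: "run member ops \<nu> (RAssign ''one'' [N0] ROne) \<rho>1 0 0 (\<lambda>\<rho>'. same_off products_off \<rho> \<rho>' \<and> products_post X \<rho>')"
    if "Q6 \<rho>1" for \<rho>1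
  proof -
    have "\<rho>1 ''one'' = (\<lambda>_. 0)" using that one by (auto simp: Q6_def same_off_def)
    then show ?thesis
      using run_RAssign[of "\<lambda>\<rho>'. same_off products_off \<rho> \<rho>' \<and> products_post X \<rho>'" "''one''" \<nu> "[N0]" ROne \<rho>1 member ops] that
      by (auto simp: Q6_def same_off_def products_off_def products_post_def mat_array_def store_cell_def)
  qed
  show ?thesis
    unfolding products_prog_def
    by (rule run_weaken[OF run_Seq[OF 1 run_Seq[OF 2 run_Seq[OF 3 run_Seq[OF 4 run_Seq[OF 5 run_Seq[OF 6 7]]]]]]], assumption+)
       (auto simp: products_cost_def algebra_simps)
qed

definition core_cost :: nat where
  "core_cost = p * (p * (T * (q * 2))) + p * (p * T + p * char_step_cost)
     + p * (p * (p * (T * (p * T * 2))) + p * (p * (T * 2))) + (Suc p * T + Suc p * (T * Suc p))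
     + Suc L * test_cost + Suc p * 12 + (Suc p * (q * (p * (T * p * 3))) + q * (p * (Suc p * 3))) + products_cost"

definition core_post :: "'a rstore \<Rightarrow> 'a rstore \<Rightarrow> bool" where
  "core_post \<rho> \<rho>' \<longleftrightarrow> \<rho>' ''S'' = \<rho> ''S'' \<and> \<rho>' ''found'' = \<rho> ''found'' \<and>
     (\<exists>X\<in>carrier_mat q p. products_post X \<rho>' \<and> ((\<exists>B. regular B) \<longrightarrow> regular X))"

lemma core_prog_run:
  assumes SA: "S_array \<rho>" and zero: "\<And>Y. Y \<notin> {''A'', ''S'', ''acc''} \<Longrightarrow> \<rho> Y = (\<lambda>_. 0)"
  shows "run member ops \<nu> core_prog \<rho> core_cost (real (Suc L) * w T + real (Suc p) * w 1) (core_post \<rho>)"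
proof -
  have keep: "\<rho>' Y = \<rho> Y" if "same_off V \<rho> \<rho>'" "Y \<notin> V" for V \<rho>' Y using that by (simp add: same_off_def)
  define V1 where "V1 = {''M'', ''acc''}"
  define V2 where "V2 = V1 \<union> {''W'', ''U'', ''H'', ''G'', ''acc''}"
  define V3 where "V3 = V2 \<union> {''E'', ''D'', ''acc''}"
  define V4 where "V4 = V3 \<union> {''C'', ''F'', ''acc''}"
  define V5 where "V5 = V4 \<union> test_off"
  define V6 where "V6 = V5 \<union> split_off"
  define V7 where "V7 = V6 \<union> {''Z'', ''X'', ''acc''}"
  note V = V1_def V2_def V3_def V4_def V5_def V6_def V7_def test_off_def split_off_def
  have SA': "S_array \<rho>'" if "same_off V7 \<rho> \<rho>'" for \<rho>'
  proof -
    have "\<rho>' ''S'' = \<rho> ''S''" by (rule keep[OF that]) (simp add: V)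
    then show ?thesis using SA by (simp add: S_array_def)
  qed
  have trans: "same_off (V \<union> W) \<rho> \<rho>''" if "same_off V \<rho> \<rho>'" "same_off W \<rho>' \<rho>''" for V W and \<rho>' \<rho>'' :: "'a rstore"
    using that by (auto simp: same_off_def)
  define Q1 where "Q1 \<rho>' \<longleftrightarrow> same_off V1 \<rho> \<rho>' \<and> M_array \<rho>'" for \<rho>' :: "'a rstore"
  define Q2 where "Q2 \<rho>' \<longleftrightarrow> same_off V2 \<rho> \<rho>' \<and> M_array \<rho>' \<and> G_array (lead_char_coeff p) \<rho>'" for \<rho>' :: "'a rstore"
  define Q3 where "Q3 \<rho>' \<longleftrightarrow> same_off V3 \<rho> \<rho>' \<and> G_array (lead_char_coeff p) \<rho>' \<and> D_array 0 \<rho>'" for \<rho>' :: "'a rstore"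
  define Q4 where "Q4 \<rho>' \<longleftrightarrow> same_off V4 \<rho> \<rho>' \<and> D_array 0 \<rho>' \<and> C_array \<rho>' \<and> F_array \<rho>'" for \<rho>' :: "'a rstore"
  define Q5 where "Q5 \<rho>' \<longleftrightarrow> same_off V5 \<rho> \<rho>' \<and> D_array 0 \<rho>' \<and> (\<forall>B. regular B \<longrightarrow> (\<exists>x. tested (Suc L) x \<rho>'))" for \<rho>' :: "'a rstore"
  define Q6 where "Q6 \<rho>' \<longleftrightarrow> same_off V6 \<rho> \<rho>' \<and> D_array 0 \<rho>' \<and> (\<forall>B. regular B \<longrightarrow> (\<exists>x. tested (Suc L) x \<rho>') \<and> split_upto B (Suc p) \<rho>')"
    for \<rho>' :: "'a rstore"
  define Q7 where "Q7 \<rho>' \<longleftrightarrow> same_off V7 \<rho> \<rho>' \<and> (\<forall>B. regular B \<longrightarrow>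
       (\<forall>i<p. \<forall>v<q. (\<Sum>u<q. \<Sum>j<p. S $$ (i, u) * \<rho>' ''X'' [u, j] * S $$ (j, v)) = S $$ (i, v)))" for \<rho>' :: "'a rstore"
  have 1: "run member ops \<nu> gram_prog \<rho> (p * (p * (T * (q * 2)))) 0 Q1"
    using gram_prog_run[OF SA] unfolding Q1_def V1_def .
  have 2: "run member ops \<nu> char_prog \<rho>1 (p * (p * T + p * char_step_cost)) 0 Q2" if Q: "Q1 \<rho>1" for \<rho>1
  proof (rule run_weaken[OF char_prog_run])
    show "M_array \<rho>1" using Q by (simp add: Q1_def)
    show "\<rho>1 ''G'' = (\<lambda>_. 0)" using Q keep[of V1 \<rho>1 "''G''"] zero[of "''G''"] by (simp add: Q1_def V1_def)
    fix \<rho>' assume R: "same_off {''W'', ''U'', ''H'', ''G'', ''acc''} \<rho>1 \<rho>' \<and> G_array (lead_char_coeff p) \<rho>'"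
    then have "\<rho>' ''M'' = \<rho>1 ''M''" by (auto simp: same_off_def)
    then have "M_array \<rho>'" using Q by (simp add: Q1_def M_array_def)
    then show "Q2 \<rho>'" using R Q trans[of V1 \<rho>1 _ \<rho>'] unfolding Q1_def Q2_def V2_def by blast
  qed auto
  have 3: "run member ops \<nu> adj_prog \<rho>1 (p * (p * (p * (T * (p * T * 2))) + p * (p * (T * 2)))) 0 Q3" if Q: "Q2 \<rho>1" for \<rho>1
  proof (rule run_weaken[OF adj_prog_run])
    show "M_array \<rho>1" "G_array (lead_char_coeff p) \<rho>1" using Q by (simp_all add: Q2_def)
    show "\<rho>1 ''D'' = (\<lambda>_. 0)" using Q keep[of V2 \<rho>1 "''D''"] zero[of "''D''"] by (simp add: Q2_def V)
    fix \<rho>' assume R: "same_off {''E'', ''D'', ''acc''} \<rho>1 \<rho>' \<and> D_array 0 \<rho>'"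
    then have "\<rho>' ''G'' = \<rho>1 ''G''" by (auto simp: same_off_def)
    then have "G_array (lead_char_coeff p) \<rho>'" using Q by (simp add: Q2_def G_array_def)
    then show "Q3 \<rho>'" using R Q trans[of V2 \<rho>1 _ \<rho>'] unfolding Q2_def Q3_def V3_def by blast
  qed auto
  have 4: "run member ops \<nu> coeff_prog \<rho>1 (Suc p * T + Suc p * (T * Suc p)) 0 Q4" if Q: "Q3 \<rho>1" for \<rho>1
  proof (rule run_weaken[OF coeff_prog_run])
    show "G_array (lead_char_coeff p) \<rho>1" using Q by (simp_all add: Q3_def)
    show "\<rho>1 ''F'' = (\<lambda>_. 0)" using Q keep[of V3 \<rho>1 "''F''"] zero[of "''F''"] by (simp add: Q3_def V)
    fix \<rho>' assume R: "same_off {''C'', ''F'', ''acc''} \<rho>1 \<rho>' \<and> C_array \<rho>' \<and> F_array \<rho>'"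
    then have "\<rho>' ''D'' = \<rho>1 ''D''" by (auto simp: same_off_def)
    then have "D_array 0 \<rho>'" using Q by (simp add: Q3_def D_array_def)
    then show "Q4 \<rho>'" using R Q trans[of V3 \<rho>1 _ \<rho>'] unfolding Q3_def Q4_def V4_def by blast
  qed auto
  have 5: "run member ops \<nu> test_prog \<rho>1 (Suc L * test_cost) (real (Suc L) * w T) Q5" if Q: "Q4 \<rho>1" for \<rho>1
  proof (rule run_weaken[OF test_prog_run])
    show "C_array \<rho>1" "F_array \<rho>1" using Q by (simp_all add: Q4_def)
    show "\<rho>1 ''x'' = (\<lambda>_. 0)" using Q keep[of V4 \<rho>1 "''x''"] zero[of "''x''"] by (simp add: Q4_def V)
    show "\<rho>1 ''f'' = (\<lambda>_. 0)" using Q keep[of V4 \<rho>1 "''f''"] zero[of "''f''"] by (simp add: Q4_def V)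
    show "\<rho>1 ''xi'' = (\<lambda>_. 0)" using Q keep[of V4 \<rho>1 "''xi''"] zero[of "''xi''"] by (simp add: Q4_def V)
    fix \<rho>' assume R: "same_off test_off \<rho>1 \<rho>' \<and> (\<forall>B. regular B \<longrightarrow> (\<exists>x. tested (Suc L) x \<rho>'))"
    then have "\<rho>' ''D'' = \<rho>1 ''D''" by (auto simp: same_off_def test_off_def)
    then have "D_array 0 \<rho>'" using Q by (simp add: Q4_def D_array_def)
    then show "Q5 \<rho>'" using R Q trans[of V4 \<rho>1 _ \<rho>'] unfolding Q4_def Q5_def V5_def by blast
  qed auto
  have 6: "run member ops \<nu> split_prog \<rho>1 (Suc p * 12) (real (Suc p) * w 1) Q6" if Q: "Q5 \<rho>1" for \<rho>1
  proof (rule run_weaken[OF split_prog_run])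
    show "\<exists>x. tested (Suc L) x \<rho>1" if "regular B" for B using Q that unfolding Q5_def by blast
    show "\<rho>1 ''s'' = (\<lambda>_. 0)" using Q keep[of V5 \<rho>1 "''s''"] zero[of "''s''"] by (simp add: Q5_def V)
    fix \<rho>' assume R: "same_off split_off \<rho>1 \<rho>' \<and> (\<forall>B. regular B \<longrightarrow> (\<exists>x. tested (Suc L) x \<rho>') \<and> split_upto B (Suc p) \<rho>')"
    then have "\<rho>' ''D'' = \<rho>1 ''D''" by (auto simp: same_off_def split_off_def)
    then have "D_array 0 \<rho>'" using Q by (simp add: Q5_def D_array_def)
    then show "Q6 \<rho>'" using R Q trans[of V5 \<rho>1 _ \<rho>'] unfolding Q5_def Q6_def V6_def by blast
  qed auto
  have 7: "run member ops \<nu> inverse_prog \<rho>1 (Suc p * (q * (p * (T * p * 3))) + q * (p * (Suc p * 3))) 0 Q7" if Q: "Q6 \<rho>1" for \<rho>1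
  proof (rule run_weaken[OF inverse_prog_run])
    show "S_array \<rho>1" using Q by (intro SA') (auto simp: Q6_def V7_def same_off_def)
    show "D_array 0 \<rho>1" using Q by (simp add: Q6_def)
    show "(\<exists>x. tested (Suc L) x \<rho>1) \<and> split_upto B (Suc p) \<rho>1" if "regular B" for B using Q that unfolding Q6_def by blast
    fix \<rho>' assume R: "same_off {''Z'', ''X'', ''acc''} \<rho>1 \<rho>' \<and> (\<forall>B. regular B \<longrightarrow>
       (\<forall>i<p. \<forall>v<q. (\<Sum>u<q. \<Sum>j<p. S $$ (i, u) * \<rho>' ''X'' [u, j] * S $$ (j, v)) = S $$ (i, v)))"
    then show "Q7 \<rho>'" using Q trans unfolding Q6_def Q7_def V7_def by blast
  qed auto
  have 8: "run member ops \<nu> products_prog \<rho>1 products_cost 0 (core_post \<rho>)" if Q: "Q7 \<rho>1" for \<rho>1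
  proof (rule run_weaken[OF products_prog_run])
    let ?X = "mat q p (\<lambda>(i, j). \<rho>1 ''X'' [i, j])"
    show "S_array \<rho>1" using Q by (intro SA') (auto simp: Q7_def)
    show "\<rho>1 ''one'' = (\<lambda>_. 0)" using Q keep[of V7 \<rho>1 "''one''"] zero[of "''one''"] by (simp add: Q7_def V)
    show X: "?X \<in> carrier_mat q p" by simp
    show "mat_array ''X'' ?X \<rho>1" by (simp add: mat_array_def)
    fix \<rho>' assume R: "same_off products_off \<rho>1 \<rho>' \<and> products_post ?X \<rho>'"
    have "S * ?X * S = S" if B: "regular B" for B
    proof (rule eq_matI)
      fix i v assume "i < dim_row S" "v < dim_col S"
      then have iv: "i < p" "v < q" by (simp_all add: dims)
      have "(S * ?X * S) $$ (i, v) = (\<Sum>j<p. (\<Sum>u<q. S $$ (i, u) * \<rho>1 ''X'' [u, j]) * S $$ (j, v))"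
        using iv S by (simp add: mult_mat_entry[OF mult_carrier_mat[OF S X] S] mult_mat_entry[OF S X] del: index_mult_mat(1))
      also have "\<dots> = (\<Sum>u<q. \<Sum>j<p. S $$ (i, u) * \<rho>1 ''X'' [u, j] * S $$ (j, v))"
        unfolding sum_distrib_right by (rule sum.swap)
      also have "\<dots> = S $$ (i, v)" using Q B iv unfolding Q7_def by blast
      finally show "(S * ?X * S) $$ (i, v) = S $$ (i, v)" .
    qed (use S in auto)
    then have "(\<exists>B. regular B) \<longrightarrow> regular ?X" using X by (auto simp: regular_def)
    moreover have "\<rho>' ''S'' = \<rho> ''S''" "\<rho>' ''found'' = \<rho> ''found''"
      using R Q by (auto simp: Q7_def same_off_def products_off_def V)
    ultimately show "core_post \<rho> \<rho>'" using R X unfolding core_post_def by blast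
  qed auto
  show ?thesis
    unfolding core_prog_def
    by (rule run_weaken[OF run_Seq[OF 1 run_Seq[OF 2 run_Seq[OF 3 run_Seq[OF 4 run_Seq[OF 5 run_Seq[OF 6 run_Seq[OF 7 8]]]]]]]], assumption+)
       (auto simp: core_cost_def)
qed

text \<open>The ideal of the empty list is zero, so the test without generators decides equality to
  0 and returns no coefficients.\<close>

lemma member_zero: "member y [] = None \<longleftrightarrow> y \<noteq> 0" "member y [] = Some cs \<Longrightarrow> cs = []"
proof -
  show "member y [] = Some cs \<Longrightarrow> cs = []" using member_Some[of y "[]" cs] by simp
  show "member y [] = None \<longleftrightarrow> y \<noteq> 0"
  proof (cases "member y []")
    case None
    then show ?thesis using member_None[OF None] by (auto simp: fg_ideal_iff)
  next
    case (Some cs)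
    then show ?thesis using member_Some[OF Some] by (simp add: lin_comb_def)
  qed
qed

lemma zero_test_run:
  assumes b: "\<mu> ''b'' = 0" and Q: "Q (store_cell ''found'' [if rval r \<mu> \<rho> = 0 then 1 else 0] 1 \<rho>)"
  shows "run member ops \<mu> (zero_test r) \<rho> (arith_ops r) (w 0) Q"
proof -
  let ?y = "rval r \<mu> \<rho>" and ?v = "if rval r \<mu> \<rho> = 0 then 1 else 0 :: nat"
  have gens: "gens \<rho> ''g'' (nval N0 \<mu>) = []" by (simp add: gens_def)
  have 1: "exec member ops (Member ''b'' r ''g'' N0 ''x'') (\<mu>, \<rho>) (arith_ops r) (ops ?y []) (\<mu>(''b'' := ?v), \<rho>)"
  proof (cases "member ?y []")
    case None
    then show ?thesis using exec.MemberNo[of ?y r \<mu> \<rho> "[]" "''g''" N0 member ops "''b''" "''x''"] gens member_zero(1)[of ?y] by simp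
  next
    case (Some cs)
    then have "store_list ''x'' cs \<rho> = \<rho>" using member_zero(2)[OF Some] by (simp add: store_list_def)
    moreover have "?y = 0" using Some member_zero(1)[of ?y] by auto
    ultimately show ?thesis using exec.MemberYes[of ?y r \<mu> \<rho> "[]" "''g''" N0 member cs ops "''b''" "''x''"] gens Some by simp
  qed
  have 2: "exec member ops (RAssign ''found'' [NVar ''b''] ROne) (\<mu>(''b'' := ?v), \<rho>) 0 0
      (\<mu>(''b'' := ?v), store_cell ''found'' [?v] 1 \<rho>)"
    using exec.RAssign[of member ops "''found''" "[NVar ''b'']" ROne "\<mu>(''b'' := ?v)" \<rho>] by simp
  have 3: "exec member ops (NAssign ''b'' N0) (\<mu>(''b'' := ?v), \<rho>') 0 0 (\<mu>, \<rho>')" for \<rho>'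
    using exec.NAssign[of member ops "''b''" N0 "\<mu>(''b'' := ?v)" \<rho>'] b by (simp add: fun_upd_idem)
  have "real (ops ?y []) \<le> w 0" using w[of ?y "[]"] by simp
  then show ?thesis
    unfolding run_def zero_test_def using exec.Seq[OF 1 exec.Seq[OF 2 3]] Q by fastforce
qed

lemma check_prog_run:
  assumes SA: "S_array \<rho>" and found: "\<rho> ''found'' = (\<lambda>_. 0)"
    and X: "X \<in> carrier_mat q p" and SXS: "mat_array ''SXS'' (S * X * S) \<rho>"
  shows "run member ops \<nu> check_prog \<rho> (p * (q * 1)) (real p * (real q * w 0))
    (\<lambda>\<rho>'. same_off {''found''} \<rho> \<rho>' \<and> (\<rho>' ''found'' [0] = 0 \<longleftrightarrow> S * X * S = S))"
proof -
  define bad where "bad i j \<longleftrightarrow> (S * X * S) $$ (i, j) \<noteq> S $$ (i, j)" for i j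
  define I where "I D \<rho>' \<longleftrightarrow> same_off {''found''} \<rho> \<rho>' \<and>
    \<rho>' ''found'' [0] = (if \<exists>(i, j)\<in>D. bad i j then 1 else 0)" for D and \<rho>' :: "'a rstore"
  have "run member ops \<nu> check_prog \<rho> (p * (q * 1)) (real p * (real q * w 0)) (I ({..<p} \<times> {..<q}))"
    unfolding check_prog_def
  proof (rule run_For[where I = "\<lambda>i. I ({..<i} \<times> {..<q})"])
    fix i \<rho>1 assume i: "i < p" and I1: "I ({..<i} \<times> {..<q}) \<rho>1"
    show "run member ops (\<nu>(''i1'' := i)) (For ''i2'' QQ (zero_test (RSub (RCell ''SXS'' [I1, I2]) (RCell ''S'' [I1, I2, N0])))) \<rho>1
      (q * 1) (real q * w 0) (I ({..<Suc i} \<times> {..<q}))"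
    proof (rule run_weaken, rule run_For[where I = "\<lambda>j. I ({..<i} \<times> {..<q} \<union> {i} \<times> {..<j})"])
      fix j \<rho>2 assume j: "j < q" and I2: "I ({..<i} \<times> {..<q} \<union> {i} \<times> {..<j}) \<rho>2"
      let ?r = "RSub (RCell ''SXS'' [I1, I2]) (RCell ''S'' [I1, I2, N0])"
      have eq: "\<rho>2 ''SXS'' = \<rho> ''SXS''" "\<rho>2 ''S'' = \<rho> ''S''" using I2 by (auto simp: I_def same_off_def)
      have r: "rval ?r (\<nu>(''i1'' := i, ''i2'' := j)) \<rho>2 = 0 \<longleftrightarrow> \<not> bad i j"
        using SXS SA S X i j by (simp add: eq bad_def mat_array_def S_array_def del: index_mult_mat(1))
      have D: "{..<i} \<times> {..<q} \<union> {i} \<times> {..<Suc j} = insert (i, j) ({..<i} \<times> {..<q} \<union> {i} \<times> {..<j})" by auto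
      have "run member ops (\<nu>(''i1'' := i, ''i2'' := j)) (zero_test ?r) \<rho>2 (arith_ops ?r) (w 0)
        (I ({..<i} \<times> {..<q} \<union> {i} \<times> {..<Suc j}))"
      proof (rule zero_test_run)
        show "I ({..<i} \<times> {..<q} \<union> {i} \<times> {..<Suc j})
          (store_cell ''found'' [if rval ?r (\<nu>(''i1'' := i, ''i2'' := j)) \<rho>2 = 0 then 1 else 0] 1 \<rho>2)"
          unfolding r D using I2 by (auto simp: I_def store_cell_def same_off_def)
      qed simp
      then show "run member ops (\<nu>(''i1'' := i, ''i2'' := j)) (zero_test ?r) \<rho>2 1 (w 0)
        (I ({..<i} \<times> {..<q} \<union> {i} \<times> {..<Suc j}))" by simp
    next
      fix \<rho>' assume "I ({..<i} \<times> {..<q} \<union> {i} \<times> {..<q}) \<rho>'"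
      moreover have "{..<Suc i} \<times> {..<q} = {..<i} \<times> {..<q} \<union> {i} \<times> {..<q}" by auto
      ultimately show "I ({..<Suc i} \<times> {..<q}) \<rho>'" by simp
    qed (use I1 in auto)
  qed (use found in \<open>auto simp: I_def same_off_def\<close>)
  then show ?thesis
  proof (rule run_weaken)
    fix \<rho>' assume I: "I ({..<p} \<times> {..<q}) \<rho>'"
    \<comment> \<open>In the zero ring a recorded failure \<open>found[0] = 1\<close> reads as 0.
      The equivalence survives because all matrices of one size are equal.\<close>
    have "S * X * S = S" if "(1 :: 'a) = 0"
    proof -
      have "a = b" for a b :: 'a using that by (metis mult_1 mult_zero_left)
      then show ?thesis using S by (intro eq_matI) auto
    qed
    moreover have "(\<forall>i<p. \<forall>j<q. \<not> bad i j) \<longleftrightarrow> S * X * S = S"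
      using S by (auto simp: bad_def mat_eq_iff simp del: index_mult_mat(1))
    ultimately show "same_off {''found''} \<rho> \<rho>' \<and> (\<rho>' ''found'' [0] = 0 \<longleftrightarrow> S * X * S = S)"
      using I by (auto simp: I_def split: if_splits)
  qed auto
qed

end

section \<open>Orientation, output and the complete program\<close>

definition copy_prog :: com where
  "copy_prog = If (BLess (NVar ''n'') (NVar ''m''))
     (Tab ''S'' [I1, I2, N0] PP QQ N1 N1 N1 (RCell ''A'' [I2, I1]))
     (Tab ''S'' [I1, I2, N0] PP QQ N1 N1 N1 (RCell ''A'' [I1, I2]))"

text \<open>Read at the distance of the two indices, the array \<open>one\<close> is the identity
  matrix.\<close>

definition mats_prog :: "rexp \<Rightarrow> rexp \<Rightarrow> rexp \<Rightarrow> com" where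
  "mats_prog r1 r2 r3 = Seq (Tab ''B'' [I1, I2] (NVar ''n'') (NVar ''m'') N1 N1 N1 r1)
     (Seq (Tab ''Im'' [I1, I2] (NVar ''m'') (NVar ''m'') N1 N1 N1 r2)
       (Tab ''Ker'' [I1, I2] (NVar ''n'') (NVar ''n'') N1 N1 N1 (RSub (RCell ''one'' [dist_exp I1 I2]) r3)))"

definition output_prog :: com where
  "output_prog = If (BLess (NVar ''n'') (NVar ''m''))
     (mats_prog (RCell ''Y'' [I2, I1]) (RCell ''YS'' [I2, I1]) (RCell ''SY'' [I2, I1]))
     (mats_prog (RCell ''Y'' [I1, I2]) (RCell ''SY'' [I1, I2]) (RCell ''YS'' [I1, I2]))"

definition main_prog :: com where
  "main_prog = Seq copy_prog (Seq core_prog (Seq check_prog (Seq output_prog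
     (Member ''ok'' (RCell ''found'' [N0]) ''g'' N0 ''x''))))"

lemma run_If:
  assumes "bval t \<nu> \<Longrightarrow> run member ops \<nu> P \<rho> a e Q" "\<not> bval t \<nu> \<Longrightarrow> run member ops \<nu> P' \<rho> a e Q"
  shows "run member ops \<nu> (If t P P') \<rho> a e Q"
  using assms unfolding run_def by (cases "bval t \<nu>") (fastforce intro: exec.IfTrue exec.IfFalse)+

text \<open>For \<open>Y = X S X\<close>, the equation \<open>S X S = S\<close> gives
  \<open>S Y = S X\<close> and \<open>Y S = X S\<close>; both laws for \<open>Y\<close>
  follow.\<close>

lemma generalized_inverse_from_regular:
  fixes S X :: "'a :: comm_ring_1 mat"
  assumes S: "S \<in> carrier_mat p q" and X: "X \<in> carrier_mat q p" and SXS: "S * X * S = S"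
  shows "S * (X * S * X) * S = S" "X * S * X * S * (X * S * X) = X * S * X"
proof -
  have SX: "S * X \<in> carrier_mat p p" using S X by simp
  have Y: "X * S * X = X * (S * X)" by (rule assoc_mult_mat[OF X S X])
  have idem: "S * X * (S * X) = S * X"
    using assoc_mult_mat[OF SX S X] SXS by simp
  have SY: "S * (X * S * X) = S * X"
    unfolding Y using assoc_mult_mat[OF S X SX] idem by simp
  then show "S * (X * S * X) * S = S" by (simp add: SXS)
  have "X * S * X * S = X * S"
    unfolding Y using assoc_mult_mat[OF X SX S] SXS by simp
  then have "X * S * X * S * (X * S * X) = X * (S * (X * S * X))"
    using assoc_mult_mat[OF X S, of "X * S * X" p] X S by simp
  then show "X * S * X * S * (X * S * X) = X * S * X" by (simp only: SY Y[symmetric])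
qed

lemma transpose_regular:
  fixes A B :: "'a :: comm_ring_1 mat"
  assumes A: "A \<in> carrier_mat m n" and B: "B \<in> carrier_mat n m"
  shows "transpose_mat A * transpose_mat B * transpose_mat A = transpose_mat (A * B * A)"
proof -
  have AB: "A * B \<in> carrier_mat m m" using A B by simp
  have "transpose_mat (A * B * A) = transpose_mat A * (transpose_mat B * transpose_mat A)"
    unfolding transpose_mult[OF AB A] transpose_mult[OF A B] ..
  then show ?thesis using assoc_mult_mat[of "transpose_mat A" n m "transpose_mat B" n "transpose_mat A" m] A B by simp
qed

text \<open>Transposition makes \<open>p \<le> q\<close>, on which the final estimates rely: the
  costs treat rows and columns differently.\<close>

locale input_program = matrix_program +
  fixes A :: "'a mat" and m n :: nat
  assumes A: "A \<in> carrier_mat m n" and mn [simp]: "\<nu> ''m'' = m" "\<nu> ''n'' = n"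
    and pq: "p = min m n" "q = max m n" and SA: "S = (if n < m then transpose_mat A else A)"
begin

lemma copy_prog_run:
  "run member ops \<nu> copy_prog (snd (init_state A)) (p * q) 0
     (\<lambda>\<rho>'. same_off {''S'', ''acc''} (snd (init_state A)) \<rho>' \<and> S_array \<rho>')"
  unfolding copy_prog_def
proof (rule run_If, simp_all only: bval.simps nval.simps mn)
  assume nm: "n < m"
  show "run member ops \<nu> (Tab ''S'' [I1, I2, N0] PP QQ N1 N1 N1 (RCell ''A'' [I2, I1])) (snd (init_state A)) (p * q) 0
     (\<lambda>\<rho>'. same_off {''S'', ''acc''} (snd (init_state A)) \<rho>' \<and> S_array \<rho>')"
  proof (rule run_TabS[where hm = 1], goal_cases)
    case (10 \<rho>')
    have "\<rho>' ''S'' [i, j, 0] = S $$ (i, j)" if "i < p" "j < q" for i j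
      using 10(2)[of i j 0] that nm A by (simp add: init_state_def SA pq)
    moreover have "\<rho>' ''S'' [i, j, g] = 0" if "g \<noteq> 0" for i j g
      using 10(3)[of "[i, j, g]"] that by (auto simp: init_state_def)
    ultimately show ?case using 10(1) by (simp add: S_array_def)
  qed auto
next
  assume nm: "\<not> n < m"
  show "run member ops \<nu> (Tab ''S'' [I1, I2, N0] PP QQ N1 N1 N1 (RCell ''A'' [I1, I2])) (snd (init_state A)) (p * q) 0
     (\<lambda>\<rho>'. same_off {''S'', ''acc''} (snd (init_state A)) \<rho>' \<and> S_array \<rho>')"
  proof (rule run_TabS[where hm = 1], goal_cases)
    case (10 \<rho>')
    have "\<rho>' ''S'' [i, j, 0] = S $$ (i, j)" if "i < p" "j < q" for i j
      using 10(2)[of i j 0] that nm A by (simp add: init_state_def SA pq)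
    moreover have "\<rho>' ''S'' [i, j, g] = 0" if "g \<noteq> 0" for i j g
      using 10(3)[of "[i, j, g]"] that by (auto simp: init_state_def)
    ultimately show ?case using 10(1) by (simp add: S_array_def)
  qed auto
qed

lemma mats_prog_run:
  assumes arr: "arrays r1 \<union> arrays r2 \<union> arrays r3 \<subseteq> {''Y'', ''YS'', ''SY''}"
    and ops0: "arith_ops r1 = 0" "arith_ops r2 = 0" "arith_ops r3 = 0"
    and one: "\<forall>g. \<rho> ''one'' [g] = (if g = 0 then 1 else 0)"
    and r1: "\<And>i j. i < n \<Longrightarrow> j < m \<Longrightarrow> rval r1 (\<nu>(''i1'' := i, ''i2'' := j, ''i3'' := 0, ''v1'' := 0, ''v2'' := 0)) \<rho> = M1 $$ (i, j)"
    and r2: "\<And>i j. i < m \<Longrightarrow> j < m \<Longrightarrow> rval r2 (\<nu>(''i1'' := i, ''i2'' := j, ''i3'' := 0, ''v1'' := 0, ''v2'' := 0)) \<rho> = M2 $$ (i, j)"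
    and r3: "\<And>i j. i < n \<Longrightarrow> j < n \<Longrightarrow> rval r3 (\<nu>(''i1'' := i, ''i2'' := j, ''i3'' := 0, ''v1'' := 0, ''v2'' := 0)) \<rho> = M3 $$ (i, j)"
    and M: "M1 \<in> carrier_mat n m" "M2 \<in> carrier_mat m m" "M3 \<in> carrier_mat n n"
  shows "run member ops \<nu> (mats_prog r1 r2 r3) \<rho> (n * m + (m * m + n * (n * 2))) 0
     (\<lambda>\<rho>'. \<rho>' ''found'' = \<rho> ''found'' \<and> stored_mat \<rho>' ''B'' n m = M1 \<and> stored_mat \<rho>' ''Im'' m m = M2 \<and> stored_mat \<rho>' ''Ker'' n n = 1\<^sub>m n - M3)"
proof -
  define Q1 where "Q1 \<rho>' \<longleftrightarrow> same_off {''B'', ''acc''} \<rho> \<rho>' \<and> stored_mat \<rho>' ''B'' n m = M1" for \<rho>' :: "'a rstore"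
  define Q2 where "Q2 \<rho>' \<longleftrightarrow> same_off {''B'', ''Im'', ''acc''} \<rho> \<rho>' \<and> stored_mat \<rho>' ''B'' n m = M1 \<and> stored_mat \<rho>' ''Im'' m m = M2"
    for \<rho>' :: "'a rstore"
  have 1: "run member ops \<nu> (Tab ''B'' [I1, I2] (NVar ''n'') (NVar ''m'') N1 N1 N1 r1) \<rho> (n * m) 0 Q1"
  proof (rule run_TabS[where hm = 1], goal_cases)
    case (10 \<rho>')
    have "stored_mat \<rho>' ''B'' n m $$ (i, j) = M1 $$ (i, j)" if "i < n" "j < m" for i j
      using 10(2)[of i j 0] r1[OF that] that by (simp add: stored_mat_def)
    then have "stored_mat \<rho>' ''B'' n m = M1" using M by (intro eq_matI) (auto simp: stored_mat_def)
    then show ?case using 10(1) by (simp add: Q1_def)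
  qed (use arr ops0 in auto)
  have 2: "run member ops \<nu> (Tab ''Im'' [I1, I2] (NVar ''m'') (NVar ''m'') N1 N1 N1 r2) \<rho>1 (m * m) 0 Q2" if Q: "Q1 \<rho>1" for \<rho>1
  proof (rule run_TabS[where hm = 1], goal_cases)
    case (10 \<rho>')
    have "rval r2 \<mu> \<rho>1 = rval r2 \<mu> \<rho>" for \<mu>
    proof (rule rval_cong)
      fix x assume "x \<in> arrays r2"
      then have "x \<in> {''Y'', ''YS'', ''SY''}" using arr by blast
      then have "x \<notin> {''B'', ''acc''}" by auto
      then show "\<rho>1 x = \<rho> x" using Q unfolding Q1_def same_off_def by blast
    qed
    then have "stored_mat \<rho>' ''Im'' m m $$ (i, j) = M2 $$ (i, j)" if "i < m" "j < m" for i j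
      using 10(2)[of i j 0] r2[OF that] that by (simp add: stored_mat_def)
    then have "stored_mat \<rho>' ''Im'' m m = M2" using M by (intro eq_matI) (auto simp: stored_mat_def)
    moreover have "\<rho>' ''B'' = \<rho>1 ''B''" using 10(1) by (simp add: same_off_def)
    ultimately show ?case using 10(1) Q by (auto simp: Q1_def Q2_def same_off_def stored_mat_def)
  qed (use arr ops0 in auto)
  have 3: "run member ops \<nu> (Tab ''Ker'' [I1, I2] (NVar ''n'') (NVar ''n'') N1 N1 N1 (RSub (RCell ''one'' [dist_exp I1 I2]) r3)) \<rho>1 (n * (n * 2)) 0
     (\<lambda>\<rho>'. \<rho>' ''found'' = \<rho> ''found'' \<and> stored_mat \<rho>' ''B'' n m = M1 \<and> stored_mat \<rho>' ''Im'' m m = M2 \<and> stored_mat \<rho>' ''Ker'' n n = 1\<^sub>m n - M3)"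
    if Q: "Q2 \<rho>1" for \<rho>1
  proof (rule run_TabS[where hm = 1], goal_cases)
    case (10 \<rho>')
    have "rval r3 \<mu> \<rho>1 = rval r3 \<mu> \<rho>" for \<mu>
    proof (rule rval_cong)
      fix x assume "x \<in> arrays r3"
      then have "x \<in> {''Y'', ''YS'', ''SY''}" using arr by blast
      then have "x \<notin> {''B'', ''Im'', ''acc''}" by auto
      then show "\<rho>1 x = \<rho> x" using Q unfolding Q2_def same_off_def by blast
    qed
    moreover have "\<rho>1 ''one'' [i - j + (j - i)] = (if i = j then 1 else 0)" for i j
      using Q one by (auto simp: Q2_def same_off_def)
    ultimately have "stored_mat \<rho>' ''Ker'' n n $$ (i, j) = (1\<^sub>m n - M3) $$ (i, j)" if "i < n" "j < n" for i j
      using 10(2)[of i j 0] r3[OF that] that M by (simp add: stored_mat_def)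
    then have "stored_mat \<rho>' ''Ker'' n n = 1\<^sub>m n - M3" using M by (intro eq_matI) (auto simp: stored_mat_def)
    moreover have "\<rho>' ''B'' = \<rho>1 ''B''" "\<rho>' ''Im'' = \<rho>1 ''Im''" "\<rho>' ''found'' = \<rho> ''found''"
      using 10(1) Q by (simp_all add: Q2_def same_off_def)
    ultimately show ?case using Q by (auto simp: Q2_def stored_mat_def)
  qed (use arr ops0 in auto)
  show ?thesis
    unfolding mats_prog_def by (rule run_weaken[OF run_Seq[OF 1 run_Seq[OF 2 3]]], assumption+) auto
qed

lemma output_prog_run:
  assumes X: "X \<in> carrier_mat q p" and post: "products_post X \<rho>"
  shows "run member ops \<nu> output_prog \<rho> (4 * (q * q)) 0
     (\<lambda>\<rho>'. \<rho>' ''found'' = \<rho> ''found'' \<and> (S * X * S = S \<longrightarrow>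
        generalized_inverse A (stored_mat \<rho>' ''B'' n m) \<and>
        projection_onto n (stored_mat \<rho>' ''Ker'' n n) (mat_kernel A) \<and>
        projection_onto m (stored_mat \<rho>' ''Im'' m m) (mat_image A)))"
proof -
  define Y where "Y = X * S * X"
  have Y: "Y \<in> carrier_mat q p" using X S by (simp add: Y_def)
  have arr: "mat_array ''Y'' Y \<rho>" "mat_array ''SY'' (S * Y) \<rho>" "mat_array ''YS'' (Y * S) \<rho>"
    and one: "\<forall>g. \<rho> ''one'' [g] = (if g = 0 then 1 else 0)"
    using post by (simp_all add: products_post_def Y_def)
  have SYS: "S * Y * S = S" "Y * S * Y = Y" if "S * X * S = S"
    using generalized_inverse_from_regular[OF S X that] by (simp_all add: Y_def)
  have final: "generalized_inverse A B \<Longrightarrow> projection_onto n (1\<^sub>m n - B * A) (mat_kernel A) \<and> projection_onto m (A * B) (mat_image A)" for B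
    using generalized_inverse_projections[OF A] by blast
  have nm_cost: "n * m + (m * m + n * (n * 2)) \<le> 4 * (q * q)"
  proof -
    have "n * m \<le> q * q" "m * m \<le> q * q" "n * n \<le> q * q" by (auto simp: pq intro!: mult_le_mono)
    then show ?thesis by simp
  qed
  show ?thesis
    unfolding output_prog_def
  proof (rule run_If, simp_all only: bval.simps nval.simps mn)
    assume nm: "n < m"
    then have AS: "A = transpose_mat S" and [simp]: "p = n" "q = m" by (auto simp: SA pq)
    let ?B = "transpose_mat Y"
    have AB: "A * ?B = transpose_mat (Y * S)" "?B * A = transpose_mat (S * Y)"
      unfolding AS using transpose_mult[OF Y S] transpose_mult[OF S Y] by simp_all
    have inv: "generalized_inverse A ?B" if "S * X * S = S"
      using SYS[OF that] transpose_regular[OF S Y] transpose_regular[OF Y S] S Y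
      by (auto simp: generalized_inverse_def AS)
    have "run member ops \<nu> (mats_prog (RCell ''Y'' [I2, I1]) (RCell ''YS'' [I2, I1]) (RCell ''SY'' [I2, I1])) \<rho>
      (n * m + (m * m + n * (n * 2))) 0 (\<lambda>\<rho>'. \<rho>' ''found'' = \<rho> ''found'' \<and> stored_mat \<rho>' ''B'' n m = ?B
        \<and> stored_mat \<rho>' ''Im'' m m = transpose_mat (Y * S) \<and> stored_mat \<rho>' ''Ker'' n n = 1\<^sub>m n - transpose_mat (S * Y))"
      by (rule mats_prog_run) (use arr one Y S in \<open>auto simp: mat_array_def simp del: index_mult_mat(1)\<close>)
    then show "run member ops \<nu> (mats_prog (RCell ''Y'' [I2, I1]) (RCell ''YS'' [I2, I1]) (RCell ''SY'' [I2, I1])) \<rho> (4 * (q * q)) 0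
     (\<lambda>\<rho>'. \<rho>' ''found'' = \<rho> ''found'' \<and> (S * X * S = S \<longrightarrow>
        generalized_inverse A (stored_mat \<rho>' ''B'' n m) \<and>
        projection_onto n (stored_mat \<rho>' ''Ker'' n n) (mat_kernel A) \<and>
        projection_onto m (stored_mat \<rho>' ''Im'' m m) (mat_image A)))"
      by (rule run_weaken) (use nm_cost inv final[of ?B] in \<open>auto simp: AB[symmetric]\<close>)
  next
    assume nm: "\<not> n < m"
    then have AS: "A = S" and [simp]: "p = m" "q = n" by (auto simp: SA pq)
    have inv: "generalized_inverse A Y" if "S * X * S = S"
      using SYS[OF that] S Y by (auto simp: generalized_inverse_def AS)
    have "run member ops \<nu> (mats_prog (RCell ''Y'' [I1, I2]) (RCell ''SY'' [I1, I2]) (RCell ''YS'' [I1, I2])) \<rho>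
      (n * m + (m * m + n * (n * 2))) 0 (\<lambda>\<rho>'. \<rho>' ''found'' = \<rho> ''found'' \<and> stored_mat \<rho>' ''B'' n m = Y
        \<and> stored_mat \<rho>' ''Im'' m m = S * Y \<and> stored_mat \<rho>' ''Ker'' n n = 1\<^sub>m n - Y * S)"
      by (rule mats_prog_run) (use arr one Y S in \<open>auto simp: mat_array_def simp del: index_mult_mat(1)\<close>)
    then show "run member ops \<nu> (mats_prog (RCell ''Y'' [I1, I2]) (RCell ''SY'' [I1, I2]) (RCell ''YS'' [I1, I2])) \<rho> (4 * (q * q)) 0
     (\<lambda>\<rho>'. \<rho>' ''found'' = \<rho> ''found'' \<and> (S * X * S = S \<longrightarrow>
        generalized_inverse A (stored_mat \<rho>' ''B'' n m) \<and>
        projection_onto n (stored_mat \<rho>' ''Ker'' n n) (mat_kernel A) \<and>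
        projection_onto m (stored_mat \<rho>' ''Im'' m m) (mat_image A)))"
      by (rule run_weaken) (use nm_cost inv final[of Y] in \<open>auto simp: AS\<close>)
  qed
qed

lemma locally_simple_regular: "locally_simple A \<longleftrightarrow> (\<exists>B. regular B)"
proof (cases "n < m")
  case True
  then have AS: "A = transpose_mat S" "S = transpose_mat A" and [simp]: "p = n" "q = m" by (auto simp: SA pq)
  have S': "S \<in> carrier_mat n m" using S by simp
  show ?thesis
    unfolding locally_simple_iff[OF A] regular_def
  proof safe
    fix B assume B: "B \<in> carrier_mat n m" "A * B * A = A"
    then show "\<exists>B. B \<in> carrier_mat q p \<and> S * B * S = S"
      using transpose_regular[OF A B(1)] AS(2) by (intro exI[of _ "transpose_mat B"]) auto
  next
    fix B assume B: "B \<in> carrier_mat q p" "S * B * S = S"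
    then show "\<exists>B\<in>carrier_mat n m. A * B * A = A"
      using transpose_regular[OF S', of B] AS(1) by (intro bexI[of _ "transpose_mat B"]) auto
  qed
next
  case False
  then have "A = S" and "p = m" "q = n" by (auto simp: SA pq)
  then show ?thesis unfolding locally_simple_iff[OF A] regular_def by auto
qed

lemma main_prog_exec:
  obtains a e \<sigma> where "exec member ops main_prog (\<nu>, snd (init_state A)) a e \<sigma>" "correct_output A \<sigma>"
    "a \<le> core_cost + 2 * (p * q) + 4 * (q * q)"
    "real e \<le> real (Suc L) * w T + real (Suc p) * w 1 + real (Suc (p * q)) * w 0"
proof -
  let ?\<rho> = "snd (init_state A)"
  define Q1 where "Q1 \<rho>' \<longleftrightarrow> same_off {''S'', ''acc''} ?\<rho> \<rho>' \<and> S_array \<rho>'" for \<rho>' :: "'a rstore"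
  define Q2 where "Q2 \<rho>' \<longleftrightarrow> S_array \<rho>' \<and> \<rho>' ''found'' = (\<lambda>_. 0) \<and>
     (\<exists>X\<in>carrier_mat q p. products_post X \<rho>' \<and> ((\<exists>B. regular B) \<longrightarrow> regular X))" for \<rho>' :: "'a rstore"
  define Q3 where "Q3 \<rho>' \<longleftrightarrow> (\<exists>X\<in>carrier_mat q p. products_post X \<rho>' \<and> (\<rho>' ''found'' [0] = 0 \<longleftrightarrow> locally_simple A)
    \<and> (locally_simple A \<longrightarrow> regular X))" for \<rho>' :: "'a rstore"
  define Q4 where "Q4 \<rho>' \<longleftrightarrow> (\<rho>' ''found'' [0] = 0 \<longleftrightarrow> locally_simple A) \<and> (locally_simple A \<longrightarrow>
        generalized_inverse A (stored_mat \<rho>' ''B'' n m) \<and>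
        projection_onto n (stored_mat \<rho>' ''Ker'' n n) (mat_kernel A) \<and>
        projection_onto m (stored_mat \<rho>' ''Im'' m m) (mat_image A))" for \<rho>' :: "'a rstore"
  have 1: "run member ops \<nu> copy_prog ?\<rho> (p * q) 0 Q1"
    unfolding Q1_def by (rule copy_prog_run)
  have 2: "run member ops \<nu> core_prog \<rho>1 core_cost (real (Suc L) * w T + real (Suc p) * w 1) Q2" if Q: "Q1 \<rho>1" for \<rho>1
  proof (rule run_weaken[OF core_prog_run])
    show zero: "\<rho>1 Y = (\<lambda>_. 0)" if "Y \<notin> {''A'', ''S'', ''acc''}" for Y
      using Q that by (auto simp: Q1_def same_off_def init_state_def)
    fix \<rho>' assume "core_post \<rho>1 \<rho>'"
    then show "Q2 \<rho>'" using Q zero[of "''found''"] by (auto simp: Q1_def Q2_def core_post_def S_array_def)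
  qed (use Q in \<open>auto simp: Q1_def\<close>)
  have 3: "run member ops \<nu> check_prog \<rho>1 (p * (q * 1)) (real p * (real q * w 0)) Q3" if Q: "Q2 \<rho>1" for \<rho>1
  proof -
    obtain X where X: "X \<in> carrier_mat q p" "products_post X \<rho>1" "(\<exists>B. regular B) \<longrightarrow> regular X"
      using Q unfolding Q2_def by blast
    show ?thesis
    proof (rule run_weaken[OF check_prog_run[OF _ _ X(1)]])
      show "S_array \<rho>1" "\<rho>1 ''found'' = (\<lambda>_. 0)" using Q by (simp_all add: Q2_def)
      show "mat_array ''SXS'' (S * X * S) \<rho>1" using X(2) by (simp add: products_post_def)
      fix \<rho>' assume R: "same_off {''found''} \<rho>1 \<rho>' \<and> (\<rho>' ''found'' [0] = 0 \<longleftrightarrow> S * X * S = S)"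
      then have "products_post X \<rho>'" using X(2) by (auto simp: products_post_def mat_array_def same_off_def)
      moreover have "S * X * S = S \<longleftrightarrow> locally_simple A"
        unfolding locally_simple_regular using X(1,3) by (auto simp: regular_def)
      ultimately show "Q3 \<rho>'" using R X(1,3) unfolding Q3_def locally_simple_regular by blast
    qed auto
  qed
  have 4: "run member ops \<nu> output_prog \<rho>1 (4 * (q * q)) 0 Q4" if Q: "Q3 \<rho>1" for \<rho>1
  proof -
    obtain X where X: "X \<in> carrier_mat q p" "products_post X \<rho>1" "\<rho>1 ''found'' [0] = 0 \<longleftrightarrow> locally_simple A"
      "locally_simple A \<longrightarrow> S * X * S = S"
      using Q unfolding Q3_def regular_def by blast
    show ?thesis by (rule run_weaken[OF output_prog_run[OF X(1,2)]]) (use X(3,4) in \<open>auto simp: Q4_def\<close>)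
  qed
  obtain a1 e1 \<rho>1 where E1: "exec member ops copy_prog (\<nu>, ?\<rho>) a1 e1 (\<nu>, \<rho>1)" "a1 \<le> p * q" "real e1 \<le> 0" "Q1 \<rho>1"
    using 1 unfolding run_def by blast
  obtain a2 e2 \<rho>2 where E2: "exec member ops core_prog (\<nu>, \<rho>1) a2 e2 (\<nu>, \<rho>2)" "a2 \<le> core_cost"
      "real e2 \<le> real (Suc L) * w T + real (Suc p) * w 1" "Q2 \<rho>2"
    using 2[OF E1(4)] unfolding run_def by blast
  obtain a3 e3 \<rho>3 where E3: "exec member ops check_prog (\<nu>, \<rho>2) a3 e3 (\<nu>, \<rho>3)" "a3 \<le> p * (q * 1)" "real e3 \<le> real p * (real q * w 0)" "Q3 \<rho>3"
    using 3[OF E2(4)] unfolding run_def by blast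
  obtain a4 e4 \<rho>4 where E4: "exec member ops output_prog (\<nu>, \<rho>3) a4 e4 (\<nu>, \<rho>4)" "a4 \<le> 4 * (q * q)" "real e4 \<le> 0" "Q4 \<rho>4"
    using 4[OF E3(4)] unfolding run_def by blast
  let ?y = "\<rho>4 ''found'' [0]" and ?v = "if locally_simple A then 1 else 0 :: nat"
  let ?M = "Member ''ok'' (RCell ''found'' [N0]) ''g'' N0 ''x''"
  have gens: "gens \<rho>4 ''g'' (nval N0 \<nu>) = []" by (simp add: gens_def)
  have y: "?y = 0 \<longleftrightarrow> locally_simple A" using E4(4) by (simp add: Q4_def)
  \<comment> \<open>The last test leaves its answer in \<open>ok\<close>. It changes a natural
    number variable and is therefore executed directly instead of through
    \<open>run\<close>.\<close>
  have E5: "exec member ops ?M (\<nu>, \<rho>4) 0 (ops ?y []) (\<nu>(''ok'' := ?v), \<rho>4)"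
  proof (cases "member ?y []")
    case None
    then show ?thesis
      using exec.MemberNo[of ?y "RCell ''found'' [N0]" \<nu> \<rho>4 "[]" "''g''" N0 member ops "''ok''" "''x''"] gens member_zero(1)[of ?y] y by simp
  next
    case (Some cs)
    then have "store_list ''x'' cs \<rho>4 = \<rho>4" using member_zero(2)[OF Some] by (simp add: store_list_def)
    moreover have "?y = 0" using Some member_zero(1)[of ?y] by auto
    ultimately show ?thesis
      using exec.MemberYes[of ?y "RCell ''found'' [N0]" \<nu> \<rho>4 "[]" "''g''" N0 member cs ops "''ok''" "''x''"] gens Some y by simp
  qed
  have "real (ops ?y []) \<le> w 0" using w[of ?y "[]"] by simp
  moreover have "correct_output A (\<nu>(''ok'' := ?v), \<rho>4)"
    using E4(4) A by (simp add: correct_output_def Q4_def Let_def)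
  ultimately show ?thesis
    using that[of "a1 + (a2 + (a3 + (a4 + 0)))" "e1 + (e2 + (e3 + (e4 + ops ?y [])))"]
      exec.Seq[OF E1(1) exec.Seq[OF E2(1) exec.Seq[OF E3(1) exec.Seq[OF E4(1) E5]]]] E1(2,3) E2(2,3) E3(2,3) E4(2,3)
    unfolding main_prog_def by (auto simp: algebra_simps)
qed

end

section \<open>Complexity\<close>

context input_program
begin

text \<open>With \<open>T \<le> 6 p q\<close>, the leading costs are of order
  \<open>p^4 T^2\<close>, that is \<open>p^6 q^2\<close>: the \<open>p^2\<close> matrix-vector
  products of truncated series in \<open>char_prog\<close> and the \<open>p\<close> matrix products
  in \<open>adj_prog\<close>. The constant 924 is the sum of those in the seven partial
  estimates.\<close>

lemma arith_bound:
  assumes p: "1 \<le> p"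
  shows "core_cost + 2 * (p * q) + 4 * (q * q) \<le> 924 * (p ^ 6 * q ^ 2)"
proof -
  have "p \<le> q" by (simp add: pq)
  then have q: "1 \<le> q" using p by simp
  have le: "p * p \<le> p * q" "p \<le> p * q" "1 \<le> p * q" using \<open>p \<le> q\<close> p q by (simp_all add: Suc_le_eq)
  have "L = 2 * (p * p) + 2 * (p * q)" by (simp add: algebra_simps)
  then have T: "T \<le> 6 * (p * q)" and L: "Suc L \<le> 5 * (p * q)" unfolding T_def using le by linarith+
  have P: "Suc p \<le> 2 * p" using p by simp
  note intros = add_mono mult_le_mono order_refl T L P
  let ?u = "p ^ 6 * q ^ 2"
  have mon: "p ^ i * q ^ j \<le> ?u" if "i \<le> 6" "j \<le> 2" for i j
    using that p q by (intro mult_le_mono power_increasing)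
  have gram: "p * (p * (T * (q * 2))) \<le> 12 * ?u"
  proof -
    have "p * (p * (T * (q * 2))) \<le> p * (p * (6 * (p * q) * (q * 2)))"
      by (intro intros)
    also have "\<dots> = 12 * (p ^ 3 * q ^ 2)" by (simp add: numeral_eq_Suc algebra_simps)
    also have "\<dots> \<le> 12 * ?u" using mon[of 3 2] by linarith
    finally show ?thesis .
  qed
  have char: "p * (p * T + p * char_step_cost) \<le> 108 * ?u"
  proof -
    have "p * (p * T + p * char_step_cost) \<le> p * (p * (6 * (p * q)) + p * (p * (6 * (p * q) * (p * (6 * (p * q)) * 2)) + p * (6 * (p * q)) + 4 * (6 * (p * q))))"
      unfolding char_step_cost_def by (intro intros)
    also have "\<dots> = 72 * (p ^ 6 * q ^ 2) + 6 * (p ^ 4 * q ^ 1) + 30 * (p ^ 3 * q ^ 1)" by (simp add: numeral_eq_Suc algebra_simps)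
    also have "\<dots> \<le> 108 * ?u" using mon[of 4 1] mon[of 3 1] by linarith
    finally show ?thesis .
  qed
  have adj: "p * (p * (p * (T * (p * T * 2))) + p * (p * (T * 2))) \<le> 84 * ?u"
  proof -
    have "p * (p * (p * (T * (p * T * 2))) + p * (p * (T * 2))) \<le> p * (p * (p * (6 * (p * q) * (p * (6 * (p * q)) * 2))) + p * (p * (6 * (p * q) * 2)))"
      by (intro intros)
    also have "\<dots> = 72 * (p ^ 6 * q ^ 2) + 12 * (p ^ 4 * q ^ 1)" by (simp add: numeral_eq_Suc algebra_simps)
    also have "\<dots> \<le> 84 * ?u" using mon[of 4 1] by linarith
    finally show ?thesis .
  qed
  have coeff: "Suc p * T + Suc p * (T * Suc p) \<le> 36 * ?u"
  proof -
    have "Suc p * T + Suc p * (T * Suc p) \<le> 2 * p * (6 * (p * q)) + 2 * p * (6 * (p * q) * (2 * p))"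
      by (intro intros)
    also have "\<dots> = 12 * (p ^ 2 * q ^ 1) + 24 * (p ^ 3 * q ^ 1)" by (simp add: numeral_eq_Suc algebra_simps)
    also have "\<dots> \<le> 36 * ?u" using mon[of 2 1] mon[of 3 1] by linarith
    finally show ?thesis .
  qed
  have test: "Suc L * test_cost \<le> 600 * ?u"
  proof -
    have "Suc L * test_cost \<le> 5 * (p * q) * (9 * (6 * (p * q) * (2 * p)) + 6 * (2 * p))"
      unfolding test_cost_def by (intro intros)
    also have "\<dots> = 540 * (p ^ 3 * q ^ 2) + 60 * (p ^ 2 * q ^ 1)" by (simp add: power2_eq_square power3_eq_cube algebra_simps)
    also have "\<dots> \<le> 600 * ?u" using mon[of 3 2] mon[of 2 1] by linarith
    finally show ?thesis .
  qed
  have inverse: "Suc p * (q * (p * (T * p * 3))) + q * (p * (Suc p * 3)) \<le> 42 * ?u"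
  proof -
    have "Suc p * (q * (p * (T * p * 3))) + q * (p * (Suc p * 3)) \<le> 2 * p * (q * (p * (6 * (p * q) * p * 3))) + q * (p * (2 * p * 3))"
      by (intro intros)
    also have "\<dots> = 36 * (p ^ 4 * q ^ 2) + 6 * (p ^ 2 * q ^ 1)" by (simp add: numeral_eq_Suc algebra_simps)
    also have "\<dots> \<le> 42 * ?u" using mon[of 4 2] mon[of 2 1] by linarith
    finally show ?thesis .
  qed
  have rest: "Suc p * 12 + products_cost + 2 * (p * q) + 4 * (q * q) \<le> 42 * ?u"
  proof -
    have "Suc p * 12 + products_cost + 2 * (p * q) + 4 * (q * q)
        = 12 * (p ^ 0 * q ^ 0) + 12 * (p ^ 1 * q ^ 0) + 6 * (p ^ 2 * q ^ 1) + 6 * (p ^ 1 * q ^ 2) + 2 * (p ^ 1 * q ^ 1) + 4 * (p ^ 0 * q ^ 2)"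
      by (simp add: products_cost_def numeral_eq_Suc algebra_simps)
    also have "\<dots> \<le> 42 * ?u"
      using mon[of 0 0] mon[of 1 0] mon[of 2 1] mon[of 1 2] mon[of 1 1] mon[of 0 2] by linarith
    finally show ?thesis .
  qed
  show ?thesis unfolding core_cost_def using gram char adj coeff test inverse rest by linarith
qed

end

definition setup_prog :: com where
  "setup_prog = Seq (If (BLess (NVar ''n'') (NVar ''m''))
       (Seq (NAssign ''p'' (NVar ''n'')) (NAssign ''q'' (NVar ''m'')))
       (Seq (NAssign ''p'' (NVar ''m'')) (NAssign ''q'' (NVar ''n''))))
     (Seq (NAssign ''c'' (NMul (NConst 2) (NAdd PP QQ)))
     (Seq (NAssign ''L'' (NMul (NVar ''c'') PP)) (NAssign ''T'' (NAdd (NAdd (NVar ''L'') PP) N1))))"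

lemma setup_prog_exec:
  fixes A :: "'a :: comm_ring_1 mat"
  assumes A: "A \<in> carrier_mat m n"
  obtains \<nu> where "exec member ops setup_prog (init_state A) 0 0 (\<nu>, snd (init_state A))"
    "env (min m n) (max m n) \<nu>" "\<nu> ''m'' = m" "\<nu> ''n'' = n"
proof -
  let ?\<rho> = "snd (init_state A)"
  define \<nu>0 where "\<nu>0 = (\<lambda>_. 0 :: nat)(''m'' := m, ''n'' := n)"
  define \<nu>1 where "\<nu>1 = \<nu>0(''p'' := min m n, ''q'' := max m n)"
  define \<nu>2 where "\<nu>2 = \<nu>1(''c'' := 2 * (min m n + max m n))"
  define \<nu>3 where "\<nu>3 = \<nu>2(''L'' := 2 * (min m n + max m n) * min m n)"
  define \<nu>4 where "\<nu>4 = \<nu>3(''T'' := 2 * (min m n + max m n) * min m n + min m n + 1)"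
  note defs = \<nu>4_def \<nu>3_def \<nu>2_def \<nu>1_def \<nu>0_def
  have init: "init_state A = (\<nu>0, ?\<rho>)" using A by (simp add: init_state_def \<nu>0_def)
  have assign: "exec member ops (NAssign x a) (\<mu>, ?\<rho>) 0 0 (\<mu>', ?\<rho>)" if "\<mu>' = \<mu>(x := nval a \<mu>)" for x a \<mu> \<mu>'
    using exec.NAssign[of member ops x a \<mu> ?\<rho>] that by simp
  have seq: "exec member ops (Seq P Q) \<sigma> 0 0 \<sigma>''" if "exec member ops P \<sigma> 0 0 \<sigma>'" "exec member ops Q \<sigma>' 0 0 \<sigma>''" for P Q \<sigma> \<sigma>' \<sigma>''
    using exec.Seq[OF that] by simp
  have 1: "exec member ops (If (BLess (NVar ''n'') (NVar ''m''))
       (Seq (NAssign ''p'' (NVar ''n'')) (NAssign ''q'' (NVar ''m'')))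
       (Seq (NAssign ''p'' (NVar ''m'')) (NAssign ''q'' (NVar ''n'')))) (\<nu>0, ?\<rho>) 0 0 (\<nu>1, ?\<rho>)"
  proof (cases "n < m")
    case True
    show ?thesis
      by (rule exec.IfTrue, simp add: \<nu>0_def True, rule seq, rule assign, rule refl, rule assign) (use True in \<open>auto simp: defs\<close>)
  next
    case False
    show ?thesis
      by (rule exec.IfFalse, simp add: \<nu>0_def False, rule seq, rule assign, rule refl, rule assign) (use False in \<open>auto simp: defs\<close>)
  qed
  have "exec member ops setup_prog (\<nu>0, ?\<rho>) 0 0 (\<nu>4, ?\<rho>)"
    unfolding setup_prog_def
    by (rule seq[OF 1 seq[OF assign[of \<nu>2] seq[OF assign[of \<nu>3] assign]]]) (simp_all add: defs)
  moreover have "env (min m n) (max m n) \<nu>4" "\<nu>4 ''m'' = m" "\<nu>4 ''n'' = n" by (simp_all add: env_def defs)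
  ultimately show ?thesis using that init by metis
qed

lemma inversion_exec:
  fixes A :: "'a :: comm_ring_1 mat"
  assumes sd: "strongly_discrete member" and w: "\<And>x xs. real (ops x xs) \<le> w (length xs)" and A: "A \<in> carrier_mat m n"
  defines "p \<equiv> min m n" and "q \<equiv> max m n"
  obtains a e \<sigma> where "exec member ops (Seq setup_prog main_prog) (init_state A) a e \<sigma>" "correct_output A \<sigma>"
    "1 \<le> p \<Longrightarrow> a \<le> 924 * (p ^ 6 * q ^ 2)"
    "real e \<le> real (Suc (2 * (p + q) * p)) * w (2 * (p + q) * p + p + 1) + real (Suc p) * w 1 + real (Suc (p * q)) * w 0"
proof -
  obtain \<nu> where \<nu>: "exec member ops setup_prog (init_state A) 0 0 (\<nu>, snd (init_state A))"
    "env p q \<nu>" "\<nu> ''m'' = m" "\<nu> ''n'' = n"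
    using setup_prog_exec[OF A, of member ops] unfolding p_def q_def by blast
  interpret input_program member ops w \<nu> p q "if n < m then transpose_mat A else A" A m n
    by unfold_locales (use w sd \<nu> A in \<open>auto simp: p_def q_def\<close>)
  obtain a e \<sigma> where E: "exec member ops main_prog (\<nu>, snd (init_state A)) a e \<sigma>" "correct_output A \<sigma>"
    "a \<le> core_cost + 2 * (p * q) + 4 * (q * q)"
    "real e \<le> real (Suc L) * w T + real (Suc p) * w 1 + real (Suc (p * q)) * w 0"
    by (rule main_prog_exec)
  show ?thesis
    using that[OF _ E(2), of "0 + a" "0 + e"] exec.Seq[OF \<nu>(1) E(1)] E(3,4) arith_bound unfolding T_def by fastforce
qed

text \<open>The numbers of tests are at most \<open>5 p q\<close>, \<open>2 p q\<close> and
  \<open>2 p q\<close>, hence the factor 9. None has more than \<open>6 p q \<le> 6 q^2\<close>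
  generators, whence \<open>6 powr s\<close> and \<open>q powr (2 * s)\<close>.\<close>

lemma elementary_bound:
  fixes p q :: nat and K s :: real
  assumes p: "1 \<le> p" "p \<le> q" and s: "0 \<le> s" and K: "0 \<le> K"
  defines "w \<equiv> \<lambda>k. K * real (max 1 k) powr s"
  shows "real (Suc (2 * (p + q) * p)) * w (2 * (p + q) * p + p + 1) + real (Suc p) * w 1 + real (Suc (p * q)) * w 0
    \<le> 9 * K * 6 powr s * (real p * real q powr (2 * s + 1))"
proof -
  let ?T = "2 * (p + q) * p + p + 1"
  define W where "W = K * (6 powr s * real q powr (2 * s))"
  have q: "1 \<le> q" using p by simp
  have le: "p * p \<le> p * q" "p \<le> p * q" "1 \<le> p * q" "p * q \<le> q * q" using p q by (simp_all add: Suc_le_eq)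
  have L: "2 * (p + q) * p = 2 * (p * p) + 2 * (p * q)" by (simp add: algebra_simps)
  have mono: "w k \<le> W" if "k \<le> 6 * (q * q)" for k
  proof -
    have "1 \<le> 6 * (q * q)" using le by linarith
    then have "max 1 k \<le> 6 * (q * q)" using that by simp
    then have "real (max 1 k) \<le> 6 * (real q * real q)" by (metis of_nat_le_iff of_nat_mult of_nat_numeral)
    then have "real (max 1 k) powr s \<le> (6 * (real q * real q)) powr s" using s by (intro powr_mono2) auto
    also have "\<dots> = 6 powr s * real q powr (2 * s)"
      by (simp add: powr_mult powr_add[symmetric])
    finally show ?thesis unfolding w_def W_def by (rule mult_left_mono[OF _ K])
  qed
  have W: "0 \<le> W" unfolding W_def using K by simp
  have "?T \<le> 6 * (q * q)" "1 \<le> 6 * (q * q)" "0 \<le> 6 * (q * q)" unfolding L using le by linarith+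
  then have "w ?T \<le> W" "w 1 \<le> W" "w 0 \<le> W" using mono by blast+
  then have "real (Suc (2 * (p + q) * p)) * w ?T + real (Suc p) * w 1 + real (Suc (p * q)) * w 0
      \<le> real (Suc (2 * (p + q) * p)) * W + real (Suc p) * W + real (Suc (p * q)) * W"
    by (intro add_mono mult_left_mono) auto
  also have "\<dots> = real (Suc (2 * (p + q) * p) + Suc p + Suc (p * q)) * W" by (simp add: algebra_simps)
  also have "\<dots> \<le> real (9 * (p * q)) * W"
  proof (intro mult_right_mono W of_nat_mono)
    show "Suc (2 * (p + q) * p) + Suc p + Suc (p * q) \<le> 9 * (p * q)" unfolding L using le by linarith
  qed
  also have "\<dots> = 9 * K * 6 powr s * (real p * real q powr (2 * s + 1))"
    using q by (simp add: W_def powr_add algebra_simps)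
  finally show ?thesis .
qed

theorem mainTheorem6:
  fixes member :: "'a :: comm_ring_1 \<Rightarrow> 'a list \<Rightarrow> 'a list option"
    and ops :: "'a \<Rightarrow> 'a list \<Rightarrow> nat"
  assumes "strongly_discrete member"
  shows "\<exists>P.
    (\<forall>m n. \<forall>A \<in> carrier_mat m n.
       \<exists>a e \<sigma>. exec member ops P (init_state A) a e \<sigma> \<and> correct_output A \<sigma>) \<and>
    (\<forall>s\<ge>0. O_strongly_discrete ops s \<longrightarrow>
       (\<exists>C. \<forall>m\<ge>1. \<forall>n\<ge>1. \<forall>A \<in> carrier_mat m n. \<forall>a e \<sigma>.
          exec member ops P (init_state A) a e \<sigma> \<longrightarrow>
          (let p = real (min m n); q = real (max m n) in
             real a \<le> C * (p ^ 6 * q ^ 2 + p * q ^ 4) \<and>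
             real e \<le> C * (p ^ 4 * q + p * q powr (2 * s + 1)))))"
proof (intro exI[of _ "Seq setup_prog main_prog"] conjI allI ballI impI)
  fix m n and A :: "'a mat" assume "A \<in> carrier_mat m n"
  \<comment> \<open>For arbitrary \<open>ops\<close> the cost of a test may be unbounded in the
    number of generators, so the run is taken with zero counts and transferred by
    \<open>exec_change_ops\<close>.\<close>
  then obtain a e \<sigma> where "exec member (\<lambda>_ _. 0) (Seq setup_prog main_prog) (init_state A) a e \<sigma>" "correct_output A \<sigma>"
    by (rule inversion_exec[OF assms, of "\<lambda>_ _. 0" "\<lambda>_. 0", rotated]) simp_all
  then show "\<exists>a e \<sigma>. exec member ops (Seq setup_prog main_prog) (init_state A) a e \<sigma> \<and> correct_output A \<sigma>"
    using exec_change_ops by blast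
next
  fix s :: real assume s: "0 \<le> s" and "O_strongly_discrete ops s"
  then obtain K where K: "\<And>x xs. real (ops x xs) \<le> K * real (max 1 (length xs)) powr s"
    unfolding O_strongly_discrete_def by blast
  have K0: "0 \<le> K" using order_trans[OF of_nat_0_le_iff K[of 0 "[]"]] by simp
  show "\<exists>C. \<forall>m\<ge>1. \<forall>n\<ge>1. \<forall>A \<in> carrier_mat m n. \<forall>a e \<sigma>.
          exec member ops (Seq setup_prog main_prog) (init_state A) a e \<sigma> \<longrightarrow>
          (let p = real (min m n); q = real (max m n) in
             real a \<le> C * (p ^ 6 * q ^ 2 + p * q ^ 4) \<and>
             real e \<le> C * (p ^ 4 * q + p * q powr (2 * s + 1)))"
  proof (intro exI[of _ "924 + 9 * K * 6 powr s"] allI ballI impI)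
    fix m n a e and A :: "'a mat" and \<sigma> assume mn: "1 \<le> m" "1 \<le> n" and A: "A \<in> carrier_mat m n"
      and ex: "exec member ops (Seq setup_prog main_prog) (init_state A) a e \<sigma>"
    let ?p = "min m n" and ?q = "max m n" and ?C = "924 + 9 * K * 6 powr s"
    have p: "1 \<le> ?p" "?p \<le> ?q" using mn by auto
    obtain a' e' \<sigma>' where run: "exec member ops (Seq setup_prog main_prog) (init_state A) a' e' \<sigma>'"
      and a: "a' \<le> 924 * (?p ^ 6 * ?q ^ 2)"
      and e: "real e' \<le> 9 * K * 6 powr s * (real ?p * real ?q powr (2 * s + 1))"
      by (rule inversion_exec[OF assms, of ops "\<lambda>k. K * real (max 1 k) powr s", OF K A])
         (use elementary_bound[OF p s K0] p(1) in \<open>blast intro: order_trans\<close>)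
    \<comment> \<open>The estimates were obtained for one run; determinism carries them over to the
      given one.\<close>
    have eq: "a = a'" "e = e'" using exec_deterministic[OF ex run] by simp_all
    have "real a \<le> real (924 * (?p ^ 6 * ?q ^ 2))" unfolding eq using a by (rule of_nat_mono)
    also have "\<dots> = 924 * (real ?p ^ 6 * real ?q ^ 2)" by simp
    also have "\<dots> \<le> ?C * (real ?p ^ 6 * real ?q ^ 2 + real ?p * real ?q ^ 4)"
      using K0 by (intro mult_mono) auto
    finally have "real a \<le> ?C * (real ?p ^ 6 * real ?q ^ 2 + real ?p * real ?q ^ 4)" .
    moreover have "real e \<le> ?C * (real ?p ^ 4 * real ?q + real ?p * real ?q powr (2 * s + 1))"
      unfolding eq by (rule order_trans[OF e]) (use K0 in \<open>auto intro!: mult_mono\<close>)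
    ultimately show "let p = real ?p; q = real ?q in
             real a \<le> ?C * (p ^ 6 * q ^ 2 + p * q ^ 4) \<and>
             real e \<le> ?C * (p ^ 4 * q + p * q powr (2 * s + 1))"
      unfolding Let_def ..
  qed
qed

end
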